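(* Consider the $q$-Racah measure on lozenge tilings (equivalently, nonintersecting path ensembles) of the hexagon with side lengths $a,b,c,a,b,c$, and put $N=a$, $T=b+c$, $S=c$. Assume that the side lengths scale proportionally with a parameter $L\to+\infty$, that is, $T=\lfloor L\mathsf T\rfloor$, $S=\lfloor L\mathsf S\rfloor$, $N=\lfloor L\mathsf N\rfloor$ with $\mathsf T>\mathsf S>0$ and $0<\mathsf N<\mathsf T$, while the parameters $q\in(0,1)$ and $\kappa\in\mathbf i\mathbb R_{>0}$ remain fixed. Then the fixed-slice correlation kernel $K_t$ converges either to zero or to the identity operator, depending on the scaled location $(\mathsf t,\mathsf x)$: $$\lim_{L\to+\infty}K_{\lfloor L\mathsf t\rfloor}\bigl(\lfloor L\mathsf x\rfloor+\Delta x,\lfloor L\mathsf x\rfloor+\Delta y\bigr)=\begin{cases}\mathbf 1_{\Delta x=\Delta y},&\text{if }(\mathsf t,\mathsf x)\in\mathcal W,\\ 0,&\text{otherwise,}\end{cases}\qquad\text{for all fixed }\Delta x,\Delta y\in\mathbb Z.$$ Moreover, the probability of finding a horizontal lozenge inside $\mathcal W$ or a square or vertical lozenge outside $\mathcal W$ decays exponentially fast in $L$.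
   Context: Model. For integers $T>S>0$, $N\ge1$, consider ensembles of $N$ nonintersecting lattice paths with steps $(t,x)\to(t+1,x)$ or $(t,x)\to(t+1,x+1)$, starting at $(0,0),\dots,(0,N-1)$ and ending at $(T,S),\dots,(T,S+N-1)$; they are in bijection with lozenge tilings of the hexagon. Let $X(t)=(x_1(t)<\dots<x_N(t))$ be the path positions at time $t$; they lie in the slice $I_t=\{x\in\mathbb Z:\max(0,t+S-T)\le x\le\min(t+N-1,S+N-1)\}$. A hole is a point $(t,x)$ with $x\in I_t\setminus X(t)$; holes correspond to horizontal lozenges, path points to square or vertical lozenges. The $q$-Racah measure assigns to each ensemble probability proportional to $\prod_{\text{holes }(t,x)}\mathsf w(x-\tfrac t2+1)$, $\mathsf w(j)=\kappa q^{j-(S+1)/2}-\bigl(\kappa q^{j-(S+1)/2}\bigr)^{-1}$ (after normalization this is a probability measure). Kernel. Let $w_t$ be the positive weight on $I_t$ determined up to a constant by $$\frac{w_t(x)}{w_t(x+1)}=\frac{q(1-q^{x+1})(q^S-\kappa^2q^{N+x+1})(q^t-\kappa^2q^{N+x+1})(q^{S+t}-\kappa^2q^{2x+1})(q^{S+t}-q^{T+x+1})}{(q^T-\kappa^2q^{x+1})(q^{N+S}-q^{x+1})(q^{N+t}-q^{x+1})(q^{S+t}-\kappa^2q^{x+1})(q^{S+t}-\kappa^2q^{2x+3})},$$ and $\mu_t(x)=q^{-x}+\kappa^2q^{x+1-S-t}$. The law of $X(t)$ is the $q$-Racah orthogonal polynomial ensemble, with probabilities proportional to $\prod_{i<j}(\mu_t(x_i)-\mu_t(x_j))^2\prod_iw_t(x_i)$.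 The fixed-slice correlation kernel $K_t(x,y)$ is the kernel of the orthogonal projection in $\ell^2(I_t)$ onto the span of $\mu_t(x)^m\sqrt{w_t(x)}$, $m=0,\dots,N-1$; the correlation functions of $X(t)$ are $\det[K_t(x_i,x_j)]$. Waterfall region. Let $\mathcal H=\{(\mathsf t,\mathsf x):0<\mathsf t<\mathsf T,\ \max(0,\mathsf t-\mathsf T+\mathsf S)<\mathsf x<\min(\mathsf S+\mathsf N,\mathsf t+\mathsf N)\}$ be the scaled hexagon, $\mathsf t_l=|\mathsf N-\mathsf S|$, $\mathsf t_r=\min(\mathsf N+\mathsf S,2\mathsf T-\mathsf N-\mathsf S)$. Then $\mathcal W=\{(\mathsf t,\mathsf x)\in\mathcal H:\mathsf t_l<\mathsf t<\mathsf t_r,\ |2\mathsf x-\mathsf S-\mathsf t|<\mathsf N\}$. Here $\mathbf 1_A$ is the indicator of $A$.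
   Formalization: The zero limit and the bound for square/vertical lozenges are claimed only off the closed length-N band filled by the paths (it includes the boundary of W and frozen parts at times t≤t_l or t≥t_r, where the zero limit fails); exponential decay is stated on compact subsets of the regions. *)

theory Defs
  imports "HOL-Analysis.Analysis"
begin

text \<open>All lattice data (\<open>N\<close>, \<open>T\<close>, \<open>S\<close>, the time \<open>t\<close> and the position \<open>x\<close>) are integers.
  Paths are indexed by \<open>0, \<dots>, N - 1\<close>.\<close>

definition slice :: "int \<Rightarrow> int \<Rightarrow> int \<Rightarrow> int \<Rightarrow> int set" where
  "slice N T S t = {max 0 (t + S - T)..min (t + N - 1) (S + N - 1)}"


section \<open>The q-Racah measure on nonintersecting path ensembles\<close>

text \<open>\<open>p i t\<close> is the position of the \<open>i\<close>-th path at time \<open>t\<close>. The bound \<open>{0..S + N - 1}\<close> on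
  positions is automatic from the end points and the steps; together with extensionality it makes
  the set of ensembles finite.\<close>

definition path_ensembles :: "int \<Rightarrow> int \<Rightarrow> int \<Rightarrow> (int \<Rightarrow> int \<Rightarrow> int) set" where
  "path_ensembles N T S =
     {p \<in> {0..<N} \<rightarrow>\<^sub>E ({0..T} \<rightarrow>\<^sub>E {0..S + N - 1}).
        (\<forall>i\<in>{0..<N}. p i 0 = i \<and> p i T = S + i \<and>
           (\<forall>t\<in>{0..<T}. p i (t + 1) = p i t \<or> p i (t + 1) = p i t + 1)) \<and>
        (\<forall>t\<in>{0..T}. strict_mono_on {0..<N} (\<lambda>i. p i t))}"

lemma finite_path_ensembles: "finite (path_ensembles N T S)"
proof -
  have "finite ({0..<N} \<rightarrow>\<^sub>E ({0..T} \<rightarrow>\<^sub>E {0..S + N - 1}))"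
    by (intro finite_PiE) auto
  then show ?thesis
    by (rule finite_subset[rotated]) (auto simp: path_ensembles_def)
qed

definition positions :: "int \<Rightarrow> (int \<Rightarrow> int \<Rightarrow> int) \<Rightarrow> int \<Rightarrow> int set" where
  "positions N p t = (\<lambda>i. p i t) ` {0..<N}"

definition holes :: "int \<Rightarrow> int \<Rightarrow> int \<Rightarrow> (int \<Rightarrow> int \<Rightarrow> int) \<Rightarrow> int \<Rightarrow> int set" where
  "holes N T S p t = slice N T S t - positions N p t"

definition hole_weight :: "int \<Rightarrow> real \<Rightarrow> complex \<Rightarrow> real \<Rightarrow> complex" where
  "hole_weight S q \<kappa> j =
     \<kappa> * of_real (q powr (j - (of_int S + 1) / 2))
     - inverse (\<kappa> * of_real (q powr (j - (of_int S + 1) / 2)))"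

definition ensemble_weight ::
    "int \<Rightarrow> int \<Rightarrow> int \<Rightarrow> real \<Rightarrow> complex \<Rightarrow> (int \<Rightarrow> int \<Rightarrow> int) \<Rightarrow> complex" where
  "ensemble_weight N T S q \<kappa> p =
     (\<Prod>t\<in>{0..T}. \<Prod>x\<in>holes N T S p t. hole_weight S q \<kappa> (of_int x - of_int t / 2 + 1))"

text \<open>For \<open>\<kappa> \<in> \<i>\<real>\<^sub>>\<^sub>0\<close> each hole weight is \<open>\<i>\<close> times a positive real, and the number of holes
  does not depend on the ensemble. Hence the powers of \<open>\<i>\<close> cancel in the quotient, which is a real
  number in \<open>[0, 1]\<close>; \<open>Re\<close> only changes the type.\<close>

definition qRacah_prob ::
    "int \<Rightarrow> int \<Rightarrow> int \<Rightarrow> real \<Rightarrow> complex \<Rightarrow> ((int \<Rightarrow> int \<Rightarrow> int) \<Rightarrow> bool) \<Rightarrow> real" where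
  "qRacah_prob N T S q \<kappa> E =
     Re ((\<Sum>p\<in>{p \<in> path_ensembles N T S. E p}. ensemble_weight N T S q \<kappa> p) /
         (\<Sum>p\<in>path_ensembles N T S. ensemble_weight N T S q \<kappa> p))"


section \<open>The fixed-slice correlation kernel\<close>

text \<open>Below, \<open>\<kappa>2\<close> stands for \<open>\<kappa>\<^sup>2\<close>, which is a (negative) real number for \<open>\<kappa> \<in> \<i>\<real>\<^sub>>\<^sub>0\<close>.\<close>

definition weight_ratio :: "int \<Rightarrow> int \<Rightarrow> int \<Rightarrow> real \<Rightarrow> real \<Rightarrow> int \<Rightarrow> int \<Rightarrow> real" where
  "weight_ratio N T S q \<kappa>2 t x =
     (q * (1 - q powi (x + 1))
        * (q powi S - \<kappa>2 * q powi (N + x + 1))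
        * (q powi t - \<kappa>2 * q powi (N + x + 1))
        * (q powi (S + t) - \<kappa>2 * q powi (2 * x + 1))
        * (q powi (S + t) - q powi (T + x + 1))) /
     ((q powi T - \<kappa>2 * q powi (x + 1))
        * (q powi (N + S) - q powi (x + 1))
        * (q powi (N + t) - q powi (x + 1))
        * (q powi (S + t) - \<kappa>2 * q powi (x + 1))
        * (q powi (S + t) - \<kappa>2 * q powi (2 * x + 3)))"

text \<open>The weight with \<open>w x / w (x + 1) = weight_ratio x\<close>, normalized to be \<open>1\<close> at the left end
  of the slice. The kernel does not depend on this normalization.\<close>

definition slice_weight :: "int \<Rightarrow> int \<Rightarrow> int \<Rightarrow> real \<Rightarrow> real \<Rightarrow> int \<Rightarrow> int \<Rightarrow> real" where
  "slice_weight N T S q \<kappa>2 t x =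
     (\<Prod>y\<in>{max 0 (t + S - T)..<x}. inverse (weight_ratio N T S q \<kappa>2 t y))"

definition slice_mu :: "int \<Rightarrow> real \<Rightarrow> real \<Rightarrow> int \<Rightarrow> int \<Rightarrow> real" where
  "slice_mu S q \<kappa>2 t x = q powi (-x) + \<kappa>2 * q powi (x + 1 - S - t)"

text \<open>Elements of \<open>\<ell>\<^sup>2(I)\<close>, for a finite set \<open>I\<close>, are functions on the integers vanishing
  outside \<open>I\<close>.\<close>

definition qRacah_span :: "int \<Rightarrow> int \<Rightarrow> int \<Rightarrow> real \<Rightarrow> real \<Rightarrow> int \<Rightarrow> (int \<Rightarrow> real) set" where
  "qRacah_span N T S q \<kappa>2 t =
     {f. \<exists>c :: nat \<Rightarrow> real.
        f = (\<lambda>x. if x \<in> slice N T S t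
                 then \<Sum>m<nat N. c m * (slice_mu S q \<kappa>2 t x ^ m * sqrt (slice_weight N T S q \<kappa>2 t x))
                 else 0)}"

definition orth_proj :: "int set \<Rightarrow> (int \<Rightarrow> real) set \<Rightarrow> (int \<Rightarrow> real) \<Rightarrow> int \<Rightarrow> real" where
  "orth_proj I V f = (THE g. g \<in> V \<and> (\<forall>v\<in>V. (\<Sum>x\<in>I. (f x - g x) * v x) = 0))"

text \<open>The kernel \<open>K x y\<close> of an operator \<open>P\<close> on \<open>\<ell>\<^sup>2(I)\<close> is the value at \<open>x\<close> of \<open>P\<close> applied to the
  unit vector at \<open>y\<close>. It vanishes if \<open>x\<close> or \<open>y\<close> is not in the slice.\<close>

definition corr_kernel ::
    "int \<Rightarrow> int \<Rightarrow> int \<Rightarrow> real \<Rightarrow> complex \<Rightarrow> int \<Rightarrow> int \<Rightarrow> int \<Rightarrow> real" where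
  "corr_kernel N T S q \<kappa> t x y =
     orth_proj (slice N T S t) (qRacah_span N T S q (Re (\<kappa>\<^sup>2)) t) (\<lambda>z. if z = y then 1 else 0) x"


section \<open>The scaled hexagon and the waterfall region\<close>

definition hexagon :: "real \<Rightarrow> real \<Rightarrow> real \<Rightarrow> (real \<times> real) set" where
  "hexagon N T S = {(t, x). 0 < t \<and> t < T \<and> max 0 (t - T + S) < x \<and> x < min (S + N) (t + N)}"

definition waterfall :: "real \<Rightarrow> real \<Rightarrow> real \<Rightarrow> (real \<times> real) set" where
  "waterfall N T S =
     {(t, x) \<in> hexagon N T S.
        \<bar>N - S\<bar> < t \<and> t < min (N + S) (2 * T - N - S) \<and> \<bar>2 * x - S - t\<bar> < N}"

text \<open>At each scaled time, the \<open>N\<close> paths concentrate on an interval of length \<open>N\<close> centered at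
  \<open>(S + t) / 2\<close>, shifted by the least amount needed to fit into the hexagon. The closed band swept
  out by these intervals is the following set. For times strictly between \<open>\<bar>N - S\<bar>\<close> and
  \<open>min (N + S) (2 * T - N - S)\<close> no shift is needed and the band is just the closure
  \<open>\<bar>2 * x - S - t\<bar> \<le> N\<close> of the waterfall region. For the remaining times it is the part of the
  hexagon adjacent to its left and right sides that is filled with paths although it does not belong
  to the waterfall region.\<close>

definition path_band :: "real \<Rightarrow> real \<Rightarrow> real \<Rightarrow> (real \<times> real) set" where
  "path_band N T S =
     {(t, x) \<in> hexagon N T S.
        let l = max (max 0 (t - T + S)) (min (min S t) ((S + t - N) / 2))
        in l \<le> x \<and> x \<le> l + N}"

end

theory Submission
  imports Defs "Jordan_Normal_Form.Determinant" "HOL-Computational_Algebra.Polynomial"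
    "HOL-Real_Asymp.Real_Asymp"
begin

text \<open>The partition function of the paths on either side of a slice is a Vandermonde determinant in
  \<open>\<mu>\<close> times a product of one-particle weights: one time step acts on each row of the determinant by an
  Askey-Wilson type difference operator, which is triangular on the powers of \<open>\<mu>\<close>. Hence the slice
  is distributed according to the q-Racah orthogonal polynomial ensemble.

  Let \<open>J\<close> be the interval of \<open>N\<close> sites nearest to the centre of the slice. Expanding the Lagrange
  basis of a configuration in the Lagrange basis of \<open>J\<close>, Cauchy-Schwarz bounds the probability of a
  particle at \<open>y \<notin> J\<close>, and that of a hole at \<open>z \<in> J\<close>, by the sum over \<open>z\<close>, respectively \<open>y\<close>, of the
  relative masses of the configurations \<open>J - {z} \<union> {y}\<close> times a polynomial factor; the same sums
  bound the distance of the projection kernel to \<open>0\<close> and to the identity. Since \<open>J\<close> is an interval,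
  these relative masses telescope: they are \<open>O(q ^ (d\<^sup>2))\<close>, up to \<open>exp (O (N + d))\<close>, if \<open>y\<close> has
  distance \<open>d\<close> from \<open>J\<close>, and in the waterfall region they are \<open>O(q ^ d)\<close> if \<open>z\<close> has distance \<open>d\<close> from
  the ends of \<open>J\<close>. The second bound is not dominated by a quadratic exponent, so there all factors
  have to be controlled up to a bounded multiplicative error.\<close>


section \<open>Vandermonde determinants, exchange of particles, and projection kernels\<close>

definition vandermonde :: "nat \<Rightarrow> (nat \<Rightarrow> real) \<Rightarrow> real" where
  "vandermonde n y = (\<Prod>i<n. \<Prod>k<i. y i - y k)"

lemma det_triangular_basis:
  fixes y :: "nat \<Rightarrow> real"
  shows "det (mat n n (\<lambda>(i, j). \<Sum>k\<le>j. c j k * y i ^ k)) =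
         (\<Prod>j<n. c j j) * det (mat n n (\<lambda>(i, j). y i ^ j))"
proof -
  define A where "A = mat n n (\<lambda>(i, j). y i ^ j)"
  define B where "B = mat n n (\<lambda>(k, j). if k \<le> j then c j k else 0)"
  have "mat n n (\<lambda>(i, j). \<Sum>k\<le>j. c j k * y i ^ k) = A * B"
  proof (rule eq_matI)
    fix i j assume ij: "i < dim_row (A * B)" "j < dim_col (A * B)"
    have "(A * B) $$ (i, j) = (\<Sum>k<n. y i ^ k * (if k \<le> j then c j k else 0))"
      using ij unfolding A_def B_def by (simp add: scalar_prod_def lessThan_atLeast0)
    also have "\<dots> = (\<Sum>k\<le>j. c j k * y i ^ k)"
      using ij by (intro sum.mono_neutral_cong_right) (auto simp: B_def)
    finally show "mat n n (\<lambda>(i, j). \<Sum>k\<le>j. c j k * y i ^ k) $$ (i, j) = (A * B) $$ (i, j)"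
      using ij by (simp add: A_def B_def)
  qed (auto simp: A_def B_def)
  moreover have "det B = (\<Prod>j<n. c j j)"
    by (subst det_upper_triangular[of _ n])
       (auto simp: B_def upper_triangular_def prod_list_diag_prod lessThan_atLeast0)
  moreover have "det (A * B) = det A * det B"
    by (rule det_mult[of _ n]) (auto simp: A_def B_def)
  ultimately show ?thesis by (simp add: A_def)
qed

lemma det_vandermonde: "det (mat n n (\<lambda>(i, j). y i ^ j)) = vandermonde n y"
proof -
  define p where "p j = (\<Prod>k<j. [:- y k, 1:])" for j
  have deg: "degree (p j) = j" for j
    unfolding p_def by (subst degree_prod_eq_sum_degree) auto
  have lc: "coeff (p j) j = 1" for j
    using lead_coeff_prod[of "\<lambda>k. [:- y k, 1:]" "{..<j}"] deg[of j] by (simp add: p_def)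
  have val: "(\<Sum>k\<le>j. coeff (p j) k * x ^ k) = (\<Prod>k<j. x - y k)" for j x
    using poly_altdef[of "p j" x] by (simp add: deg) (simp add: p_def poly_prod)
  have "det (mat n n (\<lambda>(i, j). y i ^ j)) =
        det (mat n n (\<lambda>(i, j). \<Sum>k\<le>j. coeff (p j) k * y i ^ k))"
    by (simp add: det_triangular_basis lc)
  also have "\<dots> = det (mat n n (\<lambda>(i, j). \<Prod>k<j. y i - y k))"
    by (simp add: val)
  also have "\<dots> = vandermonde n y"
    by (subst det_lower_triangular[of n])
       (auto simp: prod_list_diag_prod vandermonde_def lessThan_atLeast0 intro!: prod_zero)
  finally show ?thesis .
qed

lemma vandermonde_transform:
  fixes m :: "'a \<Rightarrow> real"
  assumes fin: "\<And>i. i < n \<Longrightarrow> finite (A i)"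
    and tr: "\<And>i k. i < n \<Longrightarrow> k < n \<Longrightarrow>
      (\<Sum>s\<in>A i. a i s * m s ^ k) = (\<Sum>k'\<le>k. c k k' * M i ^ k')"
  shows "(\<Sum>x\<in>PiE {..<n} A. (\<Prod>i<n. a i (x i)) * vandermonde n (\<lambda>i. m (x i))) =
         (\<Prod>j<n. c j j) * vandermonde n M"
proof -
  let ?P = "{p. p permutes {0..<n}}"
  have perm_less: "p i < n" if "p \<in> ?P" "i < n" for p i
    using that permutes_in_image[of p "{0..<n}" i] by auto
  have "(\<Sum>x\<in>PiE {..<n} A. (\<Prod>i<n. a i (x i)) * vandermonde n (\<lambda>i. m (x i))) =
      (\<Sum>x\<in>PiE {..<n} A. \<Sum>p\<in>?P. signof p * (\<Prod>i<n. a i (x i) * m (x i) ^ p i))"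
  proof (rule sum.cong[OF refl])
    fix x
    have "vandermonde n (\<lambda>i. m (x i)) = (\<Sum>p\<in>?P. signof p * (\<Prod>i<n. m (x i) ^ p i))"
      by (subst det_vandermonde[symmetric], subst det_def'[of _ n])
         (auto simp: lessThan_atLeast0 perm_less intro!: sum.cong prod.cong)
    then show "(\<Prod>i<n. a i (x i)) * vandermonde n (\<lambda>i. m (x i)) =
        (\<Sum>p\<in>?P. signof p * (\<Prod>i<n. a i (x i) * m (x i) ^ p i))"
      by (simp add: sum_distrib_left prod.distrib mult_ac)
  qed
  also have "\<dots> = (\<Sum>p\<in>?P. signof p * (\<Sum>x\<in>PiE {..<n} A. \<Prod>i<n. a i (x i) * m (x i) ^ p i))"
    by (subst sum.swap) (simp add: sum_distrib_left)
  also have "\<dots> = (\<Sum>p\<in>?P. signof p * (\<Prod>i<n. \<Sum>s\<in>A i. a i s * m s ^ p i))"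
    by (subst prod_sum_PiE) (use fin in auto)
  also have "\<dots> = (\<Sum>p\<in>?P. signof p * (\<Prod>i<n. \<Sum>k\<le>p i. c (p i) k * M i ^ k))"
    by (intro sum.cong refl arg_cong2[of _ _ _ _ "(*)"] prod.cong tr) (auto simp: perm_less)
  also have "\<dots> = det (mat n n (\<lambda>(i, j). \<Sum>k\<le>j. c j k * M i ^ k))"
    by (subst det_def'[of _ n])
       (auto simp: lessThan_atLeast0 perm_less intro!: sum.cong prod.cong)
  also have "\<dots> = (\<Prod>j<n. c j j) * vandermonde n M"
    by (simp add: det_triangular_basis det_vandermonde)
  finally show ?thesis .
qed

definition lagrange :: "('a \<Rightarrow> real) \<Rightarrow> 'a set \<Rightarrow> 'a \<Rightarrow> 'a \<Rightarrow> real" where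
  "lagrange m A a x = (\<Prod>b\<in>A - {a}. (m x - m b) / (m a - m b))"

lemma lagrange_poly:
  assumes "finite A" "a \<in> A"
  obtains p where "degree p < card A" "\<And>x. poly p (m x) = lagrange m A a x"
proof
  let ?p = "\<Prod>b\<in>A - {a}. Polynomial.smult (1 / (m a - m b)) [:- m b, 1:]"
  show "poly ?p (m x) = lagrange m A a x" for x
    by (simp add: poly_prod lagrange_def diff_divide_distrib)
  have "degree ?p \<le> (\<Sum>b\<in>A - {a}. degree (Polynomial.smult (1 / (m a - m b)) [:- m b, 1:]))"
    using assms(1) by (intro order.trans[OF degree_prod_sum_le]) auto
  also have "\<dots> \<le> (\<Sum>b\<in>A - {a}. 1)"
    by (intro sum_mono) (auto intro: order.trans[OF degree_smult_le])
  also have "\<dots> < card A"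
    using assms card_gt_0_iff[of A] by (auto simp: card_Diff_singleton)
  finally show "degree ?p < card A" .
qed

lemma lagrange_same:
  assumes "inj_on m A" "a \<in> A"
  shows "lagrange m A a a = 1"
proof -
  have "m a \<noteq> m b" if "b \<in> A - {a}" for b using that assms by (auto dest: inj_onD)
  then show ?thesis unfolding lagrange_def by (intro prod.neutral) auto
qed

lemma lagrange_other:
  assumes "finite A" "b \<in> A" "b \<noteq> a"
  shows "lagrange m A a b = 0"
  using assms by (auto simp: lagrange_def intro!: prod_zero bexI[of _ b])

lemma lagrange_interpolation:
  fixes p :: "real poly"
  assumes A: "finite A" "inj_on m A" and deg: "degree p < card A"
  shows "poly p (m u) = (\<Sum>a\<in>A. poly p (m a) * lagrange m A a u)"
proof -
  have "\<forall>a\<in>A. \<exists>l. degree l < card A \<and> (\<forall>x. poly l (m x) = lagrange m A a x)"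
    using lagrange_poly[OF A(1)] by metis
  then obtain l where l: "\<And>a. a \<in> A \<Longrightarrow> degree (l a) < card A"
      "\<And>a x. a \<in> A \<Longrightarrow> poly (l a) (m x) = lagrange m A a x"
    by metis
  define r where "r = p - (\<Sum>a\<in>A. Polynomial.smult (poly p (m a)) (l a))"
  have "degree (l a) \<le> card A - 1" if "a \<in> A" for a
    using l(1)[OF that] by linarith
  then have "degree r \<le> card A - 1"
    unfolding r_def using deg A(1)
    by (intro degree_diff_le degree_sum_le order.trans[OF degree_smult_le]) auto
  then have deg_r: "degree r < card A" using deg by linarith
  have "r = 0"
  proof (rule ccontr)
    assume "r \<noteq> 0"
    have "poly r (m c) = 0" if "c \<in> A" for c
    proof -
      have "(\<Sum>a\<in>A. poly p (m a) * poly (l a) (m c)) = (\<Sum>a\<in>A. if a = c then poly p (m c) else 0)"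
        using that A by (intro sum.cong) (auto simp: l(2) lagrange_same lagrange_other)
      then show ?thesis using that A(1) by (simp add: r_def poly_sum)
    qed
    then have "m ` A \<subseteq> {x. poly r x = 0}" by auto
    then have "card (m ` A) \<le> card {x. poly r x = 0}"
      by (rule card_mono[OF poly_roots_finite[OF \<open>r \<noteq> 0\<close>]])
    also have "\<dots> \<le> degree r" by (rule card_poly_roots_bound[OF \<open>r \<noteq> 0\<close>])
    finally show False using deg_r by (simp add: card_image[OF A(2)])
  qed
  then have "poly r (m u) = 0" by simp
  then show ?thesis by (simp add: r_def poly_sum l(2))
qed

definition ope_mass :: "('a \<Rightarrow> real) \<Rightarrow> ('a \<Rightarrow> real) \<Rightarrow> 'a set \<Rightarrow> real" where
  "ope_mass w m X = (\<Prod>a\<in>X. w a) * (\<Prod>a\<in>X. \<Prod>b\<in>X - {a}. \<bar>m a - m b\<bar>)"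

definition exchange_ratio :: "('a \<Rightarrow> real) \<Rightarrow> ('a \<Rightarrow> real) \<Rightarrow> 'a set \<Rightarrow> 'a \<Rightarrow> 'a \<Rightarrow> real" where
  "exchange_ratio w m A a x = w x / w a * (lagrange m A a x)\<^sup>2"

lemma ope_mass_insert:
  assumes "finite Y" "a \<notin> Y"
  shows "ope_mass w m (insert a Y) = w a * (\<Prod>b\<in>Y. m a - m b)\<^sup>2 * ope_mass w m Y"
proof -
  have "(\<Prod>c\<in>insert a Y. \<Prod>b\<in>insert a Y - {c}. \<bar>m c - m b\<bar>) =
        (\<Prod>b\<in>Y. \<bar>m a - m b\<bar>) * (\<Prod>c\<in>Y. \<bar>m c - m a\<bar> * (\<Prod>b\<in>Y - {c}. \<bar>m c - m b\<bar>))"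
  proof -
    have "(\<Prod>b\<in>insert a Y - {c}. \<bar>m c - m b\<bar>) = \<bar>m c - m a\<bar> * (\<Prod>b\<in>Y - {c}. \<bar>m c - m b\<bar>)"
      if "c \<in> Y" for c
    proof -
      have "insert a Y - {c} = insert a (Y - {c})" using that assms by auto
      then show ?thesis using assms by simp
    qed
    moreover have "insert a Y - {a} = Y" using assms by auto
    ultimately show ?thesis using assms by simp
  qed
  also have "\<dots> = (\<Prod>b\<in>Y. m a - m b)\<^sup>2 * (\<Prod>c\<in>Y. \<Prod>b\<in>Y - {c}. \<bar>m c - m b\<bar>)"
  proof -
    have "(\<Prod>c\<in>Y. \<bar>m c - m a\<bar>) = (\<Prod>b\<in>Y. \<bar>m a - m b\<bar>)"
      by (simp add: abs_minus_commute)
    moreover have "(\<Prod>b\<in>Y. \<bar>m a - m b\<bar>) * (\<Prod>b\<in>Y. \<bar>m a - m b\<bar>) = (\<Prod>b\<in>Y. m a - m b)\<^sup>2"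
      by (simp add: abs_prod[symmetric] power2_eq_square[symmetric])
    ultimately show ?thesis by (simp add: prod.distrib)
  qed
  finally show ?thesis using assms by (simp add: ope_mass_def)
qed

lemma ope_mass_nonneg: "(\<And>x. x \<in> X \<Longrightarrow> 0 \<le> w x) \<Longrightarrow> 0 \<le> ope_mass w m X"
  unfolding ope_mass_def by (intro mult_nonneg_nonneg prod_nonneg) auto

lemma ope_mass_exchange:
  assumes "finite X" "y \<in> X" "z \<notin> X" "inj_on m X" "w y \<noteq> 0"
  shows "ope_mass w m (insert z (X - {y})) = ope_mass w m X * (w z / w y) * (lagrange m X y z)\<^sup>2"
proof -
  define Y where "Y = X - {y}"
  have X: "X = insert y Y" "y \<notin> Y" "finite Y" "z \<notin> Y" using assms by (auto simp: Y_def)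
  have "(\<Prod>b\<in>Y. m y - m b) \<noteq> 0"
    using assms X by (auto simp: inj_on_def)
  then show ?thesis
    unfolding Y_def[symmetric] lagrange_def using X assms(5)
    by (simp add: ope_mass_insert prod_dividef power_divide)
qed

text \<open>Both directions of the exchange argument expand the Lagrange basis of one node set in the
  Lagrange basis of the other.\<close>

lemma lagrange_expand:
  assumes "finite A" "finite X" "inj_on m X" "card A = card X" "a \<in> A"
  shows "lagrange m A a u = (\<Sum>x\<in>X. lagrange m A a x * lagrange m X x u)"
proof -
  obtain p where p: "degree p < card A" "\<And>x. poly p (m x) = lagrange m A a x"
    using lagrange_poly[OF assms(1,5)] by blast
  show ?thesis
    using lagrange_interpolation[of X m p u] assms p by simp
qed

lemma weighted_cauchy_schwarz:
  fixes f g u :: "'a \<Rightarrow> real"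
  assumes "finite A" "\<And>a. a \<in> A \<Longrightarrow> 0 < u a"
  shows "(\<Sum>a\<in>A. f a * g a)\<^sup>2 \<le> (\<Sum>a\<in>A. u a * (f a)\<^sup>2) * (\<Sum>a\<in>A. inverse (u a) * (g a)\<^sup>2)"
proof -
  have "(\<Sum>a\<in>A. f a * g a) = (\<Sum>a\<in>A. (sqrt (u a) * f a) * (g a / sqrt (u a)))"
    using assms(2) by (intro sum.cong) (auto simp: less_imp_neq[symmetric])
  then have "(\<Sum>a\<in>A. f a * g a)\<^sup>2 \<le>
      (\<Sum>a\<in>A. (sqrt (u a) * f a)\<^sup>2) * (\<Sum>a\<in>A. (g a / sqrt (u a))\<^sup>2)"
    by (metis Cauchy_Schwarz_ineq_sum)
  also have "\<dots> = (\<Sum>a\<in>A. u a * (f a)\<^sup>2) * (\<Sum>a\<in>A. inverse (u a) * (g a)\<^sup>2)"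
    using assms(2) less_imp_le
    by (intro arg_cong2[of _ _ _ _ "(*)"] sum.cong)
       (auto simp: power_mult_distrib power_divide field_simps less_imp_le)
  finally show ?thesis .
qed

locale ope =
  fixes I :: "'a set" and w m :: "'a \<Rightarrow> real" and J :: "'a set"
  assumes I: "finite I" and w_pos: "\<And>x. x \<in> I \<Longrightarrow> 0 < w x" and m_inj: "inj_on m I"
    and J: "J \<subseteq> I" "J \<noteq> {}"
begin

definition configs :: "'a set set" where
  "configs = {X. X \<subseteq> I \<and> card X = card J}"

definition total_mass :: real where
  "total_mass = (\<Sum>X\<in>configs. ope_mass w m X)"

lemma finite_configs: "finite configs"
  using I by (auto simp: configs_def)

lemma finite_J: "finite J"
  using I J finite_subset by blast

lemma inj_J: "inj_on m J"
  using m_inj J inj_on_subset by blast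

lemma configsD:
  assumes "X \<in> configs"
  shows "X \<subseteq> I" "finite X" "card X = card J" "inj_on m X"
  using assms I m_inj by (auto simp: configs_def intro: finite_subset inj_on_subset)

lemma mass_nonneg: "X \<in> configs \<Longrightarrow> 0 \<le> ope_mass w m X"
  using configsD(1) w_pos less_imp_le by (intro ope_mass_nonneg) blast

lemma exchange_config:
  assumes "X \<in> configs" "y \<in> X" "z \<in> I - X"
  shows "insert z (X - {y}) \<in> configs"
proof -
  have "finite X" "card X > 0"
    using assms(2) configsD(2)[OF assms(1)] by (auto simp: card_gt_0_iff)
  then show ?thesis using assms by (auto simp: configs_def card_Diff_singleton)
qed

lemma exchange_nonneg: "a \<in> I \<Longrightarrow> x \<in> I \<Longrightarrow> 0 \<le> exchange_ratio w m A a x"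
  using w_pos[of a] w_pos[of x] by (simp add: exchange_ratio_def)

lemma sum_exchanged_le:
  assumes "y \<in> I" "z \<in> I" "y \<noteq> z"
  shows "(\<Sum>X\<in>{X \<in> configs. y \<in> X \<and> z \<notin> X}. ope_mass w m (insert z (X - {y}))) \<le> total_mass"
proof -
  let ?S = "{X \<in> configs. y \<in> X \<and> z \<notin> X}"
  have inj: "inj_on (\<lambda>X. insert z (X - {y})) ?S"
  proof (rule inj_onI)
    fix X X' assume *: "X \<in> ?S" "X' \<in> ?S" "insert z (X - {y}) = insert z (X' - {y})"
    have "A = insert y (insert z (A - {y}) - {z})" if "y \<in> A" "z \<notin> A" for A
      using that by blast
    from this[of X] this[of X']
    have "X = insert y (insert z (X - {y}) - {z})" "X' = insert y (insert z (X' - {y}) - {z})"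
      using *(1,2) by simp_all
    then show "X = X'" using *(3) by metis
  qed
  have "(\<Sum>X\<in>?S. ope_mass w m (insert z (X - {y}))) =
        (\<Sum>X\<in>(\<lambda>X. insert z (X - {y})) ` ?S. ope_mass w m X)"
    by (simp add: sum.reindex[OF inj])
  also have "\<dots> \<le> total_mass"
    unfolding total_mass_def using assms
    by (intro sum_mono2 finite_configs) (auto intro!: exchange_config mass_nonneg)
  finally show ?thesis .
qed

lemma mass_exchange_le:
  assumes X: "X \<in> configs" and Y: "Y \<subseteq> X" and Z: "Z \<subseteq> I - X" and "finite A"
    and pair: "y ` A \<subseteq> Y" "z ` A \<subseteq> Z"
    and one: "1 = (\<Sum>a\<in>A. e a * lagrange m X (y a) (z a))"
  shows "ope_mass w m X \<le>
    (\<Sum>a\<in>A. w (y a) / w (z a) * (e a)\<^sup>2) * (\<Sum>a\<in>A. ope_mass w m (insert (z a) (X - {y a})))"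
proof -
  have pos: "0 < w (y a)" "0 < w (z a)" if "a \<in> A" for a
    using that pair Y Z w_pos configsD(1)[OF X] by blast+
  have "1 \<le> (\<Sum>a\<in>A. w (y a) / w (z a) * (e a)\<^sup>2) *
       (\<Sum>a\<in>A. inverse (w (y a) / w (z a)) * (lagrange m X (y a) (z a))\<^sup>2)"
    using weighted_cauchy_schwarz[of A "\<lambda>a. w (y a) / w (z a)" e "\<lambda>a. lagrange m X (y a) (z a)"]
      pos \<open>finite A\<close> by (simp add: one[symmetric])
  then have "ope_mass w m X * 1 \<le> ope_mass w m X * ((\<Sum>a\<in>A. w (y a) / w (z a) * (e a)\<^sup>2) *
       (\<Sum>a\<in>A. inverse (w (y a) / w (z a)) * (lagrange m X (y a) (z a))\<^sup>2))"
    by (rule mult_left_mono) (rule mass_nonneg[OF X])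
  also have "\<dots> = (\<Sum>a\<in>A. w (y a) / w (z a) * (e a)\<^sup>2) *
       (\<Sum>a\<in>A. ope_mass w m X * (w (z a) / w (y a)) * (lagrange m X (y a) (z a))\<^sup>2)"
    by (simp add: sum_distrib_left mult_ac)
  also have "(\<Sum>a\<in>A. ope_mass w m X * (w (z a) / w (y a)) * (lagrange m X (y a) (z a))\<^sup>2) =
       (\<Sum>a\<in>A. ope_mass w m (insert (z a) (X - {y a})))"
    using configsD[OF X] pair Y Z pos
    by (intro sum.cong refl, subst ope_mass_exchange) (auto simp: less_imp_neq[symmetric])
  finally show ?thesis by simp
qed

lemma particle_mass_le:
  assumes y: "y \<in> I - J"
  shows "(\<Sum>X\<in>{X \<in> configs. y \<in> X}. ope_mass w m X) \<le>
    card J * (\<Sum>z\<in>J. exchange_ratio w m J z y) * total_mass"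
proof -
  let ?R = "\<Sum>z\<in>J. exchange_ratio w m J z y"
  have R: "0 \<le> ?R" using y J by (intro sum_nonneg exchange_nonneg) auto
  have le: "ope_mass w m X \<le> ?R * (\<Sum>z\<in>J - X. ope_mass w m (insert z (X - {y})))"
    if X: "X \<in> configs" "y \<in> X" for X
  proof -
    note X' = configsD[OF X(1)]
    have "1 = (\<Sum>z\<in>J. lagrange m X y z * lagrange m J z y)"
      using lagrange_expand[of X J m y y] lagrange_same[of m X y] X X' finite_J inj_J by simp
    also have "\<dots> = (\<Sum>z\<in>J - X. lagrange m J z y * lagrange m X y z)"
    proof (rule sum.mono_neutral_cong_right)
      show "\<forall>z\<in>J - (J - X). lagrange m X y z * lagrange m J z y = 0"
        using X' y by (auto intro!: lagrange_other)
    qed (auto simp: finite_J)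
    finally have "ope_mass w m X \<le> (\<Sum>z\<in>J - X. w y / w z * (lagrange m J z y)\<^sup>2) *
        (\<Sum>z\<in>J - X. ope_mass w m (insert z (X - {y})))"
      by - (rule mass_exchange_le[of X "{y}" "J - X" _ "\<lambda>_. y" "\<lambda>z. z"];
        use X J finite_J in auto)
    also have "\<dots> \<le> ?R * (\<Sum>z\<in>J - X. ope_mass w m (insert z (X - {y})))"
      unfolding exchange_ratio_def[symmetric] using X J y finite_J
      by (intro mult_right_mono sum_nonneg sum_mono2 mass_nonneg exchange_config exchange_nonneg) auto
    finally show ?thesis .
  qed
  have "(\<Sum>X\<in>{X \<in> configs. y \<in> X}. ope_mass w m X) \<le>
        (\<Sum>X\<in>{X \<in> configs. y \<in> X}. ?R * (\<Sum>z\<in>J - X. ope_mass w m (insert z (X - {y}))))"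
    by (intro sum_mono le) auto
  also have "\<dots> = ?R * (\<Sum>X\<in>{X \<in> configs. y \<in> X}. \<Sum>z\<in>{z \<in> J. z \<notin> X}. ope_mass w m (insert z (X - {y})))"
    unfolding sum_distrib_left[symmetric] set_diff_eq ..
  also have "\<dots> = ?R * (\<Sum>z\<in>J. \<Sum>X\<in>{X \<in> {X \<in> configs. y \<in> X}. z \<notin> X}. ope_mass w m (insert z (X - {y})))"
    by (subst sum.swap_restrict) (simp_all add: finite_configs finite_J)
  also have "(\<lambda>z. {X \<in> {X \<in> configs. y \<in> X}. z \<notin> X}) = (\<lambda>z. {X \<in> configs. y \<in> X \<and> z \<notin> X})"
    by auto
  also have "?R * (\<Sum>z\<in>J. \<Sum>X\<in>{X \<in> configs. y \<in> X \<and> z \<notin> X}. ope_mass w m (insert z (X - {y})))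
       \<le> ?R * (\<Sum>z\<in>J. total_mass)"
    using y J by (intro mult_left_mono R sum_mono sum_exchanged_le) auto
  finally show ?thesis by (simp add: mult_ac)
qed

lemma hole_mass_le:
  assumes z: "z \<in> J"
  shows "(\<Sum>X\<in>{X \<in> configs. z \<notin> X}. ope_mass w m X) \<le>
    card (I - J) * (\<Sum>y\<in>I - J. exchange_ratio w m J z y) * total_mass"
proof -
  let ?R = "\<Sum>y\<in>I - J. exchange_ratio w m J z y"
  have R: "0 \<le> ?R" using z J by (intro sum_nonneg exchange_nonneg) auto
  have le: "ope_mass w m X \<le> ?R * (\<Sum>y\<in>X - J. ope_mass w m (insert z (X - {y})))"
    if X: "X \<in> configs" "z \<notin> X" for X
  proof -
    note X' = configsD[OF X(1)]
    have "1 = (\<Sum>y\<in>X. lagrange m J z y * lagrange m X y z)"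
      using lagrange_expand[of J X m z z] lagrange_same[of m J z] X X' z finite_J inj_J by simp
    also have "\<dots> = (\<Sum>y\<in>X - J. lagrange m J z y * lagrange m X y z)"
    proof (rule sum.mono_neutral_cong_right)
      show "\<forall>y\<in>X - (X - J). lagrange m J z y * lagrange m X y z = 0"
        using X finite_J by (auto intro!: lagrange_other)
    qed (auto simp: X')
    finally have "ope_mass w m X \<le> (\<Sum>y\<in>X - J. w y / w z * (lagrange m J z y)\<^sup>2) *
        (\<Sum>y\<in>X - J. ope_mass w m (insert z (X - {y})))"
      by - (rule mass_exchange_le[of X X "{z}" _ "\<lambda>y. y" "\<lambda>_. z"];
        use X X' J z in auto)
    also have "\<dots> \<le> ?R * (\<Sum>y\<in>X - J. ope_mass w m (insert z (X - {y})))"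
      unfolding exchange_ratio_def[symmetric] using X X' J z I
      by (intro mult_right_mono sum_nonneg sum_mono2 mass_nonneg exchange_config exchange_nonneg) auto
    finally show ?thesis .
  qed
  have "(\<Sum>X\<in>{X \<in> configs. z \<notin> X}. ope_mass w m X) \<le>
        (\<Sum>X\<in>{X \<in> configs. z \<notin> X}. ?R * (\<Sum>y\<in>X - J. ope_mass w m (insert z (X - {y}))))"
    by (intro sum_mono le) auto
  also have "\<dots> = ?R * (\<Sum>X\<in>{X \<in> configs. z \<notin> X}. \<Sum>y\<in>{y \<in> I - J. y \<in> X}. ope_mass w m (insert z (X - {y})))"
    unfolding sum_distrib_left[symmetric]
    by (intro arg_cong2[of _ _ _ _ "(*)"] refl sum.cong) (auto dest: configsD(1))
  also have "\<dots> = ?R * (\<Sum>y\<in>I - J. \<Sum>X\<in>{X \<in> {X \<in> configs. z \<notin> X}. y \<in> X}. ope_mass w m (insert z (X - {y})))"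
    by (subst sum.swap_restrict) (simp_all add: finite_configs I)
  also have "(\<lambda>y. {X \<in> {X \<in> configs. z \<notin> X}. y \<in> X}) = (\<lambda>y. {X \<in> configs. y \<in> X \<and> z \<notin> X})"
    by auto
  also have "?R * (\<Sum>y\<in>I - J. \<Sum>X\<in>{X \<in> configs. y \<in> X \<and> z \<notin> X}. ope_mass w m (insert z (X - {y})))
       \<le> ?R * (\<Sum>y\<in>I - J. total_mass)"
    using z J by (intro mult_left_mono R sum_mono sum_exchanged_le) auto
  finally show ?thesis by (simp add: mult_ac)
qed

end

lemma ex_projection_coeffs:
  fixes B :: "nat \<Rightarrow> 'a \<Rightarrow> real"
  assumes "finite I"
  shows "\<exists>c. \<forall>k<n. (\<Sum>x\<in>I. (f x - (\<Sum>j<n. c j * B j x)) * B k x) = 0"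
proof (induction n arbitrary: f)
  case (Suc n)
  obtain c where c: "\<forall>k<n. (\<Sum>x\<in>I. (f x - (\<Sum>j<n. c j * B j x)) * B k x) = 0"
    using Suc by blast
  obtain d where d: "\<forall>k<n. (\<Sum>x\<in>I. (B n x - (\<Sum>j<n. d j * B j x)) * B k x) = 0"
    using Suc by blast
  define e where "e x = B n x - (\<Sum>j<n. d j * B j x)" for x
  define r where "r x = f x - (\<Sum>j<n. c j * B j x)" for x
  define s where "s = (\<Sum>x\<in>I. r x * e x) / (\<Sum>x\<in>I. e x * e x)"
  have re: "(\<Sum>x\<in>I. (r x - s * e x) * e x) = 0"
  proof (cases "(\<Sum>x\<in>I. e x * e x) = 0")
    case True
    then have "\<forall>x\<in>I. e x = 0" using assms by (subst (asm) sum_nonneg_eq_0_iff) auto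
    then show ?thesis by simp
  next
    case False
    have "(\<Sum>x\<in>I. (r x - s * e x) * e x) = (\<Sum>x\<in>I. r x * e x) - s * (\<Sum>x\<in>I. e x * e x)"
      by (simp add: left_diff_distrib sum_subtractf mult.assoc sum_distrib_left[symmetric])
    then show ?thesis using False by (simp add: s_def)
  qed
  have rB: "(\<Sum>x\<in>I. (r x - s * e x) * B k x) = 0" if "k < n" for k
  proof -
    have "(\<Sum>x\<in>I. r x * B k x) = 0" "(\<Sum>x\<in>I. e x * B k x) = 0"
      using c d that by (auto simp: r_def e_def)
    then show ?thesis
      by (simp add: left_diff_distrib sum_subtractf mult.assoc sum_distrib_left[symmetric])
  qed
  have rn: "(\<Sum>x\<in>I. (r x - s * e x) * B n x) = 0"
  proof -
    have "(\<Sum>x\<in>I. (r x - s * e x) * B n x) =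
      (\<Sum>x\<in>I. (r x - s * e x) * e x + (\<Sum>j<n. d j * ((r x - s * e x) * B j x)))"
    proof (rule sum.cong[OF refl])
      fix x
      have "B n x = e x + (\<Sum>j<n. d j * B j x)" by (simp add: e_def)
      then show "(r x - s * e x) * B n x =
        (r x - s * e x) * e x + (\<Sum>j<n. d j * ((r x - s * e x) * B j x))"
        by (simp add: distrib_left sum_distrib_left mult_ac)
    qed
    also have "\<dots> = (\<Sum>j<n. d j * (\<Sum>x\<in>I. (r x - s * e x) * B j x))"
      by (simp add: sum.distrib re sum_distrib_left) (rule sum.swap)
    finally show ?thesis by (simp add: rB)
  qed
  define c' where "c' j = (if j < n then c j - s * d j else s)" for j
  have "f x - (\<Sum>j<Suc n. c' j * B j x) = r x - s * e x" for x
    by (simp add: r_def e_def c'_def algebra_simps sum_subtractf sum_distrib_left)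
  then show ?case using rB rn by (intro exI[of _ c']) (auto simp: less_Suc_eq)
qed simp

definition poly_span :: "int set \<Rightarrow> (int \<Rightarrow> real) \<Rightarrow> (int \<Rightarrow> real) \<Rightarrow> nat \<Rightarrow> (int \<Rightarrow> real) set" where
  "poly_span I m s n = {f. \<exists>c :: nat \<Rightarrow> real.
     f = (\<lambda>x. if x \<in> I then \<Sum>k<n. c k * (m x ^ k * s x) else 0)}"

lemma orth_proj_poly_span:
  fixes I :: "int set" and m s f :: "int \<Rightarrow> real" and n :: nat
  assumes "finite I"
  defines "g \<equiv> orth_proj I (poly_span I m s n) f"
  shows "g \<in> poly_span I m s n"
    and "v \<in> poly_span I m s n \<Longrightarrow> (\<Sum>x\<in>I. (f x - g x) * v x) = 0"
proof -
  let ?V = "poly_span I m s n"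
  let ?P = "\<lambda>g. g \<in> ?V \<and> (\<forall>v\<in>?V. (\<Sum>x\<in>I. (f x - g x) * v x) = 0)"
  obtain c where c: "\<forall>k<n. (\<Sum>x\<in>I. (f x - (\<Sum>j<n. c j * (m x ^ j * s x))) * (m x ^ k * s x)) = 0"
    using ex_projection_coeffs[OF assms(1), of n f "\<lambda>k x. m x ^ k * s x"] by blast
  define g0 where "g0 x = (if x \<in> I then \<Sum>k<n. c k * (m x ^ k * s x) else 0)" for x
  have "g0 \<in> ?V" unfolding poly_span_def g0_def by auto
  moreover have "(\<Sum>x\<in>I. (f x - g0 x) * v x) = 0" if v: "v \<in> ?V" for v
  proof -
    obtain d where d: "v = (\<lambda>x. if x \<in> I then \<Sum>k<n. d k * (m x ^ k * s x) else 0)"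
      using v unfolding poly_span_def by auto
    define h where "h x = f x - (\<Sum>j<n. c j * (m x ^ j * s x))" for x
    have "f x - g0 x = h x" if "x \<in> I" for x using that by (simp add: g0_def h_def)
    then have "(\<Sum>x\<in>I. (f x - g0 x) * v x) = (\<Sum>x\<in>I. \<Sum>k<n. d k * (h x * (m x ^ k * s x)))"
      by (intro sum.cong) (auto simp: d sum_distrib_left mult_ac)
    also have "\<dots> = (\<Sum>k<n. d k * (\<Sum>x\<in>I. h x * (m x ^ k * s x)))"
      by (subst sum.swap) (simp add: sum_distrib_left)
    finally show ?thesis using c by (simp add: h_def)
  qed
  ultimately have ex: "?P g0" by blast
  moreover have "g1 = g0" if g1: "?P g1" for g1
  proof -
    obtain d where d: "g1 = (\<lambda>x. if x \<in> I then \<Sum>k<n. d k * (m x ^ k * s x) else 0)"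
      using g1 unfolding poly_span_def by auto
    have "(\<lambda>x. g1 x - g0 x) \<in> ?V" unfolding poly_span_def
      by (rule CollectI, rule exI[of _ "\<lambda>k. d k - c k"])
         (auto simp: d g0_def left_diff_distrib sum_subtractf)
    then have "(\<Sum>x\<in>I. (f x - g0 x) * (g1 x - g0 x)) - (\<Sum>x\<in>I. (f x - g1 x) * (g1 x - g0 x)) = 0"
      using g1 ex by force
    then have "(\<Sum>x\<in>I. (g1 x - g0 x)\<^sup>2) = 0"
      by (simp add: sum_subtractf[symmetric] power2_eq_square algebra_simps)
    then have "\<forall>x\<in>I. g1 x = g0 x" using assms(1) by (subst (asm) sum_nonneg_eq_0_iff) auto
    then show ?thesis by (auto simp: d g0_def)
  qed
  ultimately have "?P (THE g. ?P g)" by (rule theI)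
  then show "g \<in> ?V" "v \<in> ?V \<Longrightarrow> (\<Sum>x\<in>I. (f x - g x) * v x) = 0"
    unfolding g_def orth_proj_def by auto
qed

lemma poly_span_poly:
  assumes "degree p < n"
  shows "(\<lambda>x. if x \<in> I then poly p (m x) * s x else 0) \<in> poly_span I m s n"
proof -
  have p: "poly p u = (\<Sum>k<n. coeff p k * u ^ k)" for u
    unfolding poly_altdef using assms
    by (intro sum.mono_neutral_left) (auto simp: coeff_eq_0)
  show ?thesis unfolding poly_span_def
    by (intro CollectI exI[of _ "coeff p"]) (simp add: fun_eq_iff p sum_distrib_left mult_ac)
qed

lemma poly_span_exists_poly:
  assumes "v \<in> poly_span I m s n" "0 < n"
  obtains p where "degree p < n" "v = (\<lambda>x. if x \<in> I then poly p (m x) * s x else 0)"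
proof -
  obtain c where c: "v = (\<lambda>x. if x \<in> I then \<Sum>k<n. c k * (m x ^ k * s x) else 0)"
    using assms(1) unfolding poly_span_def by auto
  define p where "p = (\<Sum>k<n. monom (c k) k)"
  have "degree p \<le> n - 1" unfolding p_def
    by (intro degree_sum_le) (auto intro!: order.trans[OF degree_monom_le])
  then have "degree p < n" using assms(2) by linarith
  moreover have "v = (\<lambda>x. if x \<in> I then poly p (m x) * s x else 0)"
    by (simp add: fun_eq_iff c p_def poly_sum poly_monom sum_distrib_left mult_ac)
  ultimately show ?thesis by (rule that)
qed

locale int_ope = ope I w m J for I :: "int set" and w m J
begin

definition kernel :: "int \<Rightarrow> int \<Rightarrow> real" where
  "kernel x y = orth_proj I (poly_span I m (\<lambda>x. sqrt (w x)) (card J)) (\<lambda>z. if z = y then 1 else 0) x"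

lemma card_J: "0 < card J"
  using finite_J J by (simp add: card_gt_0_iff)

lemma kernel_in: "(\<lambda>x. kernel x y) \<in> poly_span I m (\<lambda>x. sqrt (w x)) (card J)"
  unfolding kernel_def using orth_proj_poly_span(1)[OF I] by simp

lemma kernel_reproducing:
  assumes "v \<in> poly_span I m (\<lambda>x. sqrt (w x)) (card J)" "y \<in> I"
  shows "(\<Sum>x\<in>I. kernel x y * v x) = v y"
proof -
  have "(\<Sum>x\<in>I. ((if x = y then 1 else 0) - kernel x y) * v x) = 0"
    unfolding kernel_def using orth_proj_poly_span(2)[OF I assms(1)] by simp
  then have "(\<Sum>x\<in>I. (if x = y then v x else 0)) = (\<Sum>x\<in>I. kernel x y * v x)"
    by (simp add: left_diff_distrib sum_subtractf if_distrib[of "\<lambda>c. c * _"] cong: if_cong)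
  then show ?thesis using assms(2) I by simp
qed

lemma kernel_outside_nodes:
  assumes y: "y \<in> I - J"
  shows "(kernel x y)\<^sup>2 \<le> (\<Sum>z\<in>J. exchange_ratio w m J z y)"
proof -
  let ?R = "\<Sum>z\<in>J. exchange_ratio w m J z y"
  define k where "k x = kernel x y" for x
  have R: "0 \<le> ?R" using y J by (intro sum_nonneg exchange_nonneg) auto
  obtain p where p: "degree p < card J" "k = (\<lambda>x. if x \<in> I then poly p (m x) * sqrt (w x) else 0)"
    using poly_span_exists_poly[OF kernel_in card_J] unfolding k_def by blast
  have norm: "(\<Sum>x\<in>I. (k x)\<^sup>2) = k y"
    using kernel_reproducing[OF kernel_in, of y y] y by (simp add: k_def power2_eq_square)
  have wJ: "0 < w z" if "z \<in> J" for z using that J w_pos by auto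
  have ky_eq: "k y = (\<Sum>z\<in>J. (lagrange m J z y * sqrt (w y)) * poly p (m z))"
    using y lagrange_interpolation[OF finite_J inj_J p(1), of y]
    by (simp add: p(2) sum_distrib_left mult_ac)
  have "(k y)\<^sup>2 \<le> (\<Sum>z\<in>J. inverse (w z) * (lagrange m J z y * sqrt (w y))\<^sup>2) *
       (\<Sum>z\<in>J. inverse (inverse (w z)) * (poly p (m z))\<^sup>2)"
    unfolding ky_eq using wJ by (intro weighted_cauchy_schwarz finite_J) simp
  also have "(\<Sum>z\<in>J. inverse (w z) * (lagrange m J z y * sqrt (w y))\<^sup>2) = ?R"
    using y w_pos[of y] by (intro sum.cong) (auto simp: exchange_ratio_def field_simps)
  also have "(\<Sum>z\<in>J. inverse (inverse (w z)) * (poly p (m z))\<^sup>2) = (\<Sum>z\<in>J. (k z)\<^sup>2)"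
    using J wJ less_imp_le[OF wJ] by (intro sum.cong) (auto simp: p(2) power_mult_distrib)
  also have "?R * (\<Sum>z\<in>J. (k z)\<^sup>2) \<le> ?R * k y"
    unfolding norm[symmetric] by (intro mult_left_mono R sum_mono2 I J) auto
  finally have *: "k y * k y \<le> ?R * k y" by (simp add: power2_eq_square)
  have "0 \<le> k y" unfolding norm[symmetric] by (simp add: sum_nonneg)
  then have ky: "k y \<le> ?R" using * R by (cases "k y = 0") (auto simp: mult_le_cancel_right)
  show ?thesis
  proof (cases "x \<in> I")
    case True
    then have "(k x)\<^sup>2 \<le> k y" unfolding norm[symmetric]
      by (intro member_le_sum) (auto simp: I)
    then show ?thesis using ky by (simp add: k_def)
  next
    case False
    then have "k x = 0" by (simp add: p(2))
    then show ?thesis using R by (simp add: k_def)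
  qed
qed

lemma kernel_at_node:
  assumes z: "z \<in> J" and x: "x \<in> I"
  shows "((if x = z then 1 else 0) - kernel x z)\<^sup>2 \<le> (\<Sum>y\<in>I - J. exchange_ratio w m J z y)"
proof -
  define k where "k x = kernel x z" for x
  define d :: "int \<Rightarrow> real" where "d x = (if x = z then 1 else 0)" for x
  define f where "f x = (if x \<in> I then lagrange m J z x / sqrt (w z) * sqrt (w x) else 0)" for x
  have zI: "z \<in> I" "0 < w z" using z J w_pos by auto
  obtain p where p: "degree p < card J" "\<And>x. poly p (m x) = lagrange m J z x"
    using lagrange_poly[OF finite_J z] by blast
  have fV: "f \<in> poly_span I m (\<lambda>x. sqrt (w x)) (card J)"
  proof -
    have "degree (Polynomial.smult (1 / sqrt (w z)) p) < card J"
      using p(1) degree_smult_le le_less_trans by blast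
    from poly_span_poly[OF this, of I m "\<lambda>x. sqrt (w x)"] show ?thesis
      by (simp add: p(2) f_def[abs_def] cong: if_cong)
  qed
  have fz: "f z = 1" using zI lagrange_same[OF inj_J z] by (simp add: f_def)
  have "(\<Sum>x\<in>I. (d x - k x)\<^sup>2) \<le> (\<Sum>x\<in>I. (d x - f x)\<^sup>2)"
  proof -
    have "(\<Sum>x\<in>I. k x * k x) = k z" "(\<Sum>x\<in>I. k x * f x) = 1"
      unfolding k_def using kernel_reproducing[OF kernel_in zI(1)] kernel_reproducing[OF fV zI(1)] fz
      by auto
    moreover have dg: "(\<Sum>x\<in>I. d x * g x) = g z" for g
      using zI(1) I by (simp add: d_def if_distrib[of "\<lambda>c. c * _"] cong: if_cong)
    moreover have "(\<Sum>x\<in>I. (d x - k x) * (k x - f x)) = (\<Sum>x\<in>I. d x * k x) -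
        (\<Sum>x\<in>I. d x * f x) - (\<Sum>x\<in>I. k x * k x) + (\<Sum>x\<in>I. k x * f x)"
      by (simp add: left_diff_distrib right_diff_distrib sum_subtractf)
    ultimately have "(\<Sum>x\<in>I. (d x - k x) * (k x - f x)) = 0"
      using fz dg[of k] dg[of f] by linarith
    then have "(\<Sum>x\<in>I. (d x - f x)\<^sup>2) = (\<Sum>x\<in>I. (d x - k x)\<^sup>2) + (\<Sum>x\<in>I. (k x - f x)\<^sup>2)"
    proof -
      assume "(\<Sum>x\<in>I. (d x - k x) * (k x - f x)) = 0"
      moreover have "(d x - f x)\<^sup>2 = (d x - k x)\<^sup>2 + (k x - f x)\<^sup>2 + 2 * ((d x - k x) * (k x - f x))" for x
        by (simp add: power2_eq_square algebra_simps)
      ultimately show ?thesis by (simp add: sum.distrib sum_distrib_left[symmetric])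
    qed
    then show ?thesis by (simp add: sum_nonneg)
  qed
  also have "\<dots> = (\<Sum>y\<in>I - J. exchange_ratio w m J z y)"
  proof (rule sum.mono_neutral_cong_right)
    show "\<forall>x\<in>I - (I - J). (d x - f x)\<^sup>2 = 0"
    proof
      fix x assume "x \<in> I - (I - J)"
      then show "(d x - f x)\<^sup>2 = 0"
        using fz lagrange_other[OF finite_J, of x z m] by (cases "x = z") (auto simp: d_def f_def)
    qed
    show "(d x - f x)\<^sup>2 = exchange_ratio w m J z x" if "x \<in> I - J" for x
      using that z zI w_pos[of x]
      by (auto simp: d_def f_def exchange_ratio_def power_mult_distrib power_divide)
  qed (auto simp: I)
  finally have *: "(\<Sum>x\<in>I. (d x - k x)\<^sup>2) \<le> (\<Sum>y\<in>I - J. exchange_ratio w m J z y)" .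
  have "(d x - k x)\<^sup>2 \<le> (\<Sum>x\<in>I. (d x - k x)\<^sup>2)"
    by (intro member_le_sum) (auto simp: I x)
  with * show ?thesis by (simp add: d_def k_def)
qed

lemma kernel_column_outside: "y \<notin> I \<Longrightarrow> kernel x y = 0"
proof -
  assume y: "y \<notin> I"
  have "(\<Sum>x\<in>I. ((if x = y then 1 else 0) - kernel x y) * kernel x y) = 0"
    unfolding kernel_def using orth_proj_poly_span(2)[OF I orth_proj_poly_span(1)[OF I]] by simp
  moreover have "(\<Sum>x\<in>I. ((if x = y then 1 else 0) - kernel x y) * kernel x y) = (\<Sum>x\<in>I. - (kernel x y)\<^sup>2)"
    using y by (intro sum.cong) (auto simp: power2_eq_square)
  ultimately have "(\<Sum>x\<in>I. (kernel x y)\<^sup>2) = 0" by (simp add: sum_negf)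
  then have "\<forall>x\<in>I. kernel x y = 0" using I by (subst (asm) sum_nonneg_eq_0_iff) auto
  moreover have "x \<notin> I \<Longrightarrow> kernel x y = 0" for x
    using kernel_in[of y] by (auto simp: poly_span_def fun_eq_iff)
  ultimately show ?thesis by blast
qed

end

section \<open>One-particle weights and difference operators\<close>

fun step_poly :: "real \<Rightarrow> real \<Rightarrow> real \<Rightarrow> real \<Rightarrow> nat \<Rightarrow> real poly" where
  "step_poly p B U M 0 = [:1 - U * M:]"
| "step_poly p B U M (Suc 0) = [:(1 - p) * (U + M * B), p - U * M:]"
| "step_poly p B U M (Suc (Suc k)) =
     [:0, 1 + p:] * step_poly p B U M (Suc k) - [:B * (1 - p)\<^sup>2, 0, p:] * step_poly p B U M k"

lemma degree_step_poly: "degree (step_poly p B U M k) \<le> k"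
proof (induction p B U M k rule: step_poly.induct)
  case (3 p B U M k)
  have "degree ([:0, 1 + p:] * step_poly p B U M (Suc k)) \<le> 1 + Suc k"
    by (rule order.trans[OF degree_mult_le]) (use 3 in \<open>auto intro!: add_mono\<close>)
  moreover have "degree ([:B * (1 - p)\<^sup>2, 0, p:] * step_poly p B U M k) \<le> 2 + k"
    by (rule order.trans[OF degree_mult_le]) (use 3 in \<open>auto intro!: add_mono\<close>)
  ultimately show ?case by (auto intro!: degree_diff_le)
qed auto

text \<open>An Askey-Wilson type difference operator: it is invariant under \<open>y \<mapsto> 1 / (B y)\<close>, which
  exchanges the two points \<open>m0\<close> and \<open>m1\<close>, and hence maps polynomials to polynomials.\<close>

lemma step_poly_eval:
  fixes y p B U M :: real
  assumes "y \<noteq> 0" "1 - B * y\<^sup>2 \<noteq> 0"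
  defines "m0 \<equiv> 1 / y + B * p * y" and "m1 \<equiv> p / y + B * y" and "m \<equiv> 1 / y + B * y"
    and "a0 \<equiv> (U - B * y) * (y - M) / (1 - B * y\<^sup>2)"
    and "a1 \<equiv> (1 - U * y) * (1 - M * B * y) / (1 - B * y\<^sup>2)"
  shows "a0 * m0 ^ k + a1 * m1 ^ k = poly (step_poly p B U M k) m"
proof (induction k rule: induct_nat_012)
  case 0
  have "(U - B * y) * (y - M) + (1 - U * y) * (1 - M * B * y) = (1 - U * M) * (1 - B * y\<^sup>2)"
    by (simp add: algebra_simps power2_eq_square)
  then show ?case using assms(2) by (simp add: a0_def a1_def add_divide_distrib[symmetric])
next
  case 1
  have "((U - B * y) * (y - M)) * m0 + ((1 - U * y) * (1 - M * B * y)) * m1 =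
        ((p - U * M) * m + (1 - p) * (U + M * B)) * (1 - B * y\<^sup>2)"
    using assms(1) unfolding m0_def m1_def m_def by (simp add: field_simps power2_eq_square)
  moreover have "a0 * m0 + a1 * m1 =
      ((U - B * y) * (y - M) * m0 + (1 - U * y) * (1 - M * B * y) * m1) / (1 - B * y\<^sup>2)"
    by (simp add: a0_def a1_def add_divide_distrib)
  ultimately have "a0 * m0 + a1 * m1 = (p - U * M) * m + (1 - p) * (U + M * B)"
    using assms(2) by simp
  then show ?case by (simp add: algebra_simps)
next
  case (ge2 k)
  have s: "m0 + m1 = (1 + p) * m" and t: "m0 * m1 = p * m\<^sup>2 + B * (1 - p)\<^sup>2"
    using assms(1) unfolding m0_def m1_def m_def by (simp_all add: field_simps power2_eq_square)
  have "a0 * m0 ^ Suc (Suc k) + a1 * m1 ^ Suc (Suc k) =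
     (m0 + m1) * (a0 * m0 ^ Suc k + a1 * m1 ^ Suc k) - (m0 * m1) * (a0 * m0 ^ k + a1 * m1 ^ k)"
    by (simp add: algebra_simps)
  also have "\<dots> = poly (step_poly p B U M (Suc (Suc k))) m"
    unfolding s t ge2.IH by (simp add: algebra_simps power2_eq_square)
  finally show ?case .
qed

lemma step_poly_sum:
  fixes y p B U M :: real
  assumes "y \<noteq> 0" "1 - B * y\<^sup>2 \<noteq> 0"
  shows "(U - B * y) * (y - M) / (1 - B * y\<^sup>2) * (1 / y + B * p * y) ^ k +
     (1 - U * y) * (1 - M * B * y) / (1 - B * y\<^sup>2) * (p / y + B * y) ^ k =
     (\<Sum>j\<le>k. coeff (step_poly p B U M k) j * (1 / y + B * y) ^ j)"
proof -
  have *: "poly (step_poly p B U M k) x = (\<Sum>j\<le>k. coeff (step_poly p B U M k) j * x ^ j)" for x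
    unfolding poly_altdef using degree_step_poly[of p B U M k]
    by (intro sum.mono_neutral_left) (auto simp: coeff_eq_0)
  show ?thesis unfolding step_poly_eval[OF assms] by (rule *)
qed

locale q_parameters =
  fixes q b :: real
  assumes q: "0 < q" "q < 1" and b: "0 < b"
begin

definition bet :: "int \<Rightarrow> real" where "bet a = 1 + b * q powi a"

definition gam :: "int \<Rightarrow> real" where "gam a = 1 - q powi a"

lemma q_nonzero [simp]: "q \<noteq> 0" using q by simp

lemma qpow_pos [simp]: "0 < q powi a" using q by simp

lemma bet_pos [simp]: "0 < bet a" using b by (simp add: bet_def add_pos_pos)

lemma bet_nonzero [simp]: "bet a \<noteq> 0" using bet_pos[of a] by linarith

lemma gam_0 [simp]: "gam 0 = 0" by (simp add: gam_def)

lemma qpow_less: "a < c \<Longrightarrow> q powi c < q powi a"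
  using q by (simp add: power_int_strict_decreasing)

lemma qpow_le: "a \<le> c \<Longrightarrow> q powi c \<le> q powi a"
  using q by (simp add: power_int_decreasing)

lemma gam_pos [simp]: "0 < a \<Longrightarrow> 0 < gam a"
  using qpow_less[of 0 a] by (simp add: gam_def)

lemma gam_eq_0_iff [simp]: "gam a = 0 \<longleftrightarrow> a = 0"
  using qpow_less[of 0 a] qpow_less[of a 0] by (cases a "0 :: int" rule: linorder_cases) (auto simp: gam_def)

lemma qpow_add: "q powi (a + c) = q powi a * q powi c"
  by (simp add: power_int_add)

lemma qpow_double: "q powi (2 * a) = (q powi a)\<^sup>2" "q powi (a * 2) = (q powi a)\<^sup>2"
  by (simp_all only: mult_2 mult_2_right qpow_add power2_eq_square)

lemma qpow_minus_gam: "q powi a - q powi c = q powi a * gam (c - a)"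
  by (simp add: gam_def power_int_diff field_simps)

end

locale qracah = q_parameters +
  fixes N T S :: int
  assumes N: "1 \<le> N" and S: "0 \<le> S" "S \<le> T"
begin

definition mu :: "int \<Rightarrow> int \<Rightarrow> real" where "mu t x = slice_mu S q (- b) t x"

lemma mu_alt: "mu t x = 1 / q powi x - b * q powi (x + 1 - S - t)"
  by (simp add: mu_def slice_mu_def power_int_minus divide_inverse)

lemma mu_diff: "mu t x - mu t y = (q powi (- x) - q powi (- y)) * bet (x + y + 1 - S - t)"
  by (simp add: mu_def slice_mu_def bet_def power_int_add power_int_diff power_int_minus field_simps)

definition u :: "int \<Rightarrow> int \<Rightarrow> real" where "u t x = q powi (- x) * bet (2 * x + 1 - S - t)"

lemma u_pos [simp]: "0 < u t x" by (simp add: u_def)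

lemma u_nonzero [simp]: "u t x \<noteq> 0" using u_pos[of t x] by linarith

text \<open>Up to factors depending only on \<open>t\<close>, the partition function of the paths before (after) time
  \<open>t\<close> with end (start) points \<open>x\<close> is the Vandermonde determinant of the \<open>mu t (x i)\<close> times the product
  of the \<open>g t (x i)\<close> (of the \<open>h t (x i)\<close>). The coefficients \<open>g_stay\<close>, \<open>g_move\<close>, \<open>h_stay\<close>, \<open>h_move\<close>
  are those of the difference operators above, so that one step preserves this form.\<close>

definition g_ratio :: "int \<Rightarrow> int \<Rightarrow> real" where
  "g_ratio t x = q powi x * bet (x - S - t) * gam (t + N - x) / (gam x * bet (N - S + x))"

definition g :: "int \<Rightarrow> int \<Rightarrow> real" where
  "g t x = (if x < 0 then 0 else \<Prod>y\<in>{1..x}. g_ratio t y)"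

definition g_stay :: "int \<Rightarrow> int \<Rightarrow> real" where
  "g_stay t x = q powi x * bet (x - S - t) * gam (t + N - x) / bet (2 * x - S - t)"

definition g_move :: "int \<Rightarrow> int \<Rightarrow> real" where
  "g_move t x = gam x * bet (N - S + x) / bet (2 * x - S - t)"

lemma g_0: "g t 0 = 1" by (simp add: g_def)

lemma g_Suc:
  assumes "0 \<le> x"
  shows "g t (x + 1) = g_ratio t (x + 1) * g t x"
proof -
  have "{1..x + 1} = insert (x + 1) {1..x}" using assms by auto
  then show ?thesis using assms by (simp add: g_def)
qed

lemma g_pos: "0 \<le> x \<Longrightarrow> x < t + N \<Longrightarrow> 0 < g t x"
  unfolding g_def g_ratio_def by (auto intro!: prod_pos divide_pos_pos mult_pos_pos)

lemma g_eq_0: "t + N \<le> x \<Longrightarrow> 0 < t + N \<Longrightarrow> g t x = 0"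
  unfolding g_def g_ratio_def by (auto intro!: prod_zero bexI[of _ "t + N"])

lemma g_step:
  assumes "0 \<le> x" "0 < t + N"
  defines "C \<equiv> 1 / (gam (t + N) * bet (- S - t))"
  shows "g t x = C * g_stay t x * (g (t + 1) x * u (t + 1) x)"
    and "g t (x - 1) = C * g_move t x * (g (t + 1) x * u (t + 1) x)"
proof -
  have "g t x = C * g_stay t x * (g (t + 1) x * u (t + 1) x) \<and>
        g t (x - 1) = C * g_move t x * (g (t + 1) x * u (t + 1) x)"
    using assms(1)
  proof (induction x rule: int_ge_induct)
    case base
    show ?case using assms(2)
      by (simp add: g_0 g_stay_def g_move_def u_def C_def) (simp add: g_def algebra_simps)
  next
    case (step x)
    let ?x = "x + 1"
    have nz: "gam ?x \<noteq> 0" using step(1) by simp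
    have "q powi ?x * q powi (- ?x) = 1" "t + 1 + N - ?x = t + N - x"
      using power_int_minus[of q ?x] by simp_all
    then have shift: "q powi ?x * gam (t + 1 + N - ?x) * q powi (- ?x) = gam (t + N - x)"
      by (metis mult.commute mult.left_neutral mult.assoc)
    have "g_ratio (t + 1) ?x * u (t + 1) ?x * g_move t ?x =
        (q powi ?x * gam (t + 1 + N - ?x) * q powi (- ?x)) * bet (x - S - t) *
        (bet (2 * x + 2 - S - t) / bet (2 * x + 2 - S - t)) *
        (gam ?x / gam ?x) * (bet (N - S + ?x) / bet (N - S + ?x))"
      by (simp add: g_ratio_def u_def g_move_def algebra_simps)
    also have "\<dots> = gam (t + N - x) * bet (x - S - t)"
      using nz by (subst shift) simp
    also have "\<dots> = u (t + 1) x * g_stay t x"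
      by (simp add: u_def g_stay_def power_int_minus field_simps)
    finally have e1: "g_ratio (t + 1) ?x * u (t + 1) ?x * g_move t ?x = u (t + 1) x * g_stay t x" .
    have e2: "g_ratio t ?x * g_move t ?x = g_stay t ?x"
      using nz by (simp add: g_ratio_def g_move_def g_stay_def field_simps)
    have m: "g t x = C * g_move t ?x * (g (t + 1) ?x * u (t + 1) ?x)"
    proof -
      have "g t x = C * (u (t + 1) x * g_stay t x) * g (t + 1) x"
        using step by simp
      then show ?thesis unfolding e1[symmetric] using step(1) by (simp add: g_Suc mult_ac)
    qed
    moreover have "g t ?x = C * g_stay t ?x * (g (t + 1) ?x * u (t + 1) ?x)"
      unfolding g_Suc[OF step(1), of t] m e2[symmetric] by (simp add: mult_ac)
    ultimately show ?case by simp
  qed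
  then show "g t x = C * g_stay t x * (g (t + 1) x * u (t + 1) x)"
    and "g t (x - 1) = C * g_move t x * (g (t + 1) x * u (t + 1) x)" by blast+
qed

definition h_stay :: "int \<Rightarrow> int \<Rightarrow> real" where
  "h_stay t x = - (q powi (t + 1 - N - T)) * bet (N + x - t) * gam (T + x - S - t) / bet (2 * x + 1 - S - t)"

definition h_move :: "int \<Rightarrow> int \<Rightarrow> real" where
  "h_move t x = - (q powi (x + 1 - S - N)) * gam (S + N - 1 - x) * bet (x + 1 - T) / bet (2 * x + 1 - S - t)"

definition h_ratio :: "int \<Rightarrow> int \<Rightarrow> real" where
  "h_ratio t x = h_stay t (x + 1) / h_move t x"

definition h :: "int \<Rightarrow> int \<Rightarrow> real" where
  "h t x = (if S + N - 1 < x then 0 else \<Prod>y\<in>{x..<S + N - 1}. h_ratio t y)"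

lemma h_Suc:
  assumes "x < S + N - 1"
  shows "h t x = h_ratio t x * h t (x + 1)"
proof -
  have "{x..<S + N - 1} = insert x {x + 1..<S + N - 1}" using assms by auto
  then show ?thesis using assms by (simp add: h_def)
qed

lemma h_top: "h t (S + N - 1) = 1" by (simp add: h_def)

lemma h_ratio_alt:
  assumes "x < S + N - 1"
  shows "h_ratio t x = q powi (t + S - T - x) * bet (N + x + 1 - t) * gam (T + x + 1 - S - t) *
    bet (2 * x + 1 - S - t) / (bet (2 * x + 3 - S - t) * gam (S + N - 1 - x) * bet (x + 1 - T))"
proof -
  have "q powi (t + 1 - N - T) / q powi (x + 1 - S - N) = q powi (t + S - T - x)"
    by (simp add: power_int_diff[symmetric] algebra_simps)
  moreover have "h_ratio t x = q powi (t + 1 - N - T) / q powi (x + 1 - S - N) * bet (N + x + 1 - t) *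
      gam (T + x + 1 - S - t) * bet (2 * x + 1 - S - t) /
      (bet (2 * x + 3 - S - t) * gam (S + N - 1 - x) * bet (x + 1 - T))"
    by (simp add: h_ratio_def h_stay_def h_move_def algebra_simps)
  ultimately show ?thesis by simp
qed

lemma h_pos: "t + S - T \<le> x \<Longrightarrow> x < S + N \<Longrightarrow> 0 < h t x"
  unfolding h_def by (auto simp: h_ratio_alt intro!: prod_pos divide_pos_pos mult_pos_pos)

lemma h_eq_0: "x < t + S - T \<Longrightarrow> t < T + N \<Longrightarrow> h t x = 0"
  unfolding h_def
  by (auto simp: h_ratio_def h_stay_def intro!: prod_zero bexI[of _ "t + S - T - 1"])

lemma h_step:
  assumes "x \<le> S + N - 1" "t < T"
  defines "C \<equiv> 1 / (u (t + 1) (S + N - 1) * h_stay t (S + N - 1))"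
  shows "h (t + 1) x = C * h_stay t x * (u (t + 1) x * h t x)"
    and "h (t + 1) (x + 1) = C * h_move t x * (u (t + 1) (x + 1) * h t x)"
proof -
  have "h (t + 1) x = C * h_stay t x * (u (t + 1) x * h t x) \<and>
        h (t + 1) (x + 1) = C * h_move t x * (u (t + 1) (x + 1) * h t x)"
    using assms(1)
  proof (induction x rule: int_le_induct)
    case base
    have "h_stay t (S + N - 1) \<noteq> 0" using assms(2) N by (simp add: h_stay_def)
    then show ?case by (simp add: h_top C_def h_move_def) (simp add: h_def)
  next
    case (step x)
    then have x: "x - 1 < S + N - 1" by simp
    have nz: "h_move t' (x - 1) \<noteq> 0" for t' using step(1) by (simp add: h_move_def)
    have hx: "h t' (x - 1) * h_move t' (x - 1) = h_stay t' x * h t' x" for t'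
      using nz[of t'] by (simp add: h_Suc[OF x] h_ratio_def)
    have m: "h (t + 1) (x - 1 + 1) = C * h_move t (x - 1) * (u (t + 1) (x - 1 + 1) * h t (x - 1))"
      using step(2) hx[of t] by (simp add: mult_ac)
    have "h_stay (t + 1) x * u (t + 1) x * h_move t (x - 1) =
          h_move (t + 1) (x - 1) * (u (t + 1) (x - 1) * h_stay t (x - 1))"
    proof -
      have e: "q powi (t + 1 + 1 - N - T) * q powi (- x) = q powi (t + 1 - N - T) * q powi (- (x - 1))"
        by (simp add: power_int_add[symmetric] algebra_simps)
      have "h_stay (t + 1) x * u (t + 1) x * h_move t (x - 1) =
         (q powi (t + 1 + 1 - N - T) * q powi (- x)) * q powi (x - S - N) * bet (N + x - 1 - t) *
         gam (T + x - S - t - 1) * gam (S + N - x) * bet (x - T) / bet (2 * x - 1 - S - t)"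
        by (simp add: h_stay_def u_def h_move_def algebra_simps)
      also have "\<dots> = h_move (t + 1) (x - 1) * (u (t + 1) (x - 1) * h_stay t (x - 1))"
        unfolding e by (simp add: h_stay_def u_def h_move_def algebra_simps)
      finally show ?thesis .
    qed
    then have "h_move (t + 1) (x - 1) * h (t + 1) (x - 1) =
        h_move (t + 1) (x - 1) * (C * h_stay t (x - 1) * (u (t + 1) (x - 1) * h t (x - 1)))"
      using hx[of "t + 1"] m by (simp add: mult_ac)
    then have "h (t + 1) (x - 1) = C * h_stay t (x - 1) * (u (t + 1) (x - 1) * h t (x - 1))"
      using nz[of "t + 1"] by simp
    with m show ?case by simp
  qed
  then show "h (t + 1) x = C * h_stay t x * (u (t + 1) x * h t x)"
    and "h (t + 1) (x + 1) = C * h_move t x * (u (t + 1) (x + 1) * h t x)" by blast+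
qed

lemma g_moments:
  "g_stay t x * mu t x ^ k + g_move t x * mu t (x - 1) ^ k =
   (\<Sum>j\<le>k. coeff (step_poly q (- b * q powi (- S - t)) 1 (q powi (t + N)) k) j * mu (t + 1) x ^ j)"
proof -
  let ?y = "q powi x" and ?B = "- b * q powi (- S - t)" and ?M = "q powi (t + N)"
  have e: "1 - ?B * ?y = bet (x - S - t)" "1 - ?M * ?B * ?y = bet (N - S + x)"
    "1 - ?B * ?y\<^sup>2 = bet (2 * x - S - t)" "?y - ?M = q powi x * gam (t + N - x)" "1 - 1 * ?y = gam x"
    by (simp_all add: bet_def gam_def power_int_add power_int_diff power_int_minus qpow_double field_simps)
  have m: "1 / ?y + ?B * q * ?y = mu t x" "q / ?y + ?B * ?y = mu t (x - 1)" "1 / ?y + ?B * ?y = mu (t + 1) x"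
    by (simp_all add: mu_alt power_int_add power_int_diff power_int_minus field_simps)
  show ?thesis
    using step_poly_sum[of ?y ?B 1 ?M q k] unfolding e m by (simp add: g_stay_def g_move_def mult_ac)
qed

lemma h_moments:
  "h_stay t x * mu (t + 1) x ^ k + h_move t x * mu (t + 1) (x + 1) ^ k =
   (\<Sum>j\<le>k. coeff (step_poly (1 / q) (- b * q powi (1 - S - t)) (q powi (1 - S - N)) (q powi (t + S - T)) k) j
      * mu t x ^ j)"
proof -
  let ?y = "q powi x" and ?B = "- b * q powi (1 - S - t)" and ?U = "q powi (1 - S - N)"
    and ?M = "q powi (t + S - T)"
  have e: "?U - ?B * ?y = q powi (1 - S - N) * bet (N + x - t)" "1 - ?M * ?B * ?y = bet (x + 1 - T)"
    "1 - ?B * ?y\<^sup>2 = bet (2 * x + 1 - S - t)" "?y - ?M = - (q powi (t + S - T)) * gam (T + x - S - t)"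
    "1 - ?U * ?y = - (q powi (x + 1 - S - N)) * gam (S + N - 1 - x)"
    by (simp_all add: bet_def gam_def power_int_add power_int_diff power_int_minus qpow_double field_simps)
  have m: "1 / ?y + ?B * (1 / q) * ?y = mu (t + 1) x" "(1 / q) / ?y + ?B * ?y = mu (t + 1) (x + 1)"
    "1 / ?y + ?B * ?y = mu t x"
    by (simp_all add: mu_alt power_int_add power_int_diff power_int_minus field_simps)
  have p: "q powi (1 - S - N) * q powi (t + S - T) = q powi (t + 1 - N - T)"
    by (simp add: power_int_add[symmetric] algebra_simps)
  have "h_stay t x = q powi (1 - S - N) * bet (N + x - t) *
      (- (q powi (t + S - T)) * gam (T + x - S - t)) / bet (2 * x + 1 - S - t)"
    by (simp add: h_stay_def p[symmetric])
  then show ?thesis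
    using step_poly_sum[of ?y ?B ?U ?M "1 / q" k] unfolding e m by (simp add: h_move_def)
qed

end

section \<open>Transfer matrices\<close>

lemma sum_PiE_Suc:
  fixes F :: "(nat \<Rightarrow> 'a) \<Rightarrow> real"
  shows "(\<Sum>Y\<in>PiE {..Suc m} (\<lambda>_. W). F Y) = (\<Sum>Y\<in>PiE {..m} (\<lambda>_. W). \<Sum>y\<in>W. F (Y(Suc m := y)))"
proof -
  have inj: "inj_on (\<lambda>(y, Y). Y(Suc m := y)) (W \<times> PiE {..m} (\<lambda>_. W))"
  proof (rule inj_onI, clarify)
    fix y Y y' Y' assume Y: "Y \<in> PiE {..m} (\<lambda>_. W)" "Y' \<in> PiE {..m} (\<lambda>_. W)"
      and e: "Y(Suc m := y) = Y'(Suc m := y')"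
    have "Y k = Y' k" for k
    proof (cases "k = Suc m")
      case True
      then show ?thesis using PiE_arb[OF Y(1), of k] PiE_arb[OF Y(2), of k] by simp
    next
      case False
      then show ?thesis using fun_cong[OF e, of k] by simp
    qed
    moreover have "y = y'" using fun_cong[OF e, of "Suc m"] by simp
    ultimately show "y = y' \<and> Y = Y'" by auto
  qed
  have "PiE {..Suc m} (\<lambda>_. W) = (\<lambda>(y, Y). Y(Suc m := y)) ` (W \<times> PiE {..m} (\<lambda>_. W))"
    by (simp add: atMost_Suc PiE_insert_eq)
  then have "(\<Sum>Y\<in>PiE {..Suc m} (\<lambda>_. W). F Y) =
      sum F ((\<lambda>(y, Y). Y(Suc m := y)) ` (W \<times> PiE {..m} (\<lambda>_. W)))"
    by (rule arg_cong)
  also have "\<dots> = (\<Sum>(y, Y)\<in>W \<times> PiE {..m} (\<lambda>_. W). F (Y(Suc m := y)))"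
    by (subst sum.reindex[OF inj]) (simp add: case_prod_unfold)
  also have "\<dots> = (\<Sum>Y\<in>PiE {..m} (\<lambda>_. W). \<Sum>y\<in>W. F (Y(Suc m := y)))"
    by (simp add: sum.cartesian_product[symmetric] sum.swap[of _ W])
  finally show ?thesis .
qed

lemma transfer_forward:
  fixes A :: "nat \<Rightarrow> 'a \<Rightarrow> 'a \<Rightarrow> real"
  assumes "\<And>k y. k < j \<Longrightarrow> y \<in> W \<Longrightarrow> (\<Sum>x\<in>W. l k x * A k x y) = K k * l (Suc k) y"
  shows "(\<Sum>Y\<in>PiE {..j} (\<lambda>_. W). l 0 (Y 0) * (\<Prod>k<j. A k (Y k) (Y (Suc k))) * f (Y j)) =
    (\<Prod>k<j. K k) * (\<Sum>x\<in>W. l j x * f x)"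
  using assms
proof (induction j arbitrary: f)
  case 0
  have "inj_on (\<lambda>x. \<lambda>k\<in>{..0::nat}. x) W" by (auto simp: inj_on_def fun_eq_iff restrict_def)
  moreover have "PiE {..0} (\<lambda>_. W) = (\<lambda>x. \<lambda>k\<in>{..0::nat}. x) ` W"
  proof (intro equalityI subsetI)
    fix Y :: "nat \<Rightarrow> 'a" assume Y: "Y \<in> PiE {..0} (\<lambda>_. W)"
    then have "Y = (\<lambda>k\<in>{..0::nat}. Y 0)" by (auto simp: fun_eq_iff PiE_def extensional_def)
    moreover have "Y 0 \<in> W" using Y by auto
    ultimately show "Y \<in> (\<lambda>x. \<lambda>k\<in>{..0::nat}. x) ` W" by blast
  next
    fix Y assume "Y \<in> (\<lambda>x. \<lambda>k\<in>{..0::nat}. x) ` W"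
    then obtain x where "x \<in> W" "Y = (\<lambda>k\<in>{..0::nat}. x)" by blast
    then show "Y \<in> PiE {..0} (\<lambda>_. W)" by (simp add: restrict_PiE_iff)
  qed
  ultimately show ?case by (simp add: sum.reindex)
next
  case (Suc j)
  have "(\<Sum>Y\<in>PiE {..Suc j} (\<lambda>_. W). l 0 (Y 0) * (\<Prod>k<Suc j. A k (Y k) (Y (Suc k))) * f (Y (Suc j))) =
    (\<Sum>Y\<in>PiE {..j} (\<lambda>_. W). l 0 (Y 0) * (\<Prod>k<j. A k (Y k) (Y (Suc k))) * (\<Sum>y\<in>W. A j (Y j) y * f y))"
    unfolding sum_PiE_Suc by (simp add: sum_distrib_left mult.assoc)
  also have "\<dots> = (\<Prod>k<j. K k) * (\<Sum>x\<in>W. l j x * (\<Sum>y\<in>W. A j x y * f y))"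
    using Suc.prems by (intro Suc.IH) auto
  also have "(\<Sum>x\<in>W. l j x * (\<Sum>y\<in>W. A j x y * f y)) = (\<Sum>y\<in>W. (\<Sum>x\<in>W. l j x * A j x y) * f y)"
    unfolding sum_distrib_left sum_distrib_right by (subst sum.swap) (simp add: mult_ac)
  also have "\<dots> = K j * (\<Sum>y\<in>W. l (Suc j) y * f y)"
    using Suc.prems by (simp add: sum_distrib_left mult_ac)
  finally show ?case by (simp add: mult_ac)
qed

text \<open>\<open>l\<close> and \<open>r\<close> are left and right eigenfunctions of the transfer matrices \<open>A\<close>, so the law of the
  configuration at the intermediate time \<open>j\<close> has the density \<open>l j * r j\<close>.\<close>

lemma transfer_marginal:
  fixes A :: "nat \<Rightarrow> 'a \<Rightarrow> 'a \<Rightarrow> real"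
  assumes "j \<le> m"
    and l: "\<And>k y. k < j \<Longrightarrow> y \<in> W \<Longrightarrow> (\<Sum>x\<in>W. l k x * A k x y) = K k * l (Suc k) y"
    and r: "\<And>k x. j \<le> k \<Longrightarrow> k < m \<Longrightarrow> x \<in> W \<Longrightarrow> (\<Sum>y\<in>W. A k x y * r (Suc k) y) = K' k * r k x"
  shows "(\<Sum>Y\<in>PiE {..m} (\<lambda>_. W).
      l 0 (Y 0) * (\<Prod>k<m. A k (Y k) (Y (Suc k))) * f (Y j) * r m (Y m)) =
    (\<Prod>k<j. K k) * (\<Prod>k=j..<m. K' k) * (\<Sum>x\<in>W. l j x * f x * r j x)"
  using assms(1) r
proof (induction m rule: dec_induct)
  case base
  show ?case
    using transfer_forward[of j W l A K "\<lambda>x. f x * r j x"] l by (simp add: mult.assoc)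
next
  case (step m)
  have "(\<Sum>Y\<in>PiE {..Suc m} (\<lambda>_. W). l 0 (Y 0) * (\<Prod>k<Suc m. A k (Y k) (Y (Suc k))) * f (Y j) * r (Suc m) (Y (Suc m))) =
    (\<Sum>Y\<in>PiE {..m} (\<lambda>_. W). l 0 (Y 0) * (\<Prod>k<m. A k (Y k) (Y (Suc k))) * f (Y j) * (\<Sum>y\<in>W. A m (Y m) y * r (Suc m) y))"
    unfolding sum_PiE_Suc using step.hyps by (simp add: sum_distrib_left mult_ac)
  also have "\<dots> = (\<Sum>Y\<in>PiE {..m} (\<lambda>_. W). l 0 (Y 0) * (\<Prod>k<m. A k (Y k) (Y (Suc k))) * f (Y j) * (K' m * r m (Y m)))"
    using step.hyps by (intro sum.cong refl arg_cong2[of _ _ _ _ "(*)"] step.prems) auto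
  also have "\<dots> = K' m * ((\<Prod>k<j. K k) * (\<Prod>k=j..<m. K' k) * (\<Sum>x\<in>W. l j x * f x * r j x))"
    using step.prems by (subst step.IH[symmetric]) (auto simp: sum_distrib_left mult_ac)
  finally show ?case using step.hyps by (simp add: prod.atLeastLessThan_Suc mult_ac)
qed

lemma vandermonde_eq_0:
  assumes "i < j" "j < n" "y i = y j"
  shows "vandermonde n y = 0"
proof -
  have *: "(\<Prod>k<j. y j - y k) = 0"
    using assms by (intro prod_zero bexI[of _ i]) auto
  show ?thesis unfolding vandermonde_def
    by (rule prod_zero[OF finite_lessThan], rule bexI[of _ j], rule *) (use assms in simp)
qed

lemma vandermonde_nonzero:
  assumes "inj_on y {..<n}"
  shows "vandermonde n y \<noteq> 0"
  unfolding vandermonde_def using inj_onD[OF assms] by (fastforce simp: prod_zero_iff)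

lemma ope_mass_image:
  assumes "inj_on x {..<n}"
  shows "ope_mass w m (x ` {..<n}) = (\<Prod>i<n. w (x i)) * (vandermonde n (\<lambda>i. m (x i)))\<^sup>2"
  using assms
proof (induction n)
  case (Suc n)
  have n: "x n \<notin> x ` {..<n}" and inj: "inj_on x {..<n}"
    using Suc.prems by (auto simp: lessThan_Suc)
  have "(\<Prod>b\<in>x ` {..<n}. m (x n) - m b) = (\<Prod>k<n. m (x n) - m (x k))"
    by (simp add: prod.reindex[OF inj])
  then show ?case
    using n Suc.IH[OF inj]
    by (simp add: lessThan_Suc ope_mass_insert vandermonde_def power_mult_distrib)
qed (simp add: ope_mass_def vandermonde_def)

lemma strict_mono_on_enum:
  fixes X :: "int set"
  assumes "finite X" "card X = n"
  shows "\<exists>!x. x \<in> extensional {..<n} \<and> strict_mono_on {..<n} x \<and> x ` {..<n} = X"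
proof -
  define f where "f i = sorted_list_of_set X ! i" for i
  have len: "length (sorted_list_of_set X) = n" using assms by simp
  have f: "strict_mono_on {..<n} f"
    using sorted_wrt_nth_less[OF strict_sorted_list_of_set[of X]] len
    by (auto simp: strict_mono_on_def f_def)
  have fX: "f ` {..<n} = X"
    using assms len set_conv_nth[of "sorted_list_of_set X"] by (auto simp: f_def image_def)
  have 1: "restrict f {..<n} \<in> extensional {..<n} \<and> strict_mono_on {..<n} (restrict f {..<n}) \<and>
      restrict f {..<n} ` {..<n} = X"
    using f fX by (auto simp: strict_mono_on_def)
  show ?thesis
  proof (rule ex1I[of _ "restrict f {..<n}"], rule 1)
    fix x assume x: "x \<in> extensional {..<n} \<and> strict_mono_on {..<n} x \<and> x ` {..<n} = X"
    have sorted: "sorted (map x [0..<n]) \<and> distinct (map x [0..<n]) \<and> set (map x [0..<n]) = X"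
      if "strict_mono_on {..<n} x" "x ` {..<n} = X" for x :: "nat \<Rightarrow> int"
    proof -
      have "sorted_wrt (<) (map x [0..<n])"
        using that(1) by (auto simp: sorted_wrt_iff_nth_less strict_mono_on_def)
      then show ?thesis using that(2) by (auto simp: strict_sorted_iff lessThan_atLeast0)
    qed
    have "map x [0..<n] = map (restrict f {..<n}) [0..<n]"
      using sorted[of x] sorted[of "restrict f {..<n}"] x 1 by (intro sorted_distinct_set_unique) auto
    then have "x i = restrict f {..<n} i" if "i < n" for i
      using that by (metis atLeastLessThan_iff atLeastLessThan_upt map_eq_conv zero_le)
    then show "x = restrict f {..<n}"
      using x 1 by (intro extensionalityI[of x "{..<n}"]) auto
  qed
qed

lemma sum_strict_mono_configs:
  fixes F :: "int set \<Rightarrow> real"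
  shows "(\<Sum>x\<in>{x \<in> PiE {..<n} (\<lambda>_. Q). strict_mono_on {..<n} x}. F (x ` {..<n})) =
    (\<Sum>X\<in>{X. X \<subseteq> Q \<and> finite X \<and> card X = n}. F X)"
proof (rule sum.reindex_bij_betw[of "\<lambda>x. x ` {..<n}"])
  show "bij_betw (\<lambda>x. x ` {..<n}) {x \<in> PiE {..<n} (\<lambda>_. Q). strict_mono_on {..<n} x}
      {X. X \<subseteq> Q \<and> finite X \<and> card X = n}"
  proof (rule bij_betwI')
    fix x x' assume x: "x \<in> {x \<in> PiE {..<n} (\<lambda>_. Q). strict_mono_on {..<n} x}"
      and x': "x' \<in> {x \<in> PiE {..<n} (\<lambda>_. Q). strict_mono_on {..<n} x}"
    have c: "card (x ` {..<n}) = n"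
      using x strict_mono_on_imp_inj_on[of "{..<n}" x] by (simp add: card_image)
    show "(x ` {..<n} = x' ` {..<n}) = (x = x')"
      using strict_mono_on_enum[OF _ c] x x' by (auto simp: PiE_def)
  next
    fix x assume x: "x \<in> {x \<in> PiE {..<n} (\<lambda>_. Q). strict_mono_on {..<n} x}"
    then show "x ` {..<n} \<in> {X. X \<subseteq> Q \<and> finite X \<and> card X = n}"
      using strict_mono_on_imp_inj_on[of "{..<n}" x] by (auto simp: card_image)
  next
    fix X assume X: "X \<in> {X. X \<subseteq> Q \<and> finite X \<and> card X = n}"
    then obtain x where "x \<in> extensional {..<n}" "strict_mono_on {..<n} x" "x ` {..<n} = X"
      using strict_mono_on_enum[of X n] by auto
    then show "\<exists>x\<in>{x \<in> PiE {..<n} (\<lambda>_. Q). strict_mono_on {..<n} x}. X = x ` {..<n}"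
      using X by (intro bexI[of _ x]) (auto simp: PiE_def)
  qed
qed

context qracah
begin

definition conf :: "(nat \<Rightarrow> int) set" where
  "conf = PiE {..<nat N} (\<lambda>_. {0..S + N - 1})"

abbreviation strict :: "(nat \<Rightarrow> int) \<Rightarrow> bool" where
  "strict x \<equiv> strict_mono_on {..<nat N} x"

definition one_step :: "(nat \<Rightarrow> int) \<Rightarrow> (nat \<Rightarrow> int) \<Rightarrow> bool" where
  "one_step x y \<longleftrightarrow> (\<forall>i<nat N. y i = x i \<or> y i = x i + 1)"

definition alternant :: "int \<Rightarrow> (nat \<Rightarrow> int) \<Rightarrow> real" where
  "alternant t x = vandermonde (nat N) (\<lambda>i. mu t (x i))"

definition transition :: "int \<Rightarrow> (nat \<Rightarrow> int) \<Rightarrow> (nat \<Rightarrow> int) \<Rightarrow> real" where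
  "transition t x y = of_bool (strict x \<and> strict y \<and> one_step x y) * (\<Prod>i<nat N. 1 / u (t + 1) (y i))"

definition left_weight :: "int \<Rightarrow> (nat \<Rightarrow> int) \<Rightarrow> real" where
  "left_weight t x = of_bool (strict x) * alternant t x * (\<Prod>i<nat N. g t (x i))"

definition right_weight :: "int \<Rightarrow> (nat \<Rightarrow> int) \<Rightarrow> real" where
  "right_weight t x = of_bool (strict x) * alternant t x * (\<Prod>i<nat N. h t (x i))"

lemma finite_conf: "finite conf"
  unfolding conf_def by (intro finite_PiE) auto

lemma confD: "x \<in> conf \<Longrightarrow> i < nat N \<Longrightarrow> 0 \<le> x i \<and> x i \<le> S + N - 1"
  unfolding conf_def by (auto dest!: PiE_mem[of x _ _ i])

text \<open>The sum over the admissible neighbours of \<open>y\<close> extends to a full product, since the Vandermonde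
  determinant vanishes at colliding particles and \<open>f\<close> vanishes outside the range.\<close>

lemma alternant_step:
  fixes e :: int and f m :: "int \<Rightarrow> real"
  assumes y: "y \<in> conf" "strict y" and e: "e = 1 \<or> e = - 1"
    and f0: "\<And>i. i < nat N \<Longrightarrow> y i + e \<notin> {0..S + N - 1} \<Longrightarrow> f (y i + e) = 0"
    and f: "\<And>i. i < nat N \<Longrightarrow> f (y i) = D i * stay i" "\<And>i. i < nat N \<Longrightarrow> f (y i + e) = D i * move i"
    and moments: "\<And>i k. i < nat N \<Longrightarrow>
      stay i * m (y i) ^ k + move i * m (y i + e) ^ k = (\<Sum>j\<le>k. c k j * M i ^ j)"
  shows "(\<Sum>x\<in>{x \<in> conf. strict x \<and> (\<forall>i<nat N. x i = y i \<or> x i = y i + e)}.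
      vandermonde (nat N) (\<lambda>i. m (x i)) * (\<Prod>i<nat N. f (x i))) =
    (\<Prod>i<nat N. D i) * ((\<Prod>j<nat N. c j j) * vandermonde (nat N) M)"
proof -
  let ?n = "nat N"
  define B where "B = PiE {..<?n} (\<lambda>i. {y i, y i + e})"
  define F where "F x = vandermonde ?n (\<lambda>i. m (x i)) * (\<Prod>i<?n. f (x i))" for x
  define W where "W = {x \<in> conf. strict x \<and> (\<forall>i<?n. x i = y i \<or> x i = y i + e)}"
  define a where "a i s = (if s = y i then stay i else move i)" for i s
  have mem: "x i = y i \<or> x i = y i + e" if "x \<in> B" "i < ?n" for x i
    using that by (auto simp: B_def dest!: PiE_mem[of x _ _ i])
  have "(\<Sum>x\<in>W. F x) = (\<Sum>x\<in>B. F x)"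
  proof (rule sum.mono_neutral_left)
    show "finite B" unfolding B_def by (intro finite_PiE) auto
    show "W \<subseteq> B" by (fastforce simp: W_def B_def conf_def PiE_def Pi_def)
    show "\<forall>x\<in>B - W. F x = 0"
    proof
      fix x assume x: "x \<in> B - W"
      have "x \<in> extensional {..<?n}" using x by (simp add: B_def PiE_def)
      consider "x \<notin> conf" | "\<not> strict x" using x mem[of x] by (auto simp: W_def)
      then show "F x = 0"
      proof cases
        case 1
        then obtain i where i: "i < ?n" "x i \<notin> {0..S + N - 1}"
          using \<open>x \<in> extensional {..<?n}\<close> by (auto simp: conf_def PiE_def Pi_def)
        then have "x i = y i + e" using mem[of x i] x confD[OF y(1), of i] by auto
        then have "f (x i) = 0" using f0[of i] i by simp
        then have "(\<Prod>i<?n. f (x i)) = 0" using i(1) by (intro prod_zero bexI[of _ i]) auto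
        then show ?thesis by (simp add: F_def)
      next
        case 2
        then obtain i j where ij: "i < j" "j < ?n" "x j \<le> x i"
          by (auto simp: strict_mono_on_def not_less)
        have "y i < y j" using y(2) ij by (auto simp: strict_mono_on_def)
        then have "x i = x j" using mem[of x i] mem[of x j] x ij e by auto
        then show ?thesis
          using vandermonde_eq_0[of i j ?n "\<lambda>i. m (x i)"] ij by (simp add: F_def)
      qed
    qed
  qed
  also have "\<dots> = (\<Sum>x\<in>B. (\<Prod>i<?n. D i) * ((\<Prod>i<?n. a i (x i)) * vandermonde ?n (\<lambda>i. m (x i))))"
  proof (rule sum.cong[OF refl])
    fix x assume x: "x \<in> B"
    have "f (x i) = D i * a i (x i)" if "i < ?n" for i
      using mem[OF x that] f[OF that] e by (auto simp: a_def)
    then have "(\<Prod>i<?n. f (x i)) = (\<Prod>i<?n. D i) * (\<Prod>i<?n. a i (x i))"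
      by (simp add: prod.distrib)
    then show "F x = (\<Prod>i<?n. D i) * ((\<Prod>i<?n. a i (x i)) * vandermonde ?n (\<lambda>i. m (x i)))"
      by (simp add: F_def mult_ac)
  qed
  also have "\<dots> = (\<Prod>i<?n. D i) * ((\<Prod>j<?n. c j j) * vandermonde ?n M)"
    unfolding sum_distrib_left[symmetric] B_def
  proof (rule arg_cong2[of _ _ _ _ "(*)", OF refl], rule vandermonde_transform[where m = m and M = M and c = c])
    fix i k assume "i < ?n"
    then show "(\<Sum>s\<in>{y i, y i + e}. a i s * m s ^ k) = (\<Sum>j\<le>k. c k j * M i ^ j)"
      using moments[of i k] e by (auto simp: a_def)
  qed auto
  finally show ?thesis by (simp add: F_def W_def)
qed

lemma left_weight_step:
  assumes t: "0 \<le> t"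
  shows "\<exists>K. \<forall>y\<in>conf. (\<Sum>x\<in>conf. left_weight t x * transition t x y) = K * left_weight (t + 1) y"
proof -
  let ?n = "nat N"
  define C where "C = 1 / (gam (t + N) * bet (- S - t))"
  define c where "c k = coeff (step_poly q (- b * q powi (- S - t)) 1 (q powi (t + N)) k)" for k
  define K where "K = C ^ ?n * (\<Prod>j<?n. c j j)"
  have "(\<Sum>x\<in>conf. left_weight t x * transition t x y) = K * left_weight (t + 1) y" if y: "y \<in> conf" for y
  proof (cases "strict y")
    case False
    then show ?thesis by (simp add: left_weight_def transition_def)
  next
    case True
    have tN: "0 < t + N" using t N by simp
    let ?W = "{x \<in> conf. strict x \<and> (\<forall>i<?n. x i = y i \<or> x i = y i + - 1)}"
    have step: "one_step x y \<longleftrightarrow> (\<forall>i<?n. x i = y i \<or> x i = y i + - 1)" for x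
      unfolding one_step_def by (intro all_cong imp_cong refl) auto
    have "(\<Sum>x\<in>conf. left_weight t x * transition t x y) =
        (\<Sum>x\<in>?W. (alternant t x * (\<Prod>i<?n. g t (x i))) * (\<Prod>i<?n. 1 / u (t + 1) (y i)))"
      using True finite_conf
      by (intro sum.mono_neutral_cong_right) (auto simp: left_weight_def transition_def step)
    also have "\<dots> = (\<Prod>i<?n. 1 / u (t + 1) (y i)) * (\<Sum>x\<in>?W. alternant t x * (\<Prod>i<?n. g t (x i)))"
      unfolding sum_distrib_right[symmetric] by (rule mult.commute)
    also have "(\<Sum>x\<in>?W. alternant t x * (\<Prod>i<?n. g t (x i))) =
        (\<Prod>i<?n. C * (g (t + 1) (y i) * u (t + 1) (y i))) * ((\<Prod>j<?n. c j j) * vandermonde ?n (\<lambda>i. mu (t + 1) (y i)))"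
      unfolding alternant_def
    proof (rule alternant_step[where f = "g t" and m = "mu t" and M = "\<lambda>i. mu (t + 1) (y i)"
          and D = "\<lambda>i. C * (g (t + 1) (y i) * u (t + 1) (y i))" and c = c
          and stay = "\<lambda>i. g_stay t (y i)" and move = "\<lambda>i. g_move t (y i)", OF y True])
      fix i assume i: "i < ?n"
      note y0 = confD[OF y i]
      show "y i + - 1 \<notin> {0..S + N - 1} \<Longrightarrow> g t (y i + - 1) = 0" using y0 by (simp add: g_def)
      show "g t (y i) = C * (g (t + 1) (y i) * u (t + 1) (y i)) * g_stay t (y i)"
        "g t (y i + - 1) = C * (g (t + 1) (y i) * u (t + 1) (y i)) * g_move t (y i)"
        using g_step[of "y i" t] y0 tN by (simp_all add: C_def mult_ac)
      show "g_stay t (y i) * mu t (y i) ^ k + g_move t (y i) * mu t (y i + - 1) ^ k =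
          (\<Sum>j\<le>k. c k j * mu (t + 1) (y i) ^ j)" for k
        using g_moments[of t "y i" k] by (simp add: c_def)
    qed simp
    also have "(\<Prod>i<?n. 1 / u (t + 1) (y i)) * \<dots> = K * left_weight (t + 1) y"
      using True
      by (simp add: K_def left_weight_def alternant_def prod.distrib prod_dividef less_imp_neq[OF prod_pos, symmetric])
    finally show ?thesis .
  qed
  then show ?thesis by blast
qed

lemma right_weight_step:
  assumes t: "t < T"
  shows "\<exists>K. \<forall>x\<in>conf. (\<Sum>y\<in>conf. transition t x y * right_weight (t + 1) y) = K * right_weight t x"
proof -
  let ?n = "nat N"
  define C where "C = 1 / (u (t + 1) (S + N - 1) * h_stay t (S + N - 1))"
  define c where "c k = coeff (step_poly (1 / q) (- b * q powi (1 - S - t)) (q powi (1 - S - N))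
    (q powi (t + S - T)) k)" for k
  define K where "K = C ^ ?n * (\<Prod>j<?n. c j j)"
  have "(\<Sum>y\<in>conf. transition t x y * right_weight (t + 1) y) = K * right_weight t x" if x: "x \<in> conf" for x
  proof (cases "strict x")
    case False
    then show ?thesis by (simp add: right_weight_def transition_def)
  next
    case True
    let ?W = "{y \<in> conf. strict y \<and> (\<forall>i<?n. y i = x i \<or> y i = x i + 1)}"
    have "(\<Sum>y\<in>conf. transition t x y * right_weight (t + 1) y) =
        (\<Sum>y\<in>?W. alternant (t + 1) y * (\<Prod>i<?n. h (t + 1) (y i) / u (t + 1) (y i)))"
      using True finite_conf
      by (intro sum.mono_neutral_cong_right)
         (auto simp: right_weight_def transition_def one_step_def prod_dividef)
    also have "\<dots> = (\<Prod>i<?n. C * h t (x i)) * ((\<Prod>j<?n. c j j) * vandermonde ?n (\<lambda>i. mu t (x i)))"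
      unfolding alternant_def
    proof (rule alternant_step[where m = "mu (t + 1)" and M = "\<lambda>i. mu t (x i)"
          and D = "\<lambda>i. C * h t (x i)" and c = c and f = "\<lambda>s. h (t + 1) s / u (t + 1) s" and stay = "\<lambda>i. h_stay t (x i)"
          and move = "\<lambda>i. h_move t (x i)", OF x True])
      fix i assume i: "i < ?n"
      note x0 = confD[OF x i]
      show "x i + 1 \<notin> {0..S + N - 1} \<Longrightarrow> h (t + 1) (x i + 1) / u (t + 1) (x i + 1) = 0"
        using x0 by (simp add: h_def)
      show "h (t + 1) (x i) / u (t + 1) (x i) = C * h t (x i) * h_stay t (x i)"
        "h (t + 1) (x i + 1) / u (t + 1) (x i + 1) = C * h t (x i) * h_move t (x i)"
        using h_step[of "x i" t] x0 t by (simp_all add: C_def)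
      show "h_stay t (x i) * mu (t + 1) (x i) ^ k + h_move t (x i) * mu (t + 1) (x i + 1) ^ k =
          (\<Sum>j\<le>k. c k j * mu t (x i) ^ j)" for k
        using h_moments[of t "x i" k] by (simp add: c_def)
    qed simp
    also have "\<dots> = K * right_weight t x"
      using True by (simp add: K_def right_weight_def alternant_def prod.distrib)
    finally show ?thesis .
  qed
  then show ?thesis by blast
qed

end

section \<open>Path ensembles\<close>

lemma path_ensembles_bounds:
  assumes p: "p \<in> path_ensembles N T S" and i: "i \<in> {0..<N}" and t: "t \<in> {0..T}"
  shows "i \<le> p i t" "p i t \<le> i + t" "S + i - (T - t) \<le> p i t" "p i t \<le> S + i"
proof -
  have step: "p i (s + 1) = p i s \<or> p i (s + 1) = p i s + 1" if "s \<in> {0..<T}" for s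
    using p i that unfolding path_ensembles_def by blast
  have ends: "p i 0 = i" "p i T = S + i" using p i unfolding path_ensembles_def by blast+
  have "0 \<le> t" "t \<le> T" using t by auto
  have "0 \<le> s \<Longrightarrow> s \<le> T \<longrightarrow> i \<le> p i s \<and> p i s \<le> i + s" for s
  proof (induction s rule: int_ge_induct)
    case (step s)
    then show ?case using \<open>\<And>s. s \<in> {0..<T} \<Longrightarrow> _\<close>[of s] by auto
  qed (simp add: ends)
  then show "i \<le> p i t" "p i t \<le> i + t" using t by auto
  have "s \<le> T \<Longrightarrow> 0 \<le> s \<longrightarrow> S + i - (T - s) \<le> p i s \<and> p i s \<le> S + i" for s
  proof (induction s rule: int_le_induct)
    case (step s)
    then show ?case using \<open>\<And>s. s \<in> {0..<T} \<Longrightarrow> _\<close>[of "s - 1"] by auto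
  qed (simp add: ends)
  then show "S + i - (T - t) \<le> p i t" "p i t \<le> S + i" using t by auto
qed

lemma positions_subset_slice:
  assumes "p \<in> path_ensembles N T S" "t \<in> {0..T}"
  shows "positions N p t \<subseteq> slice N T S t"
proof
  fix x assume "x \<in> positions N p t"
  then obtain i where i: "i \<in> {0..<N}" "x = p i t" by (auto simp: positions_def)
  show "x \<in> slice N T S t"
    using path_ensembles_bounds[OF assms(1) i(1) assms(2)] i by (auto simp: slice_def)
qed

lemma path_ensembles_inj:
  assumes "p \<in> path_ensembles N T S" "t \<in> {0..T}"
  shows "inj_on (\<lambda>i. p i t) {0..<N}"
proof -
  have "strict_mono_on {0..<N} (\<lambda>i. p i t)" using assms unfolding path_ensembles_def by blast
  then show ?thesis by (rule strict_mono_on_imp_inj_on)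
qed

lemma strict_mono_on_interval:
  fixes x :: "nat \<Rightarrow> int"
  assumes "strict_mono_on {..<n} x" "\<And>i. i < n \<Longrightarrow> c \<le> x i" "\<And>i. i < n \<Longrightarrow> x i \<le> c + int n - 1"
    and "i < n"
  shows "x i = c + int i"
proof -
  have less: "x j < x k" if "j < k" "k < n" for j k
    using assms(1) that by (auto simp: strict_mono_on_def)
  have "c + int i \<le> x i" if "i < n" for i
    using that
  proof (induction i)
    case (Suc i)
    then show ?case using less[of i "Suc i"] by simp
  qed (use assms(2) in simp)
  moreover have "x (n - 1 - i) \<le> c + int (n - 1 - i)" if "i < n" for i
    using that
  proof (induction i)
    case 0
    then show ?case using assms(3)[of "n - 1"] by simp
  next
    case (Suc i)
    have "x (n - 1 - Suc i) < x (n - 1 - i)"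
      by (rule less) (use Suc.prems in auto)
    then show ?case using Suc by (simp add: of_nat_diff)
  qed
  from this[of "n - 1 - i"] have "x i \<le> c + int i" using assms(4) by simp
  ultimately show ?thesis using assms(4) by force
qed

context qracah
begin

definition path_weight :: "(int \<Rightarrow> int \<Rightarrow> int) \<Rightarrow> real" where
  "path_weight p = (\<Prod>t\<in>{1..T}. \<Prod>i\<in>{0..<N}. 1 / u t (p i t))"

lemma path_weight_pos: "0 < path_weight p"
  unfolding path_weight_def by (intro prod_pos) auto

lemma ensemble_weight_alt:
  assumes "Re \<kappa> = 0" "Im \<kappa> > 0" "b = (Im \<kappa>)\<^sup>2"
  shows "\<exists>K. K \<noteq> 0 \<and> (\<forall>p\<in>path_ensembles N T S.
    ensemble_weight N T S q \<kappa> p = K * complex_of_real (path_weight p))"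
proof -
  define k where "k = Im \<kappa>"
  have k: "0 < k" "\<kappa> = \<i> * of_real k" "b = k\<^sup>2"
    using assms by (auto simp: k_def complex_eq_iff)
  define c where "c t = q powr ((of_int t + of_int S - 1) / 2) / k" for t :: int
  define W where "W t x = hole_weight S q \<kappa> (of_int x - of_int t / 2 + 1)" for t x :: int
  have c: "c t > 0" for t using k q by (simp add: c_def)
  have W: "W t x = \<i> * of_real (c t * u t x)" for t x
  proof -
    define r where "r = q powr (real_of_int x - real_of_int t / 2 + 1 - (real_of_int S + 1) / 2)"
    have r: "0 < r" using q by (simp add: r_def)
    have "r\<^sup>2 = q powr (of_int (2 * x + 1 - S - t))"
      unfolding r_def power2_eq_square powr_add[symmetric]
      by (rule arg_cong[of _ _ "(powr) q"]) (simp add: field_simps)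
    then have r2: "r\<^sup>2 = q powi (2 * x + 1 - S - t)" 
      using q powr_real_of_int'[of q "2 * x + 1 - S - t"] by simp
    have "q powr ((of_int t + of_int S - 1) / 2) * q powi (- x) =
        q powr ((of_int t + of_int S - 1) / 2) * q powr (- of_int x)"
      using q powr_real_of_int'[of q "- x"] by simp
    also have "\<dots> = q powr (- (of_int x - of_int t / 2 + 1 - (of_int S + 1) / 2))"
      unfolding powr_add[symmetric]
      by (rule arg_cong[of _ _ "(powr) q"]) (simp add: field_simps)
    also have "\<dots> = 1 / r" by (simp only: r_def powr_minus inverse_eq_divide)
    finally have e: "q powr ((of_int t + of_int S - 1) / 2) * q powi (- x) = 1 / r" .
    have "c t * u t x = (q powr ((of_int t + of_int S - 1) / 2) * q powi (- x)) * bet (2 * x + 1 - S - t) / k"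
      by (simp add: c_def u_def)
    also have "\<dots> = 1 / (k * r) * (1 + k\<^sup>2 * r\<^sup>2)"
      unfolding e by (simp add: bet_def r2 k(3)[symmetric])
    also have "\<dots> = k * r + 1 / (k * r)" using k r by (simp add: field_simps power2_eq_square)
    finally have cu: "c t * u t x = k * r + 1 / (k * r)" .
    have "W t x = \<kappa> * of_real r - inverse (\<kappa> * of_real r)" by (simp add: W_def hole_weight_def r_def)
    also have "\<dots> = \<i> * of_real (k * r + 1 / (k * r))"
    proof -
      have "(\<i> * of_real (k * r)) * (- (\<i> * of_real (1 / (k * r)))) = complex_of_real ((k * r) * (1 / (k * r)))"
        unfolding of_real_mult by (simp add: algebra_simps)
      also have "\<dots> = 1" using k(1) r by simp
      finally have "inverse (\<i> * complex_of_real (k * r)) = - (\<i> * of_real (1 / (k * r)))"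
        by (rule inverse_unique)
      then show ?thesis unfolding k(2) by (simp add: mult.assoc distrib_left)
    qed
    finally show ?thesis by (simp add: cu)
  qed
  have W0: "W t x \<noteq> 0" for t x unfolding W using c[of t] u_pos[of t x] by (simp del: u_pos)
  define K where "K = (\<Prod>t\<in>{0..T}. (\<Prod>x\<in>slice N T S t. W t x) / (\<i> * of_real (c t)) ^ nat N) *
     of_real (\<Prod>i\<in>{0..<N}. 1 / u 0 i)"
  have "K \<noteq> 0"
    using W0 c by (auto simp: K_def slice_def less_imp_neq[OF c, symmetric])
  moreover have "ensemble_weight N T S q \<kappa> p = K * of_real (path_weight p)"
    if p: "p \<in> path_ensembles N T S" for p
  proof -
    have one: "(\<Prod>x\<in>holes N T S p t. W t x) =
        (\<Prod>x\<in>slice N T S t. W t x) / (\<i> * of_real (c t)) ^ nat N *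
        of_real (\<Prod>i\<in>{0..<N}. 1 / u t (p i t))" if t: "t \<in> {0..T}" for t
    proof -
      have fin: "finite (slice N T S t)" by (simp add: slice_def)
      have "(\<Prod>x\<in>positions N p t. W t x) = (\<Prod>i\<in>{0..<N}. W t (p i t))"
        unfolding positions_def by (simp add: prod.reindex[OF path_ensembles_inj[OF p t]])
      also have "\<dots> = (\<i> * of_real (c t)) ^ nat N * of_real (\<Prod>i\<in>{0..<N}. u t (p i t))"
        by (simp add: W prod.distrib power_mult_distrib mult_ac)
      finally have pos: "(\<Prod>x\<in>positions N p t. W t x) =
          (\<i> * of_real (c t)) ^ nat N * of_real (\<Prod>i\<in>{0..<N}. u t (p i t))" .
      have "(\<Prod>x\<in>slice N T S t. W t x) =
          (\<Prod>x\<in>holes N T S p t. W t x) * (\<Prod>x\<in>positions N p t. W t x)"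
        unfolding holes_def by (rule prod.subset_diff[OF positions_subset_slice[OF p t] fin])
      moreover have "(\<Prod>i\<in>{0..<N}. complex_of_real (u t (p i t))) \<noteq> 0" by (simp add: prod_zero_iff)
      ultimately show ?thesis
        unfolding pos using c[of t] by (simp add: prod_dividef field_simps)
    qed
    have "ensemble_weight N T S q \<kappa> p = (\<Prod>t\<in>{0..T}. \<Prod>x\<in>holes N T S p t. W t x)"
      by (simp add: ensemble_weight_def W_def)
    also have "\<dots> = (\<Prod>t\<in>{0..T}. (\<Prod>x\<in>slice N T S t. W t x) / (\<i> * of_real (c t)) ^ nat N *
        of_real (\<Prod>i\<in>{0..<N}. 1 / u t (p i t)))"
      by (intro prod.cong refl one)
    also have "\<dots> = (\<Prod>t\<in>{0..T}. (\<Prod>x\<in>slice N T S t. W t x) / (\<i> * of_real (c t)) ^ nat N) *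
        of_real (\<Prod>t\<in>{0..T}. \<Prod>i\<in>{0..<N}. 1 / u t (p i t))"
      by (simp only: prod.distrib of_real_prod)
    also have "(\<Prod>t\<in>{0..T}. \<Prod>i\<in>{0..<N}. 1 / u t (p i t)) =
        (\<Prod>i\<in>{0..<N}. 1 / u 0 (p i 0)) * path_weight p"
    proof -
      have "{0..T} = insert 0 {1..T}" using S by auto
      then show ?thesis by (simp add: path_weight_def)
    qed
    also have "(\<Prod>i\<in>{0..<N}. 1 / u 0 (p i 0)) = (\<Prod>i\<in>{0..<N}. 1 / u 0 i)"
      using p by (intro prod.cong) (auto simp: path_ensembles_def)
    finally show ?thesis by (simp add: K_def mult_ac)
  qed
  ultimately show ?thesis by blast
qed

lemma qRacah_prob_alt:
  assumes "Re \<kappa> = 0" "Im \<kappa> > 0" "b = (Im \<kappa>)\<^sup>2"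
  shows "qRacah_prob N T S q \<kappa> E =
    (\<Sum>p\<in>path_ensembles N T S. path_weight p * of_bool (E p)) / (\<Sum>p\<in>path_ensembles N T S. path_weight p)"
proof -
  obtain K where K: "K \<noteq> 0" "\<And>p. p \<in> path_ensembles N T S \<Longrightarrow>
      ensemble_weight N T S q \<kappa> p = K * complex_of_real (path_weight p)"
    using ensemble_weight_alt[OF assms] by blast
  have "(\<Sum>p\<in>{p \<in> path_ensembles N T S. E p}. ensemble_weight N T S q \<kappa> p) =
      K * of_real (\<Sum>p\<in>{p \<in> path_ensembles N T S. E p}. path_weight p)"
    using K(2) by (simp add: sum_distrib_left)
  moreover have "(\<Sum>p\<in>path_ensembles N T S. ensemble_weight N T S q \<kappa> p) =
      K * of_real (\<Sum>p\<in>path_ensembles N T S. path_weight p)"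
    using K(2) by (simp add: sum_distrib_left)
  ultimately have "qRacah_prob N T S q \<kappa> E = Re (of_real (\<Sum>p\<in>{p \<in> path_ensembles N T S. E p}. path_weight p) /
      of_real (\<Sum>p\<in>path_ensembles N T S. path_weight p))"
    unfolding qRacah_prob_def using K(1) by simp
  also have "\<dots> = (\<Sum>p\<in>{p \<in> path_ensembles N T S. E p}. path_weight p) /
      (\<Sum>p\<in>path_ensembles N T S. path_weight p)"
    unfolding of_real_divide[symmetric] by (rule Re_complex_of_real)
  also have "(\<Sum>p\<in>{p \<in> path_ensembles N T S. E p}. path_weight p) =
      (\<Sum>p\<in>path_ensembles N T S. path_weight p * of_bool (E p))"
    using finite_path_ensembles by (intro sum.mono_neutral_cong_left) auto
  finally show ?thesis .
qed

definition start :: "nat \<Rightarrow> int" where "start = (\<lambda>i\<in>{..<nat N}. int i)"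

definition finish :: "nat \<Rightarrow> int" where "finish = (\<lambda>i\<in>{..<nat N}. S + int i)"

lemma sum_path_ensembles:
  assumes j: "j \<le> nat T"
  shows "(\<Sum>p\<in>path_ensembles N T S. path_weight p * f (positions N p (int j))) =
    (\<Sum>Y\<in>PiE {..nat T} (\<lambda>_. conf). of_bool (Y 0 = start) *
      (\<Prod>k<nat T. transition (int k) (Y k) (Y (Suc k))) * f (Y j ` {..<nat N}) * of_bool (Y (nat T) = finish))"
proof -
  define good where "good = {Y \<in> PiE {..nat T} (\<lambda>_. conf). Y 0 = start \<and> Y (nat T) = finish \<and>
    (\<forall>k<nat T. strict (Y k) \<and> strict (Y (Suc k)) \<and> one_step (Y k) (Y (Suc k)))}"
  define to_conf where "to_conf p = (\<lambda>k\<in>{..nat T}. \<lambda>i\<in>{..<nat N}. p (int i) (int k))" for p :: "int \<Rightarrow> int \<Rightarrow> int"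
  define of_conf where "of_conf Y = (\<lambda>i\<in>{0..<N}. \<lambda>t\<in>{0..T}. Y (nat t) (nat i))" for Y :: "nat \<Rightarrow> nat \<Rightarrow> int"
  have T0: "0 \<le> T" using S by simp
  have fin: "finite (PiE {..nat T} (\<lambda>_. conf))" using finite_conf by (intro finite_PiE) auto
  have "(\<Sum>p\<in>path_ensembles N T S. path_weight p * f (positions N p (int j))) =
    (\<Sum>Y\<in>good. (\<Prod>k<nat T. \<Prod>i<nat N. 1 / u (int k + 1) (Y (Suc k) i)) * f (Y j ` {..<nat N}))"
  proof (rule sum.reindex_bij_witness[of _ of_conf to_conf])
    fix p assume p: "p \<in> path_ensembles N T S"
    have pE: "p \<in> {0..<N} \<rightarrow>\<^sub>E ({0..T} \<rightarrow>\<^sub>E {0..S + N - 1})" using p by (simp add: path_ensembles_def)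
    have pi: "p i \<in> {0..T} \<rightarrow>\<^sub>E {0..S + N - 1}" if "i \<in> {0..<N}" for i
      using PiE_mem[OF pE that] .
    show "of_conf (to_conf p) = p"
    proof (intro ext)
      fix i t
      show "of_conf (to_conf p) i t = p i t"
      proof (cases "i \<in> {0..<N}")
        case True
        then show ?thesis using PiE_arb[OF pi[OF True], of t] by (auto simp: of_conf_def to_conf_def)
      next
        case False
        then show ?thesis using PiE_arb[OF pE False] by (auto simp: of_conf_def)
      qed
    qed
    have mono: "strict (to_conf p k)" if "k \<le> nat T" for k
    proof -
      have *: "strict_mono_on {0..<N} (\<lambda>i. p i (int k))"
        using p that T0 by (auto simp: path_ensembles_def)
      show ?thesis
      proof (rule strict_mono_onI)
        fix r s assume "r \<in> {..<nat N}" "s \<in> {..<nat N}" "r < s"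
        then show "to_conf p k r < to_conf p k s"
          using that strict_mono_onD[OF *, of "int r" "int s"] by (auto simp: to_conf_def)
      qed
    qed
    have pstep: "p i (t + 1) = p i t \<or> p i (t + 1) = p i t + 1" if "i \<in> {0..<N}" "t \<in> {0..<T}" for i t
      using p that unfolding path_ensembles_def by blast
    have "one_step (to_conf p k) (to_conf p (Suc k))" if "k < nat T" for k
      unfolding one_step_def
    proof (intro allI impI)
      fix i assume "i < nat N"
      then show "to_conf p (Suc k) i = to_conf p k i \<or> to_conf p (Suc k) i = to_conf p k i + 1"
        using that pstep[of "int i" "int k"] by (auto simp: to_conf_def add.commute)
    qed
    moreover have "to_conf p \<in> PiE {..nat T} (\<lambda>_. conf)"
    proof -
      have "p (int i) (int k) \<in> {0..S + N - 1}" if "k \<le> nat T" "i < nat N" for k i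
      proof -
        have "int k \<in> {0..T}" "int i \<in> {0..<N}" using that T0 by auto
        then show ?thesis using PiE_mem[OF pi] by blast
      qed
      then show ?thesis unfolding to_conf_def conf_def restrict_PiE_iff by auto
    qed
    moreover have "to_conf p 0 = start" "to_conf p (nat T) = finish"
      using p T0 by (auto simp: to_conf_def start_def finish_def path_ensembles_def fun_eq_iff restrict_def)
    ultimately show "to_conf p \<in> good" using mono by (simp add: good_def)
    have "path_weight p = (\<Prod>k<nat T. \<Prod>i<nat N. 1 / u (int k + 1) (p (int i) (int k + 1)))"
    proof -
      have "(\<Prod>i\<in>{0..<N}. 1 / u t (p i t)) = (\<Prod>i<nat N. 1 / u t (p (int i) t))" for t
        by (rule prod.reindex_bij_witness[of _ int nat]) auto
      then show ?thesis unfolding path_weight_def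
        by (intro prod.reindex_bij_witness[of _ "\<lambda>k. int k + 1" "\<lambda>t. nat (t - 1)"]) auto
    qed
    also have "\<dots> = (\<Prod>k<nat T. \<Prod>i<nat N. 1 / u (int k + 1) (to_conf p (Suc k) i))"
      by (intro prod.cong) (auto simp: to_conf_def add.commute)
    finally have "path_weight p = (\<Prod>k<nat T. \<Prod>i<nat N. 1 / u (int k + 1) (to_conf p (Suc k) i))" .
    moreover have "positions N p (int j) = to_conf p j ` {..<nat N}"
    proof -
      have "{0..<N} = int ` {..<nat N}" using N by (auto simp: image_iff intro!: bexI[of _ "nat _"])
      then show ?thesis using j by (auto simp: positions_def to_conf_def image_image)
    qed
    ultimately show "(\<Prod>k<nat T. \<Prod>i<nat N. 1 / u (int k + 1) (to_conf p (Suc k) i)) * f (to_conf p j ` {..<nat N}) =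
        path_weight p * f (positions N p (int j))" by simp
  next
    fix Y assume Y: "Y \<in> good"
    have YE: "Y \<in> {..nat T} \<rightarrow>\<^sub>E conf" using Y by (simp add: good_def)
    have Yk: "Y k \<in> conf" if "k \<le> nat T" for k using PiE_mem[OF YE] that by auto
    show "to_conf (of_conf Y) = Y"
    proof (intro ext)
      fix k i
      show "to_conf (of_conf Y) k i = Y k i"
      proof (cases "k \<le> nat T")
        case True
        then show ?thesis using Yk[OF True] N S
          by (auto simp: of_conf_def to_conf_def conf_def PiE_def extensional_def)
      next
        case False
        then show ?thesis using PiE_arb[OF YE, of k] by (auto simp: to_conf_def)
      qed
    qed
    have step: "strict (Y k)" "strict (Y (Suc k))" "one_step (Y k) (Y (Suc k))" if "k < nat T" for k
      using Y that by (auto simp: good_def)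
    have strictY: "strict (Y k)" if "k \<le> nat T" for k
    proof (cases k)
      case 0
      have "strict start" by (auto simp: start_def strict_mono_on_def)
      then show ?thesis using Y 0 by (simp add: good_def)
    next
      case (Suc k')
      then show ?thesis using step[of k'] that by simp
    qed
    have "of_conf Y \<in> {0..<N} \<rightarrow>\<^sub>E ({0..T} \<rightarrow>\<^sub>E {0..S + N - 1})"
      using confD[OF Yk] by (auto simp: of_conf_def nat_mono)
    moreover have "of_conf Y i 0 = i \<and> of_conf Y i T = S + i" if "i \<in> {0..<N}" for i
      using Y that T0 by (auto simp: good_def of_conf_def start_def finish_def)
    moreover have "of_conf Y i (t + 1) = of_conf Y i t \<or> of_conf Y i (t + 1) = of_conf Y i t + 1"
      if "i \<in> {0..<N}" "t \<in> {0..<T}" for i t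
    proof -
      have "nat (t + 1) = Suc (nat t)" using that by auto
      then show ?thesis using step(3)[of "nat t"] that by (auto simp: of_conf_def one_step_def)
    qed
    moreover have "strict_mono_on {0..<N} (\<lambda>i. of_conf Y i t)" if "t \<in> {0..T}" for t
      using strictY[of "nat t"] that by (auto simp: of_conf_def strict_mono_on_def)
    ultimately show "of_conf Y \<in> path_ensembles N T S" by (simp add: path_ensembles_def)
  qed
  also have "\<dots> = (\<Sum>Y\<in>PiE {..nat T} (\<lambda>_. conf). of_bool (Y 0 = start) *
      (\<Prod>k<nat T. transition (int k) (Y k) (Y (Suc k))) * f (Y j ` {..<nat N}) * of_bool (Y (nat T) = finish))"
  proof (rule sum.mono_neutral_cong_left[OF fin])
    show "good \<subseteq> PiE {..nat T} (\<lambda>_. conf)" by (auto simp: good_def)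
    show "\<forall>Y\<in>PiE {..nat T} (\<lambda>_. conf) - good. of_bool (Y 0 = start) *
      (\<Prod>k<nat T. transition (int k) (Y k) (Y (Suc k))) * f (Y j ` {..<nat N}) * of_bool (Y (nat T) = finish) = 0"
    proof
      fix Y assume Y: "Y \<in> PiE {..nat T} (\<lambda>_. conf) - good"
      then consider "Y 0 \<noteq> start" | "Y (nat T) \<noteq> finish"
        | k where "k < nat T" "\<not> (strict (Y k) \<and> strict (Y (Suc k)) \<and> one_step (Y k) (Y (Suc k)))"
        by (auto simp: good_def)
      then show "of_bool (Y 0 = start) * (\<Prod>k<nat T. transition (int k) (Y k) (Y (Suc k))) *
          f (Y j ` {..<nat N}) * of_bool (Y (nat T) = finish) = 0"
      proof cases
        case 3
        then have "(\<Prod>k<nat T. transition (int k) (Y k) (Y (Suc k))) = 0"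
          by (intro prod_zero bexI[of _ k]) (auto simp: transition_def)
        then show ?thesis by simp
      qed auto
    qed
  qed (auto simp: good_def transition_def intro!: prod.cong)
  finally show ?thesis .
qed

end

section \<open>The law of a slice\<close>

context qracah
begin

definition lo :: "int \<Rightarrow> int" where "lo t = max 0 (t + S - T)"

definition hi :: "int \<Rightarrow> int" where "hi t = min (t + N - 1) (S + N - 1)"

lemma slice_alt: "slice N T S t = {lo t..hi t}"
  by (simp add: slice_def lo_def hi_def)

abbreviation ratio :: "int \<Rightarrow> int \<Rightarrow> real" where
  "ratio t x \<equiv> weight_ratio N T S q (- b) t x"

definition w :: "int \<Rightarrow> int \<Rightarrow> real" where
  "w t x = slice_weight N T S q (- b) t x"

lemma weight_ratio_alt:
  "ratio t x = q powi (S + t - T - 2 * x - 1) *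
     (bet (N + x + 1 - S) * bet (N + x + 1 - t) * gam (x + 1) * gam (T + x + 1 - S - t) * bet (2 * x + 1 - S - t)) /
     (bet (x + 1 - T) * bet (x + 1 - S - t) * gam (N + S - x - 1) * gam (N + t - x - 1) * bet (2 * x + 3 - S - t))"
proof -
  have bet: "q powi c + b * q powi d = q powi c * bet (d - c)" for c d
    by (simp add: bet_def power_int_diff field_simps)
  have "ratio t x =
     (q * gam (x + 1) * (q powi S * bet (N + x + 1 - S)) * (q powi t * bet (N + x + 1 - t)) *
       (q powi (S + t) * bet (2 * x + 1 - (S + t))) * (q powi (S + t) * gam (T + x + 1 - (S + t)))) /
     ((q powi T * bet (x + 1 - T)) * (- (q powi (x + 1) * gam (N + S - (x + 1)))) *
       (- (q powi (x + 1) * gam (N + t - (x + 1)))) * (q powi (S + t) * bet (x + 1 - (S + t))) *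
       (q powi (S + t) * bet (2 * x + 3 - (S + t))))"
    unfolding weight_ratio_def bet[symmetric] qpow_minus_gam[symmetric] by (simp add: gam_def)
  also have "\<dots> = (q * q powi S * q powi t / (q powi T * q powi (x + 1) * q powi (x + 1))) *
     (bet (N + x + 1 - S) * bet (N + x + 1 - t) * gam (x + 1) * gam (T + x + 1 - S - t) * bet (2 * x + 1 - S - t)) /
     (bet (x + 1 - T) * bet (x + 1 - S - t) * gam (N + S - x - 1) * gam (N + t - x - 1) * bet (2 * x + 3 - S - t))"
    by (simp add: diff_diff_eq[symmetric] mult_ac)
  also have "q * q powi S * q powi t / (q powi T * q powi (x + 1) * q powi (x + 1)) = q powi (S + t - T - 2 * x - 1)"
    by (simp add: power_int_add power_int_diff qpow_double power2_eq_square field_simps)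
  finally show ?thesis .
qed

lemma w_lo: "w t (lo t) = 1"
  by (simp add: w_def slice_weight_def lo_def)

lemma w_Suc:
  assumes "lo t \<le> x"
  shows "w t (x + 1) = w t x / ratio t x"
proof -
  have "{lo t..<x + 1} = insert x {lo t..<x}" using assms by auto
  then show ?thesis by (simp add: w_def slice_weight_def lo_def[symmetric] divide_inverse)
qed

lemma weight_ratio_pos:
  assumes "lo t \<le> x" "x < hi t"
  shows "0 < ratio t x"
  using assms unfolding weight_ratio_alt lo_def hi_def
  by (intro divide_pos_pos mult_pos_pos) auto

lemma w_pos:
  assumes "x \<in> slice N T S t"
  shows "0 < w t x"
proof -
  have "lo t \<le> x \<Longrightarrow> x \<le> hi t \<longrightarrow> 0 < w t x"
  proof (induction x rule: int_ge_induct)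
    case (step x)
    then show ?case using weight_ratio_pos[of t x] by (auto simp: w_Suc)
  qed (simp add: w_lo)
  then show ?thesis using assms by (auto simp: slice_alt)
qed

lemma gh_step:
  assumes "0 \<le> x" "x < S + N - 1" "t + S - T \<le> x" "x < t + N - 1"
  shows "g t x * h t x = ratio t x * (g t (x + 1) * h t (x + 1))"
proof -
  have nz: "gam (x + 1) \<noteq> 0" "gam (N + S - x - 1) \<noteq> 0" "gam (N + t - x - 1) \<noteq> 0"
    using assms by simp_all
  have hr: "h_ratio t x = q powi (t + S - T - x) * (bet (N + x + 1 - t) * gam (T + x + 1 - S - t) *
      bet (2 * x + 1 - S - t)) / (bet (2 * x + 3 - S - t) * gam (N + S - x - 1) * bet (x + 1 - T))"
    using h_ratio_alt[OF assms(2), of t] by (simp add: algebra_simps)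
  have gr: "g_ratio t (x + 1) = q powi (x + 1) * bet (x + 1 - S - t) * gam (N + t - x - 1) /
      (gam (x + 1) * bet (N + x + 1 - S))"
    by (simp add: g_ratio_def algebra_simps)
  have e: "q powi (t + S - T - x) = q powi (S + t - T - 2 * x - 1) * q powi (x + 1)"
    unfolding qpow_add[symmetric] by (simp add: algebra_simps)
  have "h_ratio t x = ratio t x * g_ratio t (x + 1)"
    unfolding hr gr weight_ratio_alt e using nz by (simp add: divide_simps)
  then show ?thesis by (simp add: h_Suc[OF assms(2)] g_Suc[OF assms(1)])
qed

lemma gh_eq_w:
  assumes "x \<in> slice N T S t"
  shows "g t x * h t x = g t (lo t) * h t (lo t) * w t x"
proof -
  have "lo t \<le> x \<Longrightarrow> x \<le> hi t \<longrightarrow> g t x * h t x = g t (lo t) * h t (lo t) * w t x"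
  proof (induction x rule: int_ge_induct)
    case (step x)
    show ?case
    proof
      assume x: "x + 1 \<le> hi t"
      then have IH: "g t x * h t x = g t (lo t) * h t (lo t) * w t x" using step by simp
      have "g t x * h t x = ratio t x * (g t (x + 1) * h t (x + 1))"
        using step(1) x by (intro gh_step) (auto simp: lo_def hi_def)
      moreover have "0 < ratio t x" using step(1) x by (intro weight_ratio_pos) auto
      ultimately have "g t (x + 1) * h t (x + 1) = g t x * h t x / ratio t x" by simp
      then show "g t (x + 1) * h t (x + 1) = g t (lo t) * h t (lo t) * w t (x + 1)"
        unfolding IH w_Suc[OF step(1)] by simp
    qed
  qed (simp add: w_lo)
  then show ?thesis using assms by (auto simp: slice_alt)
qed

lemma gh_outside:
  assumes "x \<notin> slice N T S t" "0 \<le> t" "t \<le> T"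
  shows "g t x * h t x = 0"
proof -
  consider "x < 0" | "t + N \<le> x" | "x < t + S - T" | "S + N - 1 < x"
    using assms(1) by (force simp: slice_def)
  then show ?thesis
  proof cases
    case 2
    then show ?thesis using g_eq_0[of t x] N assms by simp
  next
    case 3
    then show ?thesis using h_eq_0[of x t] N assms by simp
  qed (simp_all add: g_def h_def)
qed

definition slice_configs :: "int \<Rightarrow> int set set" where
  "slice_configs t = {X. X \<subseteq> slice N T S t \<and> card X = nat N}"

lemma mu_strict_mono: "x < y \<Longrightarrow> mu t x < mu t y"
proof -
  assume "x < y"
  then have "q powi (- x) < q powi (- y)" using qpow_less[of "- y" "- x"] by simp
  moreover have "b * q powi (y + 1 - S - t) < b * q powi (x + 1 - S - t)"
    using b \<open>x < y\<close> qpow_less[of "x + 1 - S - t" "y + 1 - S - t"] by simp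
  ultimately show ?thesis by (simp add: mu_def slice_mu_def)
qed

lemma mu_inj: "inj_on (mu t) A"
  by (rule inj_onI) (metis mu_strict_mono linorder_neq_iff)

lemma alternant_nonzero: "strict x \<Longrightarrow> alternant t x \<noteq> 0"
  unfolding alternant_def
  using comp_inj_on[OF strict_mono_on_imp_inj_on[of "{..<nat N}" x] mu_inj[of t]]
  by (intro vandermonde_nonzero) (simp add: comp_def)

lemma left_weight_0: "\<exists>c. c \<noteq> 0 \<and> (\<forall>x\<in>conf. left_weight 0 x = c * of_bool (x = start))"
proof (intro exI conjI ballI)
  have st: "strict start" by (auto simp: start_def strict_mono_on_def)
  have "g 0 (start i) \<noteq> 0" if "i < nat N" for i
    using g_pos[of "start i" 0] that by (auto simp: start_def zless_nat_eq_int_zless)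
  then show "alternant 0 start * (\<Prod>i<nat N. g 0 (start i)) \<noteq> 0"
    using alternant_nonzero[OF st] by simp
  fix x assume x: "x \<in> conf"
  show "left_weight 0 x = alternant 0 start * (\<Prod>i<nat N. g 0 (start i)) * of_bool (x = start)"
  proof (cases "strict x \<and> (\<forall>i<nat N. x i < N)")
    case True
    then have "x i = 0 + int i" if "i < nat N" for i
      using confD[OF x] that N by (intro strict_mono_on_interval[of "nat N" x]) auto
    then have "x = start"
      using x by (auto simp: conf_def start_def fun_eq_iff PiE_def extensional_def)
    then show ?thesis using st by (simp add: left_weight_def)
  next
    case False
    have "x \<noteq> start" using False st by (auto simp: start_def)
    moreover have "left_weight 0 x = 0"
    proof (cases "strict x")
      case True
      then obtain i where "i < nat N" "N \<le> x i" using False by (auto simp: not_less)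
      then have "(\<Prod>i<nat N. g 0 (x i)) = 0" using N by (intro prod_zero bexI[of _ i]) (auto intro: g_eq_0)
      then show ?thesis by (simp add: left_weight_def)
    qed (simp add: left_weight_def)
    ultimately show ?thesis by simp
  qed
qed

lemma right_weight_T: "\<exists>c. c \<noteq> 0 \<and> (\<forall>x\<in>conf. right_weight T x = c * of_bool (x = finish))"
proof (intro exI conjI ballI)
  have st: "strict finish" by (auto simp: finish_def strict_mono_on_def)
  have "h T (finish i) \<noteq> 0" if "i < nat N" for i
    using h_pos[of T "finish i"] that by (auto simp: finish_def zless_nat_eq_int_zless)
  then show "alternant T finish * (\<Prod>i<nat N. h T (finish i)) \<noteq> 0"
    using alternant_nonzero[OF st] by simp
  fix x assume x: "x \<in> conf"
  show "right_weight T x = alternant T finish * (\<Prod>i<nat N. h T (finish i)) * of_bool (x = finish)"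
  proof (cases "strict x \<and> (\<forall>i<nat N. S \<le> x i)")
    case True
    then have "x i = S + int i" if "i < nat N" for i
      using confD[OF x] that N by (intro strict_mono_on_interval[of "nat N" x]) auto
    then have "x = finish"
      using x by (auto simp: conf_def finish_def fun_eq_iff PiE_def extensional_def)
    then show ?thesis using st by (simp add: right_weight_def)
  next
    case False
    have "x \<noteq> finish" using False st by (auto simp: finish_def)
    moreover have "right_weight T x = 0"
    proof (cases "strict x")
      case True
      then obtain i where "i < nat N" "x i < S" using False by (auto simp: not_le)
      then have "(\<Prod>i<nat N. h T (x i)) = 0" using N by (intro prod_zero bexI[of _ i]) (auto intro: h_eq_0)
      then show ?thesis by (simp add: right_weight_def)
    qed (simp add: right_weight_def)
    ultimately show ?thesis by simp
  qed
qed

lemma slice_density: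
  assumes t: "0 \<le> t" "t \<le> T"
  shows "\<exists>C. \<forall>f. (\<Sum>x\<in>conf. left_weight t x * f (x ` {..<nat N}) * right_weight t x) =
    C * (\<Sum>X\<in>slice_configs t. ope_mass (w t) (mu t) X * f X)"
proof (intro exI allI)
  fix f :: "int set \<Rightarrow> real"
  define gh where "gh x = g t x * h t x" for x
  define c where "c = g t (lo t) * h t (lo t)"
  have "(\<Sum>x\<in>conf. left_weight t x * f (x ` {..<nat N}) * right_weight t x) =
      (\<Sum>x\<in>{x \<in> conf. strict x}. ope_mass gh (mu t) (x ` {..<nat N}) * f (x ` {..<nat N}))"
  proof (rule sum.mono_neutral_cong_right[OF finite_conf])
    fix x assume x: "x \<in> {x \<in> conf. strict x}"
    then have "inj_on x {..<nat N}" by (auto intro: strict_mono_on_imp_inj_on)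
    then show "left_weight t x * f (x ` {..<nat N}) * right_weight t x =
        ope_mass gh (mu t) (x ` {..<nat N}) * f (x ` {..<nat N})"
      using x by (simp add: ope_mass_image left_weight_def right_weight_def alternant_def
        gh_def prod.distrib power2_eq_square)
  qed (auto simp: left_weight_def)
  also have "\<dots> = (\<Sum>X\<in>{X. X \<subseteq> {0..S + N - 1} \<and> finite X \<and> card X = nat N}. ope_mass gh (mu t) X * f X)"
    unfolding conf_def by (rule sum_strict_mono_configs[of "\<lambda>X. ope_mass gh (mu t) X * f X"])
  also have "\<dots> = (\<Sum>X\<in>slice_configs t. c ^ nat N * (ope_mass (w t) (mu t) X * f X))"
  proof (rule sum.mono_neutral_cong_right)
    show "finite {X. X \<subseteq> {0..S + N - 1} \<and> finite X \<and> card X = nat N}"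
      by (rule finite_subset[of _ "Pow {0..S + N - 1}"]) auto
    show "slice_configs t \<subseteq> {X. X \<subseteq> {0..S + N - 1} \<and> finite X \<and> card X = nat N}"
      by (auto simp: slice_configs_def slice_def intro: finite_subset[OF _ finite_atLeastAtMost_int])
    show "\<forall>X\<in>{X. X \<subseteq> {0..S + N - 1} \<and> finite X \<and> card X = nat N} - slice_configs t.
        ope_mass gh (mu t) X * f X = 0"
    proof
      fix X assume X: "X \<in> {X. X \<subseteq> {0..S + N - 1} \<and> finite X \<and> card X = nat N} - slice_configs t"
      then obtain x where "x \<in> X" "x \<notin> slice N T S t" by (auto simp: slice_configs_def)
      then have "(\<Prod>x\<in>X. gh x) = 0"
        using gh_outside[OF _ t] X by (intro prod_zero bexI[of _ x]) (auto simp: gh_def)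
      then show "ope_mass gh (mu t) X * f X = 0" by (simp add: ope_mass_def)
    qed
    fix X assume X: "X \<in> slice_configs t"
    have "(\<Prod>x\<in>X. gh x) = (\<Prod>x\<in>X. c * w t x)"
      using X by (intro prod.cong) (auto simp: gh_def c_def slice_configs_def intro!: gh_eq_w)
    also have "\<dots> = c ^ nat N * (\<Prod>x\<in>X. w t x)"
      using X by (simp add: prod.distrib slice_configs_def)
    finally show "ope_mass gh (mu t) X * f X = c ^ nat N * (ope_mass (w t) (mu t) X * f X)"
      by (simp add: ope_mass_def)
  qed
  also have "\<dots> = c ^ nat N * (\<Sum>X\<in>slice_configs t. ope_mass (w t) (mu t) X * f X)"
    by (simp add: sum_distrib_left)
  finally show "(\<Sum>x\<in>conf. left_weight t x * f (x ` {..<nat N}) * right_weight t x) =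
      (g t (lo t) * h t (lo t)) ^ nat N * (\<Sum>X\<in>slice_configs t. ope_mass (w t) (mu t) X * f X)"
    by (simp add: c_def)
qed

lemma slice_law:
  assumes t: "0 \<le> t" "t \<le> T"
  shows "\<exists>C. \<forall>f. (\<Sum>p\<in>path_ensembles N T S. path_weight p * f (positions N p t)) =
    C * (\<Sum>X\<in>slice_configs t. ope_mass (w t) (mu t) X * f X)"
proof -
  obtain K where K: "\<And>k y. y \<in> conf \<Longrightarrow> (\<Sum>x\<in>conf. left_weight (int k) x * transition (int k) x y) =
      K k * left_weight (int (Suc k)) y"
    using left_weight_step[of "int _"] by (simp add: add.commute) metis
  have "\<forall>k. \<exists>K. k < nat T \<longrightarrow> (\<forall>x\<in>conf. (\<Sum>y\<in>conf. transition (int k) x y * right_weight (int (Suc k)) y) =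
      K * right_weight (int k) x)"
    using right_weight_step[of "int _"] by (simp add: add.commute)
  then obtain K' where K': "\<And>k x. k < nat T \<Longrightarrow> x \<in> conf \<Longrightarrow>
      (\<Sum>y\<in>conf. transition (int k) x y * right_weight (int (Suc k)) y) = K' k * right_weight (int k) x"
    by metis
  obtain c0 where c0: "c0 \<noteq> 0" "\<And>x. x \<in> conf \<Longrightarrow> left_weight 0 x = c0 * of_bool (x = start)"
    using left_weight_0 by blast
  obtain c1 where c1: "c1 \<noteq> 0" "\<And>x. x \<in> conf \<Longrightarrow> right_weight T x = c1 * of_bool (x = finish)"
    using right_weight_T by blast
  obtain C where C: "\<And>f. (\<Sum>x\<in>conf. left_weight t x * f (x ` {..<nat N}) * right_weight t x) =
      C * (\<Sum>X\<in>slice_configs t. ope_mass (w t) (mu t) X * f X)"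
    using slice_density[OF t] by blast
  define P where "P = (\<Prod>k<nat t. K k) * (\<Prod>k=nat t..<nat T. K' k)"
  have "(\<Sum>p\<in>path_ensembles N T S. path_weight p * f (positions N p t)) =
      (P * C / (c0 * c1)) * (\<Sum>X\<in>slice_configs t. ope_mass (w t) (mu t) X * f X)" for f
  proof -
    have jT: "nat t \<le> nat T" using t by simp
    have T: "int (nat T) = T" "int (nat t) = t" using t by auto
    have "(\<Sum>p\<in>path_ensembles N T S. path_weight p * f (positions N p t)) * (c0 * c1) =
      (\<Sum>Y\<in>PiE {..nat T} (\<lambda>_. conf). (of_bool (Y 0 = start) *
      (\<Prod>k<nat T. transition (int k) (Y k) (Y (Suc k))) * f (Y (nat t) ` {..<nat N}) * of_bool (Y (nat T) = finish)) * (c0 * c1))"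
      using sum_path_ensembles[OF jT, of f] unfolding T by (simp add: sum_distrib_right)
    also have "\<dots> = (\<Sum>Y\<in>PiE {..nat T} (\<lambda>_. conf). left_weight (int 0) (Y 0) *
      (\<Prod>k<nat T. transition (int k) (Y k) (Y (Suc k))) * f (Y (nat t) ` {..<nat N}) * right_weight (int (nat T)) (Y (nat T)))"
    proof (rule sum.cong[OF refl])
      fix Y assume Y: "Y \<in> PiE {..nat T} (\<lambda>_. conf)"
      then have "Y 0 \<in> conf" "Y (nat T) \<in> conf" by auto
      then show "(of_bool (Y 0 = start) * (\<Prod>k<nat T. transition (int k) (Y k) (Y (Suc k))) *
          f (Y (nat t) ` {..<nat N}) * of_bool (Y (nat T) = finish)) * (c0 * c1) =
        left_weight (int 0) (Y 0) * (\<Prod>k<nat T. transition (int k) (Y k) (Y (Suc k))) *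
          f (Y (nat t) ` {..<nat N}) * right_weight (int (nat T)) (Y (nat T))"
        using t by (simp add: c0 c1)
    qed
    also have "\<dots> = P * (\<Sum>x\<in>conf. left_weight (int (nat t)) x * f (x ` {..<nat N}) * right_weight (int (nat t)) x)"
      unfolding P_def
      by (rule transfer_marginal[OF jT, where l = "\<lambda>k. left_weight (int k)" and r = "\<lambda>k. right_weight (int k)"
          and f = "\<lambda>x. f (x ` {..<nat N})" and A = "\<lambda>k. transition (int k)"]) (use K K' in auto)
    also have "\<dots> = P * C * (\<Sum>X\<in>slice_configs t. ope_mass (w t) (mu t) X * f X)"
      unfolding T C by simp
    finally show ?thesis using c0(1) c1(1) by (simp add: field_simps)
  qed
  then show ?thesis by blast
qed

end

section \<open>Exchange ratios\<close>

context q_parameters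
begin

definition neg_part :: "int \<Rightarrow> int" where "neg_part a = min 0 a"

definition near :: "real \<Rightarrow> real \<Rightarrow> bool" where
  "near c x \<longleftrightarrow> exp (- c) \<le> x \<and> x \<le> exp c"

definition compar :: "real \<Rightarrow> int \<Rightarrow> real \<Rightarrow> bool" where
  "compar c e x \<longleftrightarrow> near c (x / q powi e)"

lemma near_pos: "near c x \<Longrightarrow> 0 < x"
  unfolding near_def using exp_gt_zero[of "- c"] by linarith

lemma near_mult:
  assumes "near c x" "near d y"
  shows "near (c + d) (x * y)"
proof -
  have "exp (- c) * exp (- d) \<le> x * y" "x * y \<le> exp c * exp d"
    using assms near_pos[OF assms(1)] near_pos[OF assms(2)]
    by (auto simp: near_def intro!: mult_mono)
  then show ?thesis by (simp add: near_def exp_add[symmetric])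
qed

lemma near_inverse:
  assumes "near c x"
  shows "near c (inverse x)"
proof -
  have "inverse (exp c) \<le> inverse x" "inverse x \<le> inverse (exp (- c))"
    using assms near_pos[OF assms] by (auto simp: near_def intro!: le_imp_inverse_le)
  then show ?thesis by (simp add: near_def exp_minus)
qed

lemma near_divide: "near c x \<Longrightarrow> near d y \<Longrightarrow> near (c + d) (x / y)"
  unfolding divide_inverse by (intro near_mult near_inverse)

lemma near_power2: "near c x \<Longrightarrow> near (c + c) (x\<^sup>2)"
  unfolding power2_eq_square by (rule near_mult)

lemma near_mono: "near c x \<Longrightarrow> c \<le> d \<Longrightarrow> near d x"
  unfolding near_def by (meson exp_le_cancel_iff neg_le_iff_le order_trans)

lemma compar_cong: "compar c e x \<Longrightarrow> c = c' \<Longrightarrow> e = e' \<Longrightarrow> compar c' e' x"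
  by simp

lemma compar_mult: "compar c e x \<Longrightarrow> compar c' e' y \<Longrightarrow> compar (c + c') (e + e') (x * y)"
  unfolding compar_def qpow_add using near_mult by fastforce

lemma compar_divide: "compar c e x \<Longrightarrow> compar c' e' y \<Longrightarrow> compar (c + c') (e - e') (x / y)"
  unfolding compar_def using near_divide[of c "x / q powi e" c' "y / q powi e'"]
  by (simp add: power_int_diff mult_ac)

lemma compar_power2: "compar c e x \<Longrightarrow> compar (c + c) (e + e) (x\<^sup>2)"
  unfolding power2_eq_square by (rule compar_mult)

lemma compar_qpow: "compar 0 e (q powi e)"
  by (simp add: compar_def near_def)

lemma compar_1: "compar 0 0 1"
  using compar_qpow[of 0] by simp

lemma comparD:
  assumes "compar c e x"
  shows "0 < x" "x \<le> exp c * q powi e" "exp (- c) * q powi e \<le> x"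
proof -
  have "0 < x / q powi e" using assms near_pos unfolding compar_def by blast
  then show "0 < x" by (simp add: zero_less_divide_iff) (use qpow_pos[of e] in linarith)
  show "x \<le> exp c * q powi e" "exp (- c) * q powi e \<le> x"
    using assms qpow_pos[of e] by (simp_all add: compar_def near_def field_simps)
qed

definition Lam :: real where "Lam = ln (1 + b + 1 / b) - ln (1 - q)"

lemma Lam_nonneg: "0 \<le> Lam"
proof -
  have "0 \<le> ln (1 + b + 1 / b)" using b by (intro ln_ge_zero) simp
  moreover have "ln (1 - q) \<le> 0" using q by simp
  ultimately show ?thesis by (simp add: Lam_def)
qed

lemma compar_bet: "compar Lam (neg_part a) (bet a)"
proof -
  define B where "B = 1 + b + 1 / b"
  have B: "1 \<le> B" "1 + b \<le> B" "1 / B \<le> b" "1 / B \<le> 1"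
    using b by (auto simp: B_def field_simps add_pos_pos)
  have L: "ln B \<le> Lam" using q by (simp add: Lam_def B_def ln_le_zero_iff)
  have n: "1 / B \<le> bet a / q powi (neg_part a) \<and> bet a / q powi (neg_part a) \<le> B"
  proof (cases "0 \<le> a")
    case True
    have "q powi a \<le> 1" using qpow_le[of 0 a] True by simp
    then have "b * q powi a \<le> b" using b by (simp add: mult_left_le)
    moreover have "0 < b * q powi a" using b by simp
    ultimately have "1 \<le> bet a" "bet a \<le> 1 + b" by (auto simp: bet_def)
    then have "1 / B \<le> bet a \<and> bet a \<le> B" using B by linarith
    then show ?thesis using True by (simp add: neg_part_def min_def)
  next
    case False
    have e: "bet a / q powi (neg_part a) = q powi (- a) + b"
      using False by (simp add: bet_def neg_part_def min_def power_int_minus field_simps)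
    have "q powi (- a) \<le> 1" using qpow_le[of 0 "- a"] False by simp
    moreover have "0 < q powi (- a)" by simp
    ultimately show ?thesis unfolding e using B by linarith
  qed
  have "near (ln B) (bet a / q powi (neg_part a))"
    using n B by (simp add: near_def exp_minus inverse_eq_divide)
  then show ?thesis unfolding compar_def using L by (rule near_mono)
qed

lemma compar_gam: "0 < a \<Longrightarrow> compar Lam 0 (gam a)"
proof -
  assume a: "0 < a"
  have "0 \<le> ln (1 + b + 1 / b)" using b by (intro ln_ge_zero) simp
  then have L: "- ln (1 - q) \<le> Lam" by (simp add: Lam_def)
  have "q powi a \<le> q" using qpow_le[of 1 a] a by simp
  then have "1 - q \<le> gam a" "gam a \<le> 1"
    unfolding gam_def using qpow_pos[of a] by linarith+
  moreover have "1 \<le> exp Lam" using Lam_nonneg by simp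
  moreover have "exp (- Lam) \<le> 1 - q"
  proof -
    have "exp (- Lam) \<le> exp (ln (1 - q))" using L by simp
    then show ?thesis using q by simp
  qed
  ultimately have "exp (- Lam) \<le> gam a" "gam a \<le> exp Lam" by linarith+
  then show ?thesis by (simp add: compar_def near_def)
qed

lemma qpow_sum_le:
  assumes "finite A" "\<And>a. a \<in> A \<Longrightarrow> 1 \<le> a"
  shows "(\<Sum>a\<in>A. q powi a) \<le> 1 / (1 - q)"
proof -
  have inj: "inj_on nat A" using assms(2) by (intro inj_onI) force
  have "(\<Sum>a\<in>A. q powi a) = (\<Sum>a\<in>A. q ^ nat a)"
    using assms(2) by (intro sum.cong refl) (metis int_nat_eq order_trans power_int_of_nat zero_le_one)
  also have "\<dots> = (\<Sum>k\<in>nat ` A. q ^ k)" by (simp add: sum.reindex[OF inj])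
  also have "\<dots> \<le> (\<Sum>k. q ^ k)"
    using q assms(1) by (intro sum_le_suminf summable_geometric) auto
  also have "\<dots> = 1 / (1 - q)" using q by (simp add: suminf_geometric)
  finally show ?thesis .
qed

end

context qracah
begin

lemma mu_diff_gam: "mu t x - mu t y = q powi (- x) * gam (x - y) * bet (x + y + 1 - S - t)"
  unfolding mu_diff qpow_minus_gam by simp

definition node_poly :: "int \<Rightarrow> int \<Rightarrow> nat \<Rightarrow> int \<Rightarrow> real" where
  "node_poly t l n y = (\<Prod>c\<in>{l..<l + int n}. mu t y - mu t c)"

text \<open>The factors telescope; stated without division, the identity also holds at the nodes.\<close>

lemma node_poly_step:
  "node_poly t l n (y + 1) * (gam (y - l - int n + 1) * bet (y + 1 + l - S - t) * q ^ n) =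
   node_poly t l n y * (gam (y + 1 - l) * bet (y + 1 + l + int n - S - t))"
proof (induction n)
  case 0
  then show ?case by (simp add: node_poly_def algebra_simps)
next
  case (Suc n)
  let ?m = "l + int n"
  have Suc': "node_poly t l (Suc n) x = node_poly t l n x * (mu t x - mu t ?m)" for x
  proof -
    have "{l..<l + int (Suc n)} = insert ?m {l..<?m}" by auto
    then show ?thesis by (simp add: node_poly_def mult.commute)
  qed
  have "q powi (- (y + 1)) * q = q powi (- y)" by (simp add: power_int_add power_int_diff power_int_minus)
  then have d: "(mu t (y + 1) - mu t ?m) * q = q powi (- y) * gam (y - l - int n + 1) * bet (y + 2 + l + int n - S - t)"
    unfolding mu_diff_gam by (simp add: algebra_simps)
  have "node_poly t l (Suc n) (y + 1) * (gam (y - l - int (Suc n) + 1) * bet (y + 1 + l - S - t) * q ^ Suc n) =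
    (node_poly t l n (y + 1) * (gam (y - l - int n + 1) * bet (y + 1 + l - S - t) * q ^ n)) *
    (q powi (- y) * bet (y + 2 + l + int n - S - t) * gam (y - l - int n))"
  proof -
    have e: "y - l - int (Suc n) + 1 = y - l - int n" by simp
    have "node_poly t l (Suc n) (y + 1) * (gam (y - l - int (Suc n) + 1) * bet (y + 1 + l - S - t) * q ^ Suc n) =
      node_poly t l n (y + 1) * (bet (y + 1 + l - S - t) * q ^ n) * gam (y - l - int n) * ((mu t (y + 1) - mu t ?m) * q)"
      unfolding Suc' e by (simp add: mult_ac)
    then show ?thesis unfolding d by (simp add: mult_ac)
  qed
  also have "\<dots> = node_poly t l (Suc n) y * (gam (y + 1 - l) * bet (y + 1 + l + int (Suc n) - S - t))"
    unfolding Suc.IH Suc' mu_diff_gam by (simp add: algebra_simps)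
  finally show ?case .
qed

lemma node_poly_nonzero: "y < l \<or> l + int n \<le> y \<Longrightarrow> node_poly t l n y \<noteq> 0"
  unfolding node_poly_def mu_diff_gam by auto

lemma node_poly_ratio_above:
  assumes "l + int n \<le> y"
  shows "node_poly t l n (y + 1) / node_poly t l n y =
    gam (y + 1 - l) * bet (y + 1 + l + int n - S - t) /
    (gam (y - l - int n + 1) * bet (y + 1 + l - S - t) * q powi (int n))"
proof -
  have "gam (y - l - int n + 1) \<noteq> 0" using assms by simp
  then show ?thesis
    using node_poly_step[of t l n y] node_poly_nonzero[of y l n t] assms
    by (simp add: frac_eq_eq mult_ac)
qed

lemma node_poly_ratio_below:
  assumes "y + 1 < l"
  shows "node_poly t l n (y + 1) / node_poly t l n y =
    gam (l - y - 1) * bet (y + 1 + l + int n - S - t) / (gam (l + int n - y - 1) * bet (y + 1 + l - S - t))"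
proof -
  have neg: "gam (- a) = - (q powi (- a)) * gam a" for a
    by (simp add: gam_def power_int_minus field_simps)
  define a c where "a = q powi (y - l - int n + 1)" and "c = q powi (y + 1 - l)"
  define A C where "A = gam (l + int n - y - 1) * bet (y + 1 + l - S - t)"
    and "C = gam (l - y - 1) * bet (y + 1 + l + int n - S - t)"
  have gc: "gam (y + 1 - l) = - c * gam (l - y - 1)"
    using neg[of "l - y - 1"] by (simp add: c_def algebra_simps)
  have ga: "gam (y - l - int n + 1) = - a * gam (l + int n - y - 1)"
    using neg[of "l + int n - y - 1"] by (simp add: a_def algebra_simps)
  have ac: "a * q ^ n = c"
    unfolding a_def c_def power_int_of_nat[symmetric] qpow_add[symmetric] by (simp add: algebra_simps)
  have "(a * q ^ n) * (node_poly t l n (y + 1) * A) = c * (node_poly t l n y * C)"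
    using node_poly_step[of t l n y] unfolding gc ga A_def C_def by (simp add: mult_ac)
  then have "c * (node_poly t l n (y + 1) * A) = c * (node_poly t l n y * C)" unfolding ac .
  then have "node_poly t l n (y + 1) * A = node_poly t l n y * C" by (simp add: c_def)
  moreover have "gam (l + int n - y - 1) \<noteq> 0" using assms by simp
  ultimately show ?thesis
    using node_poly_nonzero[of y l n t] assms by (simp add: A_def C_def frac_eq_eq mult_ac)
qed

definition ratio_exponent :: "int \<Rightarrow> int \<Rightarrow> int" where
  "ratio_exponent t x = S + t - T - 2 * x - 1 + neg_part (N + x + 1 - S) + neg_part (N + x + 1 - t) +
     neg_part (2 * x + 1 - S - t) - neg_part (x + 1 - T) - neg_part (x + 1 - S - t) - neg_part (2 * x + 3 - S - t)"

lemma compar_ratio: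
  assumes "lo t \<le> x" "x < hi t"
  shows "compar (10 * Lam) (ratio_exponent t x) (ratio t x)"
proof -
  have "compar (0 + (Lam + Lam + Lam + Lam + Lam) + (Lam + Lam + Lam + Lam + Lam))
    ((S + t - T - 2 * x - 1) + (neg_part (N + x + 1 - S) + neg_part (N + x + 1 - t) + 0 + 0 + neg_part (2 * x + 1 - S - t)) -
     (neg_part (x + 1 - T) + neg_part (x + 1 - S - t) + 0 + 0 + neg_part (2 * x + 3 - S - t))) (ratio t x)"
    unfolding weight_ratio_alt
    by (intro compar_mult compar_divide compar_qpow compar_bet compar_gam)
       (use assms in \<open>auto simp: lo_def hi_def\<close>)
  then show ?thesis by (rule compar_cong) (simp_all add: ratio_exponent_def algebra_simps)
qed

end

locale qracah_slice = qracah +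
  fixes t l :: int
  assumes t: "0 \<le> t" "t \<le> T" and l: "lo t \<le> l" "l + N - 1 \<le> hi t"
begin

definition J :: "int set" where "J = {l..l + N - 1}"

abbreviation r :: int where "r \<equiv> l + N - 1"

lemma J_subset: "J \<subseteq> slice N T S t"
  using l by (auto simp: J_def slice_alt)

lemma card_J: "card J = nat N"
  using N by (simp add: J_def)

sublocale int_ope "slice N T S t" "w t" "mu t" J
proof unfold_locales
  show "finite (slice N T S t)" by (simp add: slice_def)
  show "0 < w t x" if "x \<in> slice N T S t" for x using that by (rule w_pos)
  show "inj_on (mu t) (slice N T S t)" by (rule mu_inj)
  show "J \<subseteq> slice N T S t" by (rule J_subset)
  show "J \<noteq> {}" using N by (simp add: J_def)
qed

abbreviation R :: "int \<Rightarrow> int \<Rightarrow> real" where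
  "R z y \<equiv> exchange_ratio (w t) (mu t) J z y"

definition psi :: "int \<Rightarrow> real" where
  "psi z = w t z * (\<Prod>c\<in>J - {z}. mu t z - mu t c)\<^sup>2"

definition psi_exponent :: "int \<Rightarrow> int" where
  "psi_exponent z = - ratio_exponent t z - 2 * (z - l) + 2 * neg_part (z + 2 + r - S - t) -
     2 * neg_part (z + 1 + l - S - t) + 2 * neg_part (2 * z + 1 - S - t) - 2 * neg_part (2 * z + 3 - S - t)"

lemma w_pos': "lo t \<le> x \<Longrightarrow> x \<le> hi t \<Longrightarrow> 0 < w t x"
  by (rule w_pos) (simp add: slice_alt)

lemma psi_pos:
  assumes "z \<in> J"
  shows "0 < psi z"
proof -
  have "(\<Prod>c\<in>J - {z}. mu t z - mu t c) \<noteq> 0"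
    using mu_inj[of t UNIV] by (auto simp: J_def inj_on_def)
  then show ?thesis using assms w_pos J_subset unfolding psi_def by (intro mult_pos_pos) auto
qed

lemma psi_ratio:
  assumes z: "l \<le> z" "z < r"
  shows "psi (z + 1) / psi z = 1 / ratio t z * (gam (z + 1 - l) * bet (2 * z + 1 - S - t) * bet (z + 2 + r - S - t) /
    (gam (r - z) * bet (z + 1 + l - S - t) * bet (2 * z + 3 - S - t) * q powi (z - l)))\<^sup>2"
proof -
  define m where "m = nat (z - l)"
  define k where "k = nat (r - z - 1)"
  define A where "A = node_poly t l m"
  define B where "B = node_poly t (z + 2) k"
  have split: "J - {z} = {l..<l + int m} \<union> {z + 2..<z + 2 + int k} \<union> {z + 1}"
    "J - {z + 1} = {l..<l + int m} \<union> {z + 2..<z + 2 + int k} \<union> {z}"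
    using z by (auto simp: J_def m_def k_def)
  have union: "(\<Prod>c\<in>{l..<l + int m} \<union> {z + 2..<z + 2 + int k} \<union> {x}. f c) =
      (\<Prod>c\<in>{l..<l + int m}. f c) * (\<Prod>c\<in>{z + 2..<z + 2 + int k}. f c) * f x"
    if "x = z \<or> x = z + 1" for f :: "int \<Rightarrow> real" and x
  proof -
    have "{l..<l + int m} \<inter> {z + 2..<z + 2 + int k} = {}" "x \<notin> {l..<l + int m} \<union> {z + 2..<z + 2 + int k}"
      using z that by (auto simp: m_def)
    then show ?thesis by (simp add: prod.union_disjoint)
  qed
  have P: "(\<Prod>c\<in>J - {z}. mu t z - mu t c) = A z * B z * (mu t z - mu t (z + 1))"
    "(\<Prod>c\<in>J - {z + 1}. mu t (z + 1) - mu t c) = A (z + 1) * B (z + 1) * (mu t (z + 1) - mu t z)"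
    unfolding split A_def B_def node_poly_def by (rule union; simp)+
  have sq: "(mu t (z + 1) - mu t z)\<^sup>2 = (mu t z - mu t (z + 1))\<^sup>2" by (simp add: power2_commute)
  have mu0: "mu t z - mu t (z + 1) \<noteq> 0" using mu_strict_mono[of z "z + 1" t] by simp
  have A: "A (z + 1) / A z = gam (z + 1 - l) * bet (2 * z + 1 - S - t) /
      (gam 1 * bet (z + 1 + l - S - t) * q powi (z - l))"
    using node_poly_ratio_above[of l m z t] z by (simp add: A_def m_def algebra_simps)
  have B: "B (z + 1) / B z = gam 1 * bet (z + 2 + r - S - t) / (gam (r - z) * bet (2 * z + 3 - S - t))"
    using node_poly_ratio_below[of z "z + 2" t k] z by (simp add: B_def k_def algebra_simps)
  have "psi (z + 1) / psi z = (w t (z + 1) / w t z) * (A (z + 1) / A z * (B (z + 1) / B z))\<^sup>2"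
    unfolding psi_def P using mu0 by (simp add: power_mult_distrib power_divide sq)
  also have "w t (z + 1) / w t z = 1 / ratio t z"
    using z l w_Suc[of t z] w_pos'[of z] by simp
  also have "A (z + 1) / A z * (B (z + 1) / B z) =
    gam (z + 1 - l) * bet (2 * z + 1 - S - t) * bet (z + 2 + r - S - t) /
    (gam (r - z) * bet (z + 1 + l - S - t) * bet (2 * z + 3 - S - t) * q powi (z - l))"
    unfolding A B by (simp add: mult_ac)
  finally show ?thesis .
qed

lemma compar_psi_ratio:
  assumes z: "l \<le> z" "z < r"
  shows "compar (22 * Lam) (psi_exponent z) (psi (z + 1) / psi z)"
proof -
  have "compar (0 + 10 * Lam + (((Lam + Lam + Lam) + (Lam + Lam + Lam + 0)) + ((Lam + Lam + Lam) + (Lam + Lam + Lam + 0))))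
    ((0 - ratio_exponent t z) +
     ((0 + neg_part (2 * z + 1 - S - t) + neg_part (z + 2 + r - S - t) -
      (0 + neg_part (z + 1 + l - S - t) + neg_part (2 * z + 3 - S - t) + (z - l))) +
      (0 + neg_part (2 * z + 1 - S - t) + neg_part (z + 2 + r - S - t) -
      (0 + neg_part (z + 1 + l - S - t) + neg_part (2 * z + 3 - S - t) + (z - l))))) (psi (z + 1) / psi z)"
    unfolding psi_ratio[OF z]
    by (intro compar_mult compar_divide compar_power2 compar_qpow compar_1 compar_bet compar_gam compar_ratio;
        use z l in linarith)
  then show ?thesis
    by (rule compar_cong) (simp_all add: psi_exponent_def algebra_simps)
qed

lemma R_below_psi:
  assumes z: "z \<in> J" and y: "y \<in> slice N T S t - J" and v: "v \<in> J"
    and closer: "\<bar>mu t y - mu t v\<bar> \<le> \<bar>mu t y - mu t z\<bar>"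
  shows "R z y \<le> R v y * (psi v / psi z)"
proof -
  define G where "G = w t y * (\<Prod>c\<in>J. mu t y - mu t c)\<^sup>2"
  have fin: "finite J" by (simp add: J_def)
  have ne: "mu t y - mu t c \<noteq> 0" if "c \<in> J" for c
    using y that mu_inj[of t UNIV] by (auto simp: inj_on_def)
  have R: "R c y = G / ((mu t y - mu t c)\<^sup>2 * psi c)" if "c \<in> J" for c
  proof -
    have "(\<Prod>c\<in>J. mu t y - mu t c) = (mu t y - mu t c) * (\<Prod>d\<in>J - {c}. mu t y - mu t d)"
      by (rule prod.remove[OF fin that])
    then show ?thesis
      unfolding exchange_ratio_def lagrange_def G_def psi_def using ne[OF that]
      by (simp add: prod_dividef power_mult_distrib power_divide)
  qed
  have G: "0 \<le> G" using w_pos[of y] y by (simp add: G_def)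
  have sq: "(mu t y - mu t v)\<^sup>2 \<le> (mu t y - mu t z)\<^sup>2"
    using closer by (simp add: abs_le_square_iff)
  have "R z y \<le> G / ((mu t y - mu t v)\<^sup>2 * psi z)"
    unfolding R[OF z] using sq psi_pos[OF z] ne[OF v] ne[OF z] G
    by (intro divide_left_mono mult_right_mono mult_pos_pos) auto
  also have "\<dots> = R v y * (psi v / psi z)"
    unfolding R[OF v] using psi_pos[OF v] by simp
  finally show ?thesis .
qed

definition up_exponent :: "int \<Rightarrow> int" where
  "up_exponent y = - ratio_exponent t y - 2 * (N - 1) + 2 * neg_part (y + l + N - S - t) - 2 * neg_part (y + 1 + l - S - t)"

definition down_exponent :: "int \<Rightarrow> int" where
  "down_exponent y = ratio_exponent t y + 2 * neg_part (y + 2 + l - S - t) - 2 * neg_part (y + 1 + l + N - S - t)"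

lemma node_poly_alt:
  "finite J" "(\<Prod>c\<in>J - {r}. mu t y - mu t c) = node_poly t l (nat (N - 1)) y"
  "(\<Prod>c\<in>J - {l}. mu t y - mu t c) = node_poly t (l + 1) (nat (N - 1)) y"
proof -
  have "J - {r} = {l..<l + int (nat (N - 1))}" "J - {l} = {l + 1..<l + 1 + int (nat (N - 1))}"
    using N by (auto simp: J_def)
  then show "(\<Prod>c\<in>J - {r}. mu t y - mu t c) = node_poly t l (nat (N - 1)) y"
    "(\<Prod>c\<in>J - {l}. mu t y - mu t c) = node_poly t (l + 1) (nat (N - 1)) y"
    by (simp_all only: node_poly_def)
qed (simp add: J_def)

lemma R_end:
  "R r y = w t y / w t r * (node_poly t l (nat (N - 1)) y / node_poly t l (nat (N - 1)) r)\<^sup>2"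
  "R l y = w t y / w t l * (node_poly t (l + 1) (nat (N - 1)) y / node_poly t (l + 1) (nat (N - 1)) l)\<^sup>2"
  unfolding exchange_ratio_def lagrange_def prod_dividef node_poly_alt by (rule refl)+

lemma compar_R_up:
  assumes y: "r \<le> y" "y < hi t"
  shows "compar (18 * Lam) (up_exponent y) (R r (y + 1) / R r y)"
proof -
  define D where "D = node_poly t l (nat (N - 1))"
  have pos: "0 < w t y" "0 < w t r" using y l N by (auto intro!: w_pos')
  have D0: "D r \<noteq> 0" "D y \<noteq> 0"
    unfolding D_def using y N by (intro node_poly_nonzero; simp)+
  have "R r (y + 1) / R r y = (w t (y + 1) / w t y) * (D (y + 1) / D y)\<^sup>2"
    unfolding R_end D_def[symmetric] using pos D0 by (simp add: power_divide)
  also have "w t (y + 1) / w t y = 1 / ratio t y"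
    using y l N w_Suc[of t y] pos by simp
  also have "D (y + 1) / D y = gam (y + 1 - l) * bet (y + l + N - S - t) /
      (gam (y + 2 - l - N) * bet (y + 1 + l - S - t) * q powi (N - 1))"
    using node_poly_ratio_above[of l "nat (N - 1)" y t] y N by (simp add: D_def algebra_simps)
  finally have e: "R r (y + 1) / R r y = 1 / ratio t y * (gam (y + 1 - l) * bet (y + l + N - S - t) /
      (gam (y + 2 - l - N) * bet (y + 1 + l - S - t) * q powi (N - 1)))\<^sup>2" .
  have "compar (0 + 10 * Lam + (((Lam + Lam) + (Lam + Lam + 0)) + ((Lam + Lam) + (Lam + Lam + 0))))
    ((0 - ratio_exponent t y) +
     ((0 + neg_part (y + l + N - S - t) - (0 + neg_part (y + 1 + l - S - t) + (N - 1))) +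
      (0 + neg_part (y + l + N - S - t) - (0 + neg_part (y + 1 + l - S - t) + (N - 1))))) (R r (y + 1) / R r y)"
    unfolding e
    by (intro compar_mult compar_divide compar_power2 compar_qpow compar_1 compar_bet compar_gam compar_ratio;
        use y l N in linarith)
  then show ?thesis
    by (rule compar_cong) (simp_all add: up_exponent_def algebra_simps)
qed

lemma compar_R_down:
  assumes y: "lo t \<le> y" "y < l"
  shows "compar (18 * Lam) (down_exponent y) (R l y / R l (y + 1))"
proof -
  define D where "D = node_poly t (l + 1) (nat (N - 1))"
  have pos: "0 < w t y" "0 < w t l" "0 < w t (y + 1)" using y l N by (auto intro!: w_pos')
  have D0: "D l \<noteq> 0" "D y \<noteq> 0" "D (y + 1) \<noteq> 0"
    unfolding D_def using y N by (intro node_poly_nonzero; simp)+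
  have "R l y / R l (y + 1) = (w t y / w t (y + 1)) / (D (y + 1) / D y)\<^sup>2"
    unfolding R_end D_def[symmetric] using pos D0 by (simp add: power_divide)
  also have "w t y / w t (y + 1) = ratio t y"
    using y l N w_Suc[of t y] pos by simp
  also have "D (y + 1) / D y = gam (l - y) * bet (y + 1 + l + N - S - t) / (gam (l + N - 1 - y) * bet (y + 2 + l - S - t))"
    using node_poly_ratio_below[of y "l + 1" t "nat (N - 1)"] y N by (simp add: D_def algebra_simps)
  finally have e: "R l y / R l (y + 1) = ratio t y / (gam (l - y) * bet (y + 1 + l + N - S - t) /
      (gam (l + N - 1 - y) * bet (y + 2 + l - S - t)))\<^sup>2" .
  have "compar (10 * Lam + (((Lam + Lam) + (Lam + Lam)) + ((Lam + Lam) + (Lam + Lam))))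
    (ratio_exponent t y -
     ((0 + neg_part (y + 1 + l + N - S - t) - (0 + neg_part (y + 2 + l - S - t))) +
      (0 + neg_part (y + 1 + l + N - S - t) - (0 + neg_part (y + 2 + l - S - t))))) (R l y / R l (y + 1))"
    unfolding e
    by (intro compar_mult compar_divide compar_power2 compar_qpow compar_bet compar_gam compar_ratio;
        use y l N in linarith)
  then show ?thesis
    by (rule compar_cong) (simp_all add: down_exponent_def algebra_simps)
qed

end

context qracah_slice
begin

lemma ranges: "0 \<le> l" "t + S - T \<le> l" "l \<le> t" "l \<le> S" "0 \<le> t" "t \<le> T" "0 \<le> S" "S \<le> T" "1 \<le> N"
  using l t S N by (auto simp: lo_def hi_def)

lemma up_exponent_ge:
  assumes "N \<le> T" "S + t - N - 1 \<le> 2 * l" "r \<le> y" "y < hi t"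
  shows "2 * (y - r) \<le> up_exponent y"
proof -
  have "y < t + N - 1" "y < S + N - 1" using assms(4) by (auto simp: hi_def)
  then show ?thesis
    using assms ranges unfolding neg_part_def up_exponent_def ratio_exponent_def
    by (smt (verit))
qed

lemma down_exponent_ge:
  assumes "N \<le> T" "2 * l \<le> S + t - N" "lo t \<le> y" "y < l"
  shows "2 * (l - 1 - y) \<le> down_exponent y"
proof -
  have "0 \<le> y" "t + S - T \<le> y" using assms(3) by (auto simp: lo_def)
  then show ?thesis
    using assms ranges unfolding neg_part_def down_exponent_def ratio_exponent_def
    by (smt (verit))
qed

lemma psi_exponent_ge:
  assumes "N \<le> T" "S + t - N - 1 \<le> 2 * l" "l \<le> z" "z < r"
  shows "- 1 \<le> psi_exponent z"
proof -
  show ?thesis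
    using assms ranges unfolding neg_part_def psi_exponent_def ratio_exponent_def
    by (smt (verit))
qed

lemma psi_exponent_le:
  assumes "N \<le> T" "2 * l \<le> S + t - N" "l \<le> z" "z < r"
  shows "psi_exponent z \<le> 1"
proof -
  show ?thesis
    using assms ranges unfolding neg_part_def psi_exponent_def ratio_exponent_def
    by (smt (verit))
qed

end

context q_parameters
begin

lemma qpow_nonneg [simp]: "0 \<le> q powi a"
  using qpow_pos[of a] by (rule less_imp_le)

lemma ln_q: "ln q < 0"
  using q by simp

definition step_const :: real where "step_const = 22 * Lam - ln q"

lemma step_const_nonneg: "0 \<le> step_const"
  using Lam_nonneg ln_q by (simp add: step_const_def)

lemma qpow_exp: "q powi e = exp (of_int e * ln q)"
  using q powr_real_of_int'[of q e] by (simp add: powr_def)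

lemma step_bound:
  assumes "compar c e x" "c \<le> 22 * Lam" "- 1 \<le> e"
  shows "x \<le> exp step_const"
proof -
  have "x \<le> exp c * q powi e" by (rule comparD(2)[OF assms(1)])
  also have "\<dots> \<le> exp (22 * Lam) * q powi (- 1)"
    using assms(2) qpow_le[OF assms(3)] by (intro mult_mono) auto
  also have "\<dots> = exp step_const" using q by (simp add: step_const_def exp_diff divide_inverse)
  finally show ?thesis .
qed

lemma step_bound':
  assumes "compar c e x" "c \<le> 22 * Lam" "k \<le> e"
  shows "x \<le> exp step_const * q powi k"
proof -
  have "x \<le> exp c * q powi e" by (rule comparD(2)[OF assms(1)])
  also have "\<dots> \<le> exp step_const * q powi k"
    using assms(2) qpow_le[OF assms(3)] ln_q
    by (intro mult_mono) (auto simp: step_const_def)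
  finally show ?thesis .
qed

lemma qpow_quadratic_bounded:
  "\<exists>M. \<forall>d\<ge>0. exp (step_const * of_int d) * q powi (d * (d - 1)) \<le> M"
proof -
  obtain n :: nat where n: "step_const / (- ln q) < real n"
    using reals_Archimedean2 by blast
  show ?thesis
  proof (intro exI allI impI)
    fix d :: int assume d: "0 \<le> d"
    show "exp (step_const * of_int d) * q powi (d * (d - 1)) \<le> exp (step_const * (of_nat n + 1))"
    proof (cases "d \<le> int n + 1")
      case True
      have "q powi (d * (d - 1)) \<le> 1"
      proof -
        have "0 \<le> d * (d - 1)" using d by (cases "d = 0") auto
        then show ?thesis using qpow_le[of 0 "d * (d - 1)"] by simp
      qed
      moreover have "real_of_int d \<le> of_nat n + 1" using True by linarith
      then have "step_const * of_int d \<le> step_const * (of_nat n + 1)"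
        by (intro mult_left_mono step_const_nonneg)
      ultimately have "exp (step_const * of_int d) * q powi (d * (d - 1)) \<le> exp (step_const * (of_nat n + 1)) * 1"
        by (intro mult_mono) auto
      then show ?thesis by simp
    next
      case False
      then have "real n \<le> of_int (d - 1)" by linarith
      then have "real n * (- ln q) \<le> of_int (d - 1) * (- ln q)"
        using ln_q by (intro mult_right_mono) auto
      moreover have "step_const < real n * (- ln q)"
        using n ln_q pos_divide_less_eq[of "- ln q" step_const "real n"] by simp
      ultimately have "step_const < of_int (d - 1) * (- ln q)" by linarith
      then have "step_const + of_int (d - 1) * ln q \<le> 0" by simp
      then have "of_int d * (step_const + of_int (d - 1) * ln q) \<le> 0"
        using d by (simp add: mult_nonneg_nonpos)
      then have "exp (of_int d * (step_const + of_int (d - 1) * ln q)) \<le> 1" by simp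
      moreover have "exp (step_const * of_int d) * q powi (d * (d - 1)) =
          exp (of_int d * (step_const + of_int (d - 1) * ln q))"
        unfolding qpow_exp exp_add[symmetric] by (simp add: algebra_simps)
      moreover have "1 \<le> exp (step_const * (of_nat n + 1))" using step_const_nonneg by simp
      ultimately show ?thesis by linarith
    qed
  qed
qed

end

context qracah_slice
begin

lemma R_same: "v \<in> J \<Longrightarrow> R v v = 1"
  unfolding exchange_ratio_def using lagrange_same[OF inj_J, of v] w_pos[of v] J_subset by auto

lemma R_pos_end: "r \<le> y \<Longrightarrow> y \<le> hi t \<Longrightarrow> 0 < R r y" "lo t \<le> y \<Longrightarrow> y \<le> l \<Longrightarrow> 0 < R l y"
  unfolding R_end using w_pos' l N by (auto intro!: mult_pos_pos divide_pos_pos simp: node_poly_nonzero)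

lemma R_up_bound:
  assumes "N \<le> T" "S + t - N - 1 \<le> 2 * l" "r \<le> y"
  shows "y \<le> hi t \<longrightarrow> R r y \<le> exp (step_const * of_int (y - r)) * q powi ((y - r) * (y - r - 1))"
  using assms(3)
proof (induction y rule: int_ge_induct)
  case base
  have "r \<in> J" using N by (simp add: J_def)
  then show ?case by (simp add: R_same)
next
  case (step y)
  show ?case
  proof
    assume y: "y + 1 \<le> hi t"
    have "R r (y + 1) / R r y \<le> exp step_const * q powi (2 * (y - r))"
      using compar_R_up[of y] up_exponent_ge[OF assms(1,2), of y] step(1) y Lam_nonneg
      by (intro step_bound'[of "18 * Lam" "up_exponent y"]) auto
    then have "R r (y + 1) \<le> exp step_const * q powi (2 * (y - r)) * R r y"
      using R_pos_end(1)[of y] step(1) y by (simp add: divide_le_eq)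
    also have "\<dots> \<le> exp step_const * q powi (2 * (y - r)) *
        (exp (step_const * of_int (y - r)) * q powi ((y - r) * (y - r - 1)))"
      using step y by (intro mult_left_mono) auto
    also have "\<dots> = exp (step_const * of_int (y + 1 - r)) * q powi ((y + 1 - r) * (y + 1 - r - 1))"
      unfolding qpow_exp exp_add[symmetric] by (simp add: algebra_simps)
    finally show "R r (y + 1) \<le> exp (step_const * of_int (y + 1 - r)) * q powi ((y + 1 - r) * (y + 1 - r - 1))" .
  qed
qed

lemma R_down_bound:
  assumes "N \<le> T" "2 * l \<le> S + t - N" "y \<le> l"
  shows "lo t \<le> y \<longrightarrow> R l y \<le> exp (step_const * of_int (l - y)) * q powi ((l - y) * (l - y - 1))"
  using assms(3)
proof (induction y rule: int_le_induct)
  case base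
  have "l \<in> J" using N by (simp add: J_def)
  then show ?case by (simp add: R_same)
next
  case (step y)
  show ?case
  proof
    assume y: "lo t \<le> y - 1"
    have "R l (y - 1) / R l (y - 1 + 1) \<le> exp step_const * q powi (2 * (l - 1 - (y - 1)))"
      using compar_R_down[of "y - 1"] down_exponent_ge[OF assms(1,2), of "y - 1"] step(1) y Lam_nonneg
      by (intro step_bound'[of "18 * Lam" "down_exponent (y - 1)"]) auto
    then have "R l (y - 1) \<le> exp step_const * q powi (2 * (l - y)) * R l y"
      using R_pos_end(2)[of y] step(1) y by (simp add: divide_le_eq)
    also have "\<dots> \<le> exp step_const * q powi (2 * (l - y)) *
        (exp (step_const * of_int (l - y)) * q powi ((l - y) * (l - y - 1)))"
      using step y by (intro mult_left_mono) auto
    also have "\<dots> = exp (step_const * of_int (l - (y - 1))) * q powi ((l - (y - 1)) * (l - (y - 1) - 1))"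
      unfolding qpow_exp exp_add[symmetric] by (simp add: algebra_simps)
    finally show "R l (y - 1) \<le> exp (step_const * of_int (l - (y - 1))) * q powi ((l - (y - 1)) * (l - (y - 1) - 1))" .
  qed
qed

lemma psi_up_bound:
  assumes "N \<le> T" "S + t - N - 1 \<le> 2 * l" "l \<le> z" "z \<le> v"
  shows "v \<le> r \<longrightarrow> psi v \<le> exp (step_const * of_int (v - z)) * psi z"
  using assms(4)
proof (induction v rule: int_ge_induct)
  case (step v)
  show ?case
  proof
    assume v: "v + 1 \<le> r"
    have "psi (v + 1) / psi v \<le> exp step_const"
      using compar_psi_ratio[of v] psi_exponent_ge[OF assms(1,2), of v] step(1) assms(3) v
      by (intro step_bound[of "22 * Lam" "psi_exponent v"]) auto
    moreover have "0 < psi v" using step(1) assms(3) v by (intro psi_pos) (auto simp: J_def)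
    ultimately have "psi (v + 1) \<le> exp step_const * psi v" by (simp add: divide_le_eq)
    also have "\<dots> \<le> exp step_const * (exp (step_const * of_int (v - z)) * psi z)"
      using step v by (intro mult_left_mono) auto
    also have "\<dots> = exp (step_const * of_int (v + 1 - z)) * psi z"
      unfolding mult.assoc[symmetric] exp_add[symmetric] by (simp add: algebra_simps)
    finally show "psi (v + 1) \<le> exp (step_const * of_int (v + 1 - z)) * psi z" .
  qed
qed simp

lemma psi_down_bound:
  assumes "N \<le> T" "2 * l \<le> S + t - N" "z \<le> r" "v \<le> z"
  shows "l \<le> v \<longrightarrow> psi v \<le> exp (step_const * of_int (z - v)) * psi z"
  using assms(4)
proof (induction v rule: int_le_induct)
  case (step v)
  show ?case
  proof
    assume v: "l \<le> v - 1"
    have c: "compar (22 * Lam) (psi_exponent (v - 1)) (psi v / psi (v - 1))"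
      using compar_psi_ratio[of "v - 1"] step(1) assms(3) v by auto
    have "psi (v - 1) / psi v \<le> exp step_const"
      using compar_divide[OF compar_1 c] psi_exponent_le[OF assms(1,2), of "v - 1"] step(1) assms(3) v
      by (intro step_bound[of "22 * Lam" "- psi_exponent (v - 1)"]) auto
    moreover have "0 < psi v" using step(1) assms(3) v by (intro psi_pos) (auto simp: J_def)
    ultimately have "psi (v - 1) \<le> exp step_const * psi v" by (simp add: divide_le_eq)
    also have "\<dots> \<le> exp step_const * (exp (step_const * of_int (z - v)) * psi z)"
      using step v by (intro mult_left_mono) auto
    also have "\<dots> = exp (step_const * of_int (z - (v - 1))) * psi z"
      unfolding mult.assoc[symmetric] exp_add[symmetric] by (simp add: algebra_simps)
    finally show "psi (v - 1) \<le> exp (step_const * of_int (z - (v - 1))) * psi z" .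
  qed
qed simp

lemma R_above:
  assumes "N \<le> T" "S + t - N - 1 \<le> 2 * l" "z \<in> J" "r < y" "y \<le> hi t"
  shows "R z y \<le> exp (step_const * of_int (y - r)) * q powi ((y - r) * (y - r - 1)) * (psi r / psi z)"
proof -
  have r: "r \<in> J" using N by (simp add: J_def)
  have "mu t r < mu t y" using assms(4) by (rule mu_strict_mono)
  moreover have "mu t z \<le> mu t r"
    using assms(3) mu_strict_mono[of z r t] by (cases "z = r") (auto simp: J_def)
  ultimately have "R z y \<le> R r y * (psi r / psi z)"
    using assms l by (intro R_below_psi r) (auto simp: J_def slice_alt)
  also have "\<dots> \<le> exp (step_const * of_int (y - r)) * q powi ((y - r) * (y - r - 1)) * (psi r / psi z)"
    using R_up_bound[OF assms(1,2), of y] assms psi_pos[OF r] psi_pos[OF assms(3)]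
    by (intro mult_right_mono) auto
  finally show ?thesis .
qed

lemma R_below:
  assumes "N \<le> T" "2 * l \<le> S + t - N" "z \<in> J" "y < l" "lo t \<le> y"
  shows "R z y \<le> exp (step_const * of_int (l - y)) * q powi ((l - y) * (l - y - 1)) * (psi l / psi z)"
proof -
  have l': "l \<in> J" using N by (simp add: J_def)
  have "mu t y < mu t l" using assms(4) by (rule mu_strict_mono)
  moreover have "mu t l \<le> mu t z"
    using assms(3) mu_strict_mono[of l z t] by (cases "z = l") (auto simp: J_def)
  ultimately have "R z y \<le> R l y * (psi l / psi z)"
    using assms l N by (intro R_below_psi l') (auto simp: J_def slice_alt)
  also have "\<dots> \<le> exp (step_const * of_int (l - y)) * q powi ((l - y) * (l - y - 1)) * (psi l / psi z)"
    using R_down_bound[OF assms(1,2), of y] assms psi_pos[OF l'] psi_pos[OF assms(3)]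
    by (intro mult_right_mono) auto
  finally show ?thesis .
qed

lemma R_far_above:
  assumes "N \<le> T" "S + t - N - 1 \<le> 2 * l" "z \<in> J" "r < y" "y \<le> hi t"
  shows "R z y \<le> exp (step_const * of_int (y - r + N)) * q powi ((y - r) * (y - r - 1))"
proof -
  have "psi r / psi z \<le> exp (step_const * of_int (r - z))"
    using psi_up_bound[OF assms(1,2), of z r] assms(3) psi_pos[OF assms(3)]
    by (auto simp: J_def divide_le_eq)
  also have "\<dots> \<le> exp (step_const * of_int N)"
    using assms(3) step_const_nonneg by (auto simp: J_def intro!: mult_left_mono)
  finally have "R z y \<le> exp (step_const * of_int (y - r)) * q powi ((y - r) * (y - r - 1)) * exp (step_const * of_int N)"
    by (intro order.trans[OF R_above[OF assms]] mult_left_mono) auto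
  then show ?thesis by (simp only: of_int_add[of "y - r" N] distrib_left exp_add mult_ac)
qed

lemma R_far_below:
  assumes "N \<le> T" "2 * l \<le> S + t - N" "z \<in> J" "y < l" "lo t \<le> y"
  shows "R z y \<le> exp (step_const * of_int (l - y + N)) * q powi ((l - y) * (l - y - 1))"
proof -
  have "psi l / psi z \<le> exp (step_const * of_int (z - l))"
    using psi_down_bound[OF assms(1,2), of z l] assms(3) psi_pos[OF assms(3)]
    by (auto simp: J_def divide_le_eq)
  also have "\<dots> \<le> exp (step_const * of_int N)"
    using assms(3) step_const_nonneg by (auto simp: J_def intro!: mult_left_mono)
  finally have "R z y \<le> exp (step_const * of_int (l - y)) * q powi ((l - y) * (l - y - 1)) * exp (step_const * of_int N)"
    by (intro order.trans[OF R_below[OF assms]] mult_left_mono) auto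
  then show ?thesis by (simp only: of_int_add[of "l - y" N] distrib_left exp_add mult_ac)
qed

end

context q_parameters
begin

definition bet' :: "int \<Rightarrow> real" where "bet' a = 1 + q powi a / b"

lemma bet'_pos [simp]: "0 < bet' a" using b by (simp add: bet'_def add_pos_pos)

lemma bet'_nonzero [simp]: "bet' a \<noteq> 0" using bet'_pos[of a] by linarith

lemma bet_reflect: "bet a = b * q powi a * bet' (- a)"
  using b by (simp add: bet_def bet'_def power_int_minus field_simps)

definition near_const :: real where "near_const = 1 / (1 - q) + b / q + 1 / (b * q)"

lemma near_one_plus:
  assumes "0 \<le> x" "x \<le> c"
  shows "near c (1 + x)"
proof -
  have "1 + x \<le> exp x" by (rule exp_ge_add_one_self)
  also have "\<dots> \<le> exp c" using assms by simp
  finally have "1 + x \<le> exp c" .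
  moreover have "exp (- c) \<le> 1" using assms by simp
  ultimately show ?thesis using assms unfolding near_def by linarith
qed

lemma near_gam:
  assumes "0 < n" "q powi n \<le> D"
  shows "near (near_const * D) (gam n)"
proof -
  define x where "x = q powi n"
  have x: "0 < x" "x \<le> q" "x \<le> D"
    using qpow_le[of 1 n] assms by (simp_all add: x_def)
  have "x / (1 - x) \<le> x / (1 - q)" using x q by (intro divide_left_mono mult_pos_pos) auto
  also have "\<dots> \<le> 1 / (1 - q) * D" using x q by (simp add: divide_right_mono)
  also have "\<dots> \<le> near_const * D"
    using x q b by (intro mult_right_mono) (auto simp: near_const_def)
  finally have "near (near_const * D) (1 + x / (1 - x))" using x q by (intro near_one_plus) auto
  then have "near (near_const * D) (inverse (1 + x / (1 - x)))" by (rule near_inverse)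
  moreover have "inverse (1 + x / (1 - x)) = gam n" using x q by (simp add: gam_def x_def field_simps)
  ultimately show ?thesis by simp
qed

lemma near_bet:
  assumes "q powi (n + 1) \<le> D"
  shows "near (near_const * D) (bet n)" "near (near_const * D) (bet' n)"
proof -
  define x where "x = q powi n"
  have x: "0 < x" "x * q \<le> D" using assms by (simp_all add: x_def power_int_add)
  then have "x \<le> D / q" using q by (simp add: le_divide_eq)
  moreover have D: "0 < D" using x q by (smt (verit) mult_pos_pos)
  ultimately have "b * x \<le> b / q * D" "x / b \<le> 1 / (b * q) * D"
    using b q by (auto simp: field_simps)
  moreover have "b / q \<le> near_const" "1 / (b * q) \<le> near_const"
    using q b by (simp_all add: near_const_def)
  then have "b / q * D \<le> near_const * D" "1 / (b * q) * D \<le> near_const * D"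
    using D by (intro mult_right_mono; simp)+
  ultimately show "near (near_const * D) (bet n)" "near (near_const * D) (bet' n)"
    unfolding bet_def bet'_def x_def[symmetric] using x b by (intro near_one_plus; simp)+
qed

lemma near_refl: "0 \<le> c \<Longrightarrow> near c 1"
  by (simp add: near_def)

definition deep_const :: real where "deep_const = 16 * near_const * (1 / (1 - q) + 1 / (1 - q))"

lemma near_const_pos: "0 < near_const"
  unfolding near_const_def using q b by (intro add_pos_pos divide_pos_pos mult_pos_pos) auto

end

context qracah_slice
begin

definition end_decay :: "int \<Rightarrow> real" where "end_decay z = q powi (z + 1 - l) + q powi (r - z)"

definition psi' :: "int \<Rightarrow> real" where "psi' z = psi z * bet (2 * z + 1 - S - t)"

lemma end_decay_ge: "z + 1 - l \<le> n \<or> r - z \<le> n \<Longrightarrow> q powi n \<le> end_decay z"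
  using qpow_le[of "z + 1 - l" n] qpow_le[of "r - z" n] qpow_pos[of "z + 1 - l"] qpow_pos[of "r - z"]
  unfolding end_decay_def by (auto simp del: qpow_pos)

text \<open>The weight \<open>psi'\<close> decays exactly like \<open>q powi z\<close>, uniformly in all parameters, because the
  corrections to its step ratio are summable over \<open>z\<close>.\<close>

lemma near_psi'_step:
  assumes c: "S + t - N - 1 \<le> 2 * l" "2 * l \<le> S + t - N" "r \<le> T" "r \<le> S + t" "S - N \<le> l" "t - N \<le> l"
    and z: "l \<le> z" "z < r"
  shows "near (16 * near_const * end_decay z) (psi' (z + 1) / psi' z / q)"
proof -
  let ?K = "near_const * end_decay z"
  have hi: "r \<le> t + N - 1" "r \<le> S + N - 1" "0 \<le> l" "t + S - T \<le> l"
    using l by (auto simp: lo_def hi_def)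
  define E where "E = q powi (S + t - T - 2 * z - 1) * (b * q powi (z + 1 + l - S - t))\<^sup>2 * (q powi (z - l))\<^sup>2"
  define F where "F = b * q powi (z + 1 - T) * (b * q powi (z + 1 - S - t))"
  define \<theta> where "\<theta> = bet' (T - z - 1) * bet' (S + t - z - 1) / (bet (N + z + 1 - S) * bet (N + z + 1 - t)) *
      (gam (N + S - z - 1) * gam (N + t - z - 1) / (gam (z + 1) * gam (T + z + 1 - S - t))) *
      (gam (z + 1 - l) * bet (z + 2 + r - S - t) / (gam (r - z) * bet' (S + t - z - 1 - l)))\<^sup>2"
  have nz: "gam (z + 1) \<noteq> 0" "gam (T + z + 1 - S - t) \<noteq> 0" "gam (N + S - z - 1) \<noteq> 0" "gam (N + t - z - 1) \<noteq> 0"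
    "gam (r - z) \<noteq> 0" using z hi by auto
  have FE: "F = q * E"
  proof -
    have "q * E = b\<^sup>2 * q powi (1 + (S + t - T - 2 * z - 1) + ((z + 1 + l - S - t) + (z + 1 + l - S - t)) + ((z - l) + (z - l)))"
      unfolding E_def power2_eq_square qpow_add by simp
    also have "\<dots> = b\<^sup>2 * q powi ((z + 1 - T) + (z + 1 - S - t))" by (simp add: algebra_simps)
    also have "\<dots> = F" unfolding F_def qpow_add by (simp add: power2_eq_square)
    finally show ?thesis by simp
  qed
  have r1: "bet (z + 1 - T) * bet (z + 1 - S - t) = F * (bet' (T - z - 1) * bet' (S + t - z - 1))"
    unfolding bet_reflect[of "z + 1 - T"] bet_reflect[of "z + 1 - S - t"] F_def by (simp add: algebra_simps)
  have r2: "bet (z + 1 + l - S - t) = b * q powi (z + 1 + l - S - t) * bet' (S + t - z - 1 - l)"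
    unfolding bet_reflect[of "z + 1 + l - S - t"] by (simp add: algebra_simps)
  have "psi' (z + 1) / psi' z = psi (z + 1) / psi z * (bet (2 * z + 3 - S - t) / bet (2 * z + 1 - S - t))"
    by (simp add: psi'_def algebra_simps)
  also have "\<dots> = F / E * \<theta>"
  proof -
    define B1 B3 where "B1 = bet (2 * z + 1 - S - t)" and "B3 = bet (2 * z + 3 - S - t)"
    have B: "B1 \<noteq> 0" "B3 \<noteq> 0" by (simp_all add: B1_def B3_def)
    have "1 / ratio t z = (F * (bet' (T - z - 1) * bet' (S + t - z - 1))) * gam (N + S - z - 1) * gam (N + t - z - 1) * B3 /
      (q powi (S + t - T - 2 * z - 1) * (bet (N + z + 1 - S) * bet (N + z + 1 - t) * gam (z + 1) * gam (T + z + 1 - S - t) * B1))"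
      unfolding weight_ratio_alt B1_def[symmetric] B3_def[symmetric] r1[symmetric] by simp
    then show ?thesis
      unfolding psi_ratio[OF z] B1_def[symmetric] B3_def[symmetric] r2 \<theta>_def E_def
      using B by (simp add: power_mult_distrib power_divide) (simp add: divide_simps power2_eq_square)
  qed
  finally have eq: "psi' (z + 1) / psi' z / q = \<theta>" using b unfolding FE by (simp add: E_def)
  have "near ((?K + ?K + (?K + ?K)) + (?K + ?K + (?K + ?K)) + ((?K + ?K + (?K + ?K)) + (?K + ?K + (?K + ?K)))) \<theta>"
    unfolding \<theta>_def
    by (intro near_mult near_divide near_power2 near_gam near_bet end_decay_ge) (use c hi z in linarith)+
  moreover have "(?K + ?K + (?K + ?K)) + (?K + ?K + (?K + ?K)) + ((?K + ?K + (?K + ?K)) + (?K + ?K + (?K + ?K))) =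
      16 * near_const * end_decay z" by simp
  ultimately show ?thesis unfolding eq by (simp only:)
qed

lemma near_psi':
  assumes c: "S + t - N - 1 \<le> 2 * l" "2 * l \<le> S + t - N" "r \<le> T" "r \<le> S + t" "S - N \<le> l" "t - N \<le> l"
    and z: "l \<le> z" "z \<le> v" "v \<le> r"
  shows "near deep_const (psi' v / (psi' z * q powi (v - z)))"
proof -
  have pos: "0 < psi' x" if "l \<le> x" "x \<le> r" for x
    using psi_pos[of x] that by (auto simp: psi'_def J_def)
  have "v \<le> r \<longrightarrow> near (\<Sum>x\<in>{z..<v}. 16 * near_const * end_decay x) (psi' v / (psi' z * q powi (v - z)))"
    using z(2)
  proof (induction v rule: int_ge_induct)
    case base
    then show ?case using pos[of z] z by (auto simp: near_refl)
  next
    case (step v)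
    show ?case
    proof
      assume v: "v + 1 \<le> r"
      have "near ((\<Sum>x\<in>{z..<v}. 16 * near_const * end_decay x) + 16 * near_const * end_decay v)
        (psi' v / (psi' z * q powi (v - z)) * (psi' (v + 1) / psi' v / q))"
        using step v z by (intro near_mult near_psi'_step c) auto
      moreover have "{z..<v + 1} = insert v {z..<v}" using step(1) by auto
      moreover have "psi' v / (psi' z * q powi (v - z)) * (psi' (v + 1) / psi' v / q) =
          psi' (v + 1) / (psi' z * q powi (v + 1 - z))"
        using pos[of v] step(1) z v by (simp add: power_int_add power_int_diff)
      ultimately show "near (\<Sum>x\<in>{z..<v + 1}. 16 * near_const * end_decay x) (psi' (v + 1) / (psi' z * q powi (v + 1 - z)))"
        by (simp add: add.commute)
    qed
  qed
  moreover have "(\<Sum>x\<in>{z..<v}. 16 * near_const * end_decay x) \<le> deep_const"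
  proof -
    have "(\<Sum>x\<in>{z..<v}. q powi (x + 1 - l)) = (\<Sum>a\<in>(\<lambda>x. x + 1 - l) ` {z..<v}. q powi a)"
      by (subst sum.reindex) (auto simp: inj_on_def)
    also have "\<dots> \<le> 1 / (1 - q)" using z by (intro qpow_sum_le) auto
    finally have 1: "(\<Sum>x\<in>{z..<v}. q powi (x + 1 - l)) \<le> 1 / (1 - q)" .
    have "(\<Sum>x\<in>{z..<v}. q powi (r - x)) = (\<Sum>a\<in>(\<lambda>x. r - x) ` {z..<v}. q powi a)"
      by (subst sum.reindex) (auto simp: inj_on_def)
    also have "\<dots> \<le> 1 / (1 - q)" using z by (intro qpow_sum_le) auto
    finally have 2: "(\<Sum>x\<in>{z..<v}. q powi (r - x)) \<le> 1 / (1 - q)" .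
    show ?thesis
      unfolding deep_const_def sum_distrib_left[symmetric] end_decay_def sum.distrib
      using 1 2 near_const_pos by (intro mult_left_mono add_mono) auto
  qed
  ultimately show ?thesis using near_mono z(3) by blast
qed

lemma R_deep:
  assumes "N \<le> T"
    and c: "S + t - N - 1 \<le> 2 * l" "2 * l \<le> S + t - N" "r \<le> T" "r \<le> S + t" "S - N \<le> l" "t - N \<le> l"
    and M: "\<And>d. 0 \<le> d \<Longrightarrow> exp (step_const * of_int d) * q powi (d * (d - 1)) \<le> M"
    and z: "z \<in> J" and y: "y \<in> slice N T S t - J"
  shows "R z y \<le> M * (exp (deep_const + 2 * Lam) * q powi (min (z - l) (r - z) - 1))"
proof -
  have zr: "l \<le> z" "z \<le> r" using z by (auto simp: J_def)
  have pos: "0 < psi' x" "0 < psi x" if "l \<le> x" "x \<le> r" for x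
    using psi_pos[of x] that by (auto simp: psi'_def J_def)
  have M0: "0 \<le> M" using order.trans[OF _ M[of 0]] by simp
  have bz: "bet (2 * z + 1 - S - t) \<le> exp Lam * q powi (min 0 (2 * z + 1 - S - t))"
    using comparD(2)[OF compar_bet[of "2 * z + 1 - S - t"]] by (simp add: neg_part_def)
  have L: "exp Lam * exp deep_const \<le> exp (deep_const + 2 * Lam)"
    unfolding exp_add[symmetric] using Lam_nonneg by simp
  consider "r < y" "y \<le> hi t" | "y < l" "lo t \<le> y"
    using y by (auto simp: J_def slice_alt)
  then show ?thesis
  proof cases
    case 1
    have "psi' r / (psi' z * q powi (r - z)) \<le> exp deep_const"
      using near_psi'[OF c zr(1) zr(2)] by (simp add: near_def)
    then have "psi' r \<le> exp deep_const * (psi' z * q powi (r - z))"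
      using pos[of z] zr by (simp add: divide_le_eq)
    moreover have "psi r \<le> psi' r"
    proof -
      have "1 \<le> bet (2 * r + 1 - S - t)" using b by (simp add: bet_def)
      then show ?thesis using pos(2)[of r] zr by (simp add: psi'_def mult_le_cancel_left1)
    qed
    ultimately have "psi r / psi z \<le> exp deep_const * (bet (2 * z + 1 - S - t) * q powi (r - z))"
      using pos(2)[of z] zr by (simp add: divide_le_eq psi'_def mult_ac)
    also have "\<dots> \<le> exp deep_const * ((exp Lam * q powi (min 0 (2 * z + 1 - S - t))) * q powi (r - z))"
      by (intro mult_left_mono mult_right_mono bz) auto
    also have "\<dots> = exp Lam * exp deep_const * q powi (min 0 (2 * z + 1 - S - t) + (r - z))"
      by (simp only: qpow_add mult_ac)
    also have "\<dots> \<le> exp (deep_const + 2 * Lam) * q powi (min (z - l) (r - z) - 1)"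
      using c by (intro mult_mono L qpow_le) auto
    finally have P: "psi r / psi z \<le> exp (deep_const + 2 * Lam) * q powi (min (z - l) (r - z) - 1)" .
    have "R z y \<le> (exp (step_const * of_int (y - r)) * q powi ((y - r) * (y - r - 1))) * (psi r / psi z)"
      using R_above[OF assms(1) c(1) z 1] by simp
    also have "\<dots> \<le> M * (psi r / psi z)"
      using M[of "y - r"] 1 pos(2)[of z] pos(2)[of r] zr by (intro mult_right_mono) auto
    also have "\<dots> \<le> M * (exp (deep_const + 2 * Lam) * q powi (min (z - l) (r - z) - 1))"
      by (intro mult_left_mono P M0)
    finally show ?thesis .
  next
    case 2
    have lr: "l \<le> r" using N by simp
    have "exp (- deep_const) \<le> psi' z / (psi' l * q powi (z - l))"
      using near_psi'[OF c order.refl zr] by (simp add: near_def)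
    then have "exp (- deep_const) * (psi' l * q powi (z - l)) \<le> psi' z"
      using pos[of l] lr by (simp add: le_divide_eq)
    then have "exp deep_const * (exp (- deep_const) * (psi' l * q powi (z - l))) \<le> exp deep_const * psi' z"
      by (rule mult_left_mono) simp
    then have *: "psi' l * q powi (z - l) \<le> exp deep_const * psi' z"
      by (simp add: mult.assoc[symmetric] exp_add[symmetric])
    have "2 * l + 1 - S - t \<le> 0" using c(2) N by linarith
    then have bl: "exp (- Lam) * q powi (2 * l + 1 - S - t) \<le> bet (2 * l + 1 - S - t)"
      using comparD(3)[OF compar_bet[of "2 * l + 1 - S - t"]] by (simp add: neg_part_def)
    have "psi l * (exp (- Lam) * q powi (2 * l + 1 - S - t)) * q powi (z - l) \<le> psi' l * q powi (z - l)"
      unfolding psi'_def using pos(2)[of l] lr by (intro mult_right_mono mult_left_mono bl) auto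
    also have "\<dots> \<le> exp deep_const * (psi z * (exp Lam * q powi (min 0 (2 * z + 1 - S - t))))"
      using pos(2)[of z] zr
      by (intro order.trans[OF *] mult_left_mono bz) (auto simp: psi'_def intro!: mult_left_mono bz)
    finally have "psi l * (exp (- Lam) * q powi (2 * l + 1 - S - t + (z - l))) \<le>
      psi z * (exp Lam * exp deep_const * q powi (min 0 (2 * z + 1 - S - t)))"
      unfolding qpow_add[of "2 * l + 1 - S - t" "z - l"] by (simp add: mult_ac)
    then have "(exp Lam * q powi (- (2 * l + 1 - S - t + (z - l)))) *
        (psi l * (exp (- Lam) * q powi (2 * l + 1 - S - t + (z - l)))) \<le>
      (exp Lam * q powi (- (2 * l + 1 - S - t + (z - l)))) *
        (psi z * (exp Lam * exp deep_const * q powi (min 0 (2 * z + 1 - S - t))))"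
      by (rule mult_left_mono) auto
    also have "(exp Lam * q powi (- (2 * l + 1 - S - t + (z - l)))) *
        (psi l * (exp (- Lam) * q powi (2 * l + 1 - S - t + (z - l)))) = psi l"
      by (simp only: power_int_minus exp_minus) (simp add: field_simps)
    also have "(exp Lam * q powi (- (2 * l + 1 - S - t + (z - l)))) *
        (psi z * (exp Lam * exp deep_const * q powi (min 0 (2 * z + 1 - S - t)))) =
       exp Lam * exp Lam * exp deep_const * q powi (- (2 * l + 1 - S - t + (z - l)) + min 0 (2 * z + 1 - S - t)) * psi z"
      by (simp only: qpow_add mult_ac)
    finally have "psi l / psi z \<le>
        exp Lam * exp Lam * exp deep_const * q powi (- (2 * l + 1 - S - t + (z - l)) + min 0 (2 * z + 1 - S - t))"
      using pos(2)[of z] zr by (simp add: divide_le_eq)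
    also have "\<dots> \<le> exp (deep_const + 2 * Lam) * q powi (min (z - l) (r - z) - 1)"
    proof (rule mult_mono)
      show "exp Lam * exp Lam * exp deep_const \<le> exp (deep_const + 2 * Lam)"
        unfolding exp_add[symmetric] by simp
      show "q powi (- (2 * l + 1 - S - t + (z - l)) + min 0 (2 * z + 1 - S - t)) \<le> q powi (min (z - l) (r - z) - 1)"
        using c by (intro qpow_le) auto
    qed auto
    finally have P: "psi l / psi z \<le> exp (deep_const + 2 * Lam) * q powi (min (z - l) (r - z) - 1)" .
    have "R z y \<le> (exp (step_const * of_int (l - y)) * q powi ((l - y) * (l - y - 1))) * (psi l / psi z)"
      using R_below[OF assms(1) c(2) z 2] by simp
    also have "\<dots> \<le> M * (psi l / psi z)"
      using M[of "l - y"] 2 pos(2)[of z] pos(2)[of l] zr lr by (intro mult_right_mono) auto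
    also have "\<dots> \<le> M * (exp (deep_const + 2 * Lam) * q powi (min (z - l) (r - z) - 1))"
      by (intro mult_left_mono P M0)
    finally show ?thesis .
  qed
qed

end

section \<open>The scaling limit\<close>

context qracah
begin

lemma qRacah_prob_union:
  assumes \<kappa>: "Re \<kappa> = 0" "Im \<kappa> > 0" "b = (Im \<kappa>)\<^sup>2" and "finite A"
    and sub: "\<And>p. p \<in> path_ensembles N T S \<Longrightarrow> E p \<Longrightarrow> \<exists>i\<in>A. F i p"
  shows "qRacah_prob N T S q \<kappa> E \<le> (\<Sum>i\<in>A. qRacah_prob N T S q \<kappa> (F i))"
proof -
  let ?P = "path_ensembles N T S"
  have "(\<Sum>p\<in>?P. path_weight p * of_bool (E p)) \<le> (\<Sum>p\<in>?P. \<Sum>i\<in>A. path_weight p * of_bool (F i p))"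
  proof (rule sum_mono)
    fix p assume p: "p \<in> ?P"
    have nonneg: "0 \<le> path_weight p * of_bool (F i p)" for i
      using path_weight_pos[of p] by simp
    show "path_weight p * of_bool (E p) \<le> (\<Sum>i\<in>A. path_weight p * of_bool (F i p))"
    proof (cases "E p")
      case True
      then obtain i where "i \<in> A" "F i p" using sub p by blast
      then have "path_weight p * of_bool (F i p) \<le> (\<Sum>i\<in>A. path_weight p * of_bool (F i p))"
        using \<open>finite A\<close> nonneg by (intro member_le_sum) auto
      then show ?thesis using True \<open>F i p\<close> by simp
    qed (use nonneg in \<open>auto intro: sum_nonneg\<close>)
  qed
  also have "\<dots> = (\<Sum>i\<in>A. \<Sum>p\<in>?P. path_weight p * of_bool (F i p))" by (rule sum.swap)
  finally have "(\<Sum>p\<in>?P. path_weight p * of_bool (E p)) / (\<Sum>p\<in>?P. path_weight p) \<le>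
      (\<Sum>i\<in>A. \<Sum>p\<in>?P. path_weight p * of_bool (F i p)) / (\<Sum>p\<in>?P. path_weight p)"
    using path_weight_pos by (intro divide_right_mono) (auto intro: sum_nonneg less_imp_le)
  then show ?thesis by (simp add: qRacah_prob_alt[OF \<kappa>] sum_divide_distrib)
qed

lemma qRacah_prob_mono:
  assumes "Re \<kappa> = 0" "Im \<kappa> > 0" "b = (Im \<kappa>)\<^sup>2"
    and "\<And>p. p \<in> path_ensembles N T S \<Longrightarrow> E p \<Longrightarrow> F p"
  shows "qRacah_prob N T S q \<kappa> E \<le> qRacah_prob N T S q \<kappa> F"
  using qRacah_prob_union[OF assms(1-3), of "{()}" E "\<lambda>_. F"] assms(4) by simp

end

context qracah_slice
begin

lemma configs_alt: "configs = slice_configs t"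
  by (simp add: configs_def slice_configs_def card_J)

lemma qRacah_prob_slice_le:
  assumes \<kappa>: "Re \<kappa> = 0" "Im \<kappa> > 0" "b = (Im \<kappa>)\<^sup>2"
    and le: "(\<Sum>X\<in>{X \<in> configs. P X}. ope_mass (w t) (mu t) X) \<le> B * total_mass" and B: "0 \<le> B"
  shows "qRacah_prob N T S q \<kappa> (\<lambda>p. P (positions N p t)) \<le> B"
proof -
  obtain C where C: "\<And>f. (\<Sum>p\<in>path_ensembles N T S. path_weight p * f (positions N p t)) =
      C * (\<Sum>X\<in>configs. ope_mass (w t) (mu t) X * f X)"
    using slice_law[OF t] unfolding configs_alt by blast
  have "(\<Sum>X\<in>configs. ope_mass (w t) (mu t) X * of_bool (P X)) =
      (\<Sum>X\<in>{X \<in> configs. P X}. ope_mass (w t) (mu t) X)"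
    using finite_configs by (intro sum.mono_neutral_cong_right) auto
  then have 1: "(\<Sum>p\<in>path_ensembles N T S. path_weight p * of_bool (P (positions N p t))) =
      C * (\<Sum>X\<in>{X \<in> configs. P X}. ope_mass (w t) (mu t) X)"
    using C[of "\<lambda>X. of_bool (P X)"] by simp
  have 2: "(\<Sum>p\<in>path_ensembles N T S. path_weight p) = C * total_mass"
    using C[of "\<lambda>_. 1"] by (simp add: total_mass_def)
  have "0 \<le> total_mass" unfolding total_mass_def by (intro sum_nonneg mass_nonneg)
  show ?thesis
  proof (cases "C = 0 \<or> total_mass = 0")
    case True
    then show ?thesis using B unfolding qRacah_prob_alt[OF \<kappa>] 1 2 by auto
  next
    case False
    then show ?thesis using le \<open>0 \<le> total_mass\<close>
      unfolding qRacah_prob_alt[OF \<kappa>] 1 2 by (simp add: divide_le_eq)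
  qed
qed

lemma prob_particle_le:
  assumes "Re \<kappa> = 0" "Im \<kappa> > 0" "b = (Im \<kappa>)\<^sup>2" "y \<in> slice N T S t - J"
  shows "qRacah_prob N T S q \<kappa> (\<lambda>p. y \<in> positions N p t) \<le> of_int N * (\<Sum>z\<in>J. R z y)"
proof (rule qRacah_prob_slice_le[OF assms(1-3), of "\<lambda>X. y \<in> X"])
  show "(\<Sum>X\<in>{X \<in> configs. y \<in> X}. ope_mass (w t) (mu t) X) \<le> of_int N * (\<Sum>z\<in>J. R z y) * total_mass"
    using particle_mass_le[OF assms(4)] N by (simp add: card_J)
  show "0 \<le> of_int N * (\<Sum>z\<in>J. R z y)"
    using assms(4) J_subset N by (intro mult_nonneg_nonneg sum_nonneg exchange_nonneg) auto
qed

lemma prob_hole_le: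
  assumes "Re \<kappa> = 0" "Im \<kappa> > 0" "b = (Im \<kappa>)\<^sup>2" "z \<in> J"
  shows "qRacah_prob N T S q \<kappa> (\<lambda>p. z \<in> holes N T S p t) \<le>
    card (slice N T S t - J) * (\<Sum>y\<in>slice N T S t - J. R z y)"
proof -
  have "qRacah_prob N T S q \<kappa> (\<lambda>p. z \<in> holes N T S p t) \<le> qRacah_prob N T S q \<kappa> (\<lambda>p. z \<notin> positions N p t)"
    by (rule qRacah_prob_mono[OF assms(1-3)]) (simp add: holes_def)
  also have "\<dots> \<le> card (slice N T S t - J) * (\<Sum>y\<in>slice N T S t - J. R z y)"
    using assms(4) J_subset
    by (intro qRacah_prob_slice_le[OF assms(1-3), of "\<lambda>X. z \<notin> X"] hole_mass_le
        mult_nonneg_nonneg sum_nonneg exchange_nonneg) auto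
  finally show ?thesis .
qed

lemma corr_kernel_alt:
  assumes "Re \<kappa> = 0" "b = (Im \<kappa>)\<^sup>2"
  shows "corr_kernel N T S q \<kappa> t x y = kernel x y"
proof -
  have "Re (\<kappa>\<^sup>2) = - b" using assms by (simp add: power2_eq_square)
  then have "qRacah_span N T S q (Re (\<kappa>\<^sup>2)) t = poly_span (slice N T S t) (mu t) (\<lambda>x. sqrt (w t x)) (nat N)"
    by (simp add: qRacah_span_def poly_span_def mu_def[abs_def] w_def[abs_def])
  then show ?thesis by (simp add: corr_kernel_def kernel_def card_J)
qed

end

text \<open>The left end of the interval filled by the paths, as in \<open>path_band\<close>, on the lattice scale.\<close>

definition clamp :: "int \<Rightarrow> int \<Rightarrow> int \<Rightarrow> int \<Rightarrow> int" where
  "clamp N T S t = max (max 0 (t + S - T)) (min (min S t) ((S + t - N) div 2))"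

definition band_left :: "real \<Rightarrow> real \<Rightarrow> real \<Rightarrow> real \<Rightarrow> real" where
  "band_left N T S t = max (max 0 (t + S - T)) (min (min S t) ((S + t - N) / 2))"

lemma band_left_scale:
  assumes "0 < L"
  shows "band_left (L * N) (L * T) (L * S) (L * t) = L * band_left N T S t"
proof -
  have *: "L * max x y = max (L * x) (L * y)" "L * min x y = min (L * x) (L * y)" for x y
    using assms by (simp_all add: max_mult_distrib_left min_mult_distrib_left)
  show ?thesis unfolding band_left_def * by (simp add: algebra_simps)
qed

lemma clamp_approx:
  "\<bar>of_int (clamp \<lfloor>N\<rfloor> \<lfloor>T\<rfloor> \<lfloor>S\<rfloor> t) - band_left N T S (of_int t)\<bar> \<le> 2"
proof -
  have lip: "\<bar>max x y - max x' y'\<bar> \<le> 2" "\<bar>min x y - min x' y'\<bar> \<le> 2"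
    if "\<bar>x - x'\<bar> \<le> 2" "\<bar>y - y'\<bar> \<le> 2" for x y x' y' :: real
    using that by (auto simp: max_def min_def)
  have d: "2 * ((\<lfloor>S\<rfloor> + t - \<lfloor>N\<rfloor>) div 2) \<le> \<lfloor>S\<rfloor> + t - \<lfloor>N\<rfloor>"
    "\<lfloor>S\<rfloor> + t - \<lfloor>N\<rfloor> - 1 \<le> 2 * ((\<lfloor>S\<rfloor> + t - \<lfloor>N\<rfloor>) div 2)" by linarith+
  have d': "2 * of_int ((\<lfloor>S\<rfloor> + t - \<lfloor>N\<rfloor>) div 2) \<le> real_of_int (\<lfloor>S\<rfloor> + t - \<lfloor>N\<rfloor>)"
    "real_of_int (\<lfloor>S\<rfloor> + t - \<lfloor>N\<rfloor>) - 1 \<le> 2 * of_int ((\<lfloor>S\<rfloor> + t - \<lfloor>N\<rfloor>) div 2)"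
    using d by linarith+
  have f: "of_int \<lfloor>x\<rfloor> \<le> x" "x < of_int \<lfloor>x\<rfloor> + 1" for x :: real by linarith+
  have "\<bar>of_int (t + \<lfloor>S\<rfloor> - \<lfloor>T\<rfloor>) - (of_int t + S - T)\<bar> \<le> 2"
    using f[of S] f[of T] unfolding abs_le_iff of_int_add of_int_diff by linarith
  moreover have "\<bar>of_int \<lfloor>S\<rfloor> - S\<bar> \<le> 2"
    using f[of S] unfolding abs_le_iff by linarith
  moreover have "\<bar>of_int ((\<lfloor>S\<rfloor> + t - \<lfloor>N\<rfloor>) div 2) - (S + of_int t - N) / 2\<bar> \<le> 2"
    using d' f[of S] f[of N] unfolding abs_le_iff of_int_add of_int_diff by (intro conjI; argo)
  ultimately show ?thesis
    unfolding clamp_def band_left_def of_int_max of_int_min by (intro lip) auto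
qed

lemma clamp_bounds:
  assumes "0 \<le> t" "t \<le> T" "0 \<le> S" "S \<le> T"
  shows "max 0 (t + S - T) \<le> clamp N T S t" "clamp N T S t \<le> min S t"
    and "clamp N T S t < min S t \<Longrightarrow> S + t - N - 1 \<le> 2 * clamp N T S t"
    and "max 0 (t + S - T) < clamp N T S t \<Longrightarrow> 2 * clamp N T S t \<le> S + t - N"
proof -
  define m where "m = (S + t - N) div 2"
  have m: "S + t - N - 1 \<le> 2 * m" "2 * m \<le> S + t - N" unfolding m_def by linarith+
  show "max 0 (t + S - T) \<le> clamp N T S t" "clamp N T S t \<le> min S t"
    using assms by (auto simp: clamp_def)
  show "S + t - N - 1 \<le> 2 * clamp N T S t" if "clamp N T S t < min S t"
    using that m unfolding clamp_def m_def[symmetric] by (auto simp: max_def min_def split: if_splits)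
  show "2 * clamp N T S t \<le> S + t - N" if "max 0 (t + S - T) < clamp N T S t"
    using that m unfolding clamp_def m_def[symmetric] by (auto simp: max_def min_def split: if_splits)
qed

lemma poly_exp_bound:
  fixes K c :: real
  assumes "0 < c"
  shows "\<forall>\<^sub>F L in at_top. K * L ^ 2 * exp (- 2 * c * L) \<le> exp (- c * L)"
    and "\<forall>\<^sub>F L in at_top. K * L ^ 2 * exp (- c * L) \<le> 1"
proof -
  have "((\<lambda>L. K * L ^ 2 * exp (- c * L)) \<longlongrightarrow> 0) at_top"
    using assms by real_asymp
  from order_tendstoD(2)[OF this, of 1]
  show 1: "\<forall>\<^sub>F L in at_top. K * L ^ 2 * exp (- c * L) \<le> 1"
    by (auto elim: eventually_mono)
  show "\<forall>\<^sub>F L in at_top. K * L ^ 2 * exp (- 2 * c * L) \<le> exp (- c * L)"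
    using 1
  proof (rule eventually_mono)
    fix L assume "K * L ^ 2 * exp (- c * L) \<le> 1"
    then have "(K * L ^ 2 * exp (- c * L)) * exp (- c * L) \<le> 1 * exp (- c * L)"
      by (rule mult_right_mono) simp
    moreover have "exp (- 2 * c * L) = exp (- c * L) * exp (- c * L)"
      by (simp add: exp_add[symmetric])
    ultimately show "K * L ^ 2 * exp (- 2 * c * L) \<le> exp (- c * L)"
      by (simp only: mult.assoc mult_1)
  qed
qed

text \<open>\<open>deep\<close> and \<open>far\<close> are the scaled waterfall region and the complement of the band, with
  margins, on the lattice scale.\<close>

definition deep :: "real \<Rightarrow> real \<Rightarrow> real \<Rightarrow> real \<Rightarrow> real \<Rightarrow> real \<Rightarrow> bool" where
  "deep \<delta> N T S t x \<longleftrightarrow> N - S + \<delta> \<le> t \<and> S - N + \<delta> \<le> t \<and> t + \<delta> \<le> N + S \<and> t + \<delta> \<le> 2 * T - N - S \<and>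
     2 * x - S - t + \<delta> \<le> N \<and> S + t - 2 * x + \<delta> \<le> N"

definition far :: "real \<Rightarrow> real \<Rightarrow> real \<Rightarrow> real \<Rightarrow> real \<Rightarrow> real \<Rightarrow> bool" where
  "far \<delta> N T S t x \<longleftrightarrow> band_left N T S t + N + \<delta> \<le> x \<or> x + \<delta> \<le> band_left N T S t"

locale qracah_limit =
  fixes TT SS NN q :: real and \<kappa> :: complex
  assumes params: "SS > 0" "TT > SS" "0 < NN" "NN < TT"
    and q01: "0 < q" "q < 1" and \<kappa>: "Re \<kappa> = 0" "Im \<kappa> > 0"
begin

sublocale q_parameters q "(Im \<kappa>)\<^sup>2"
  using q01 \<kappa> by unfold_locales auto

abbreviation NL :: "real \<Rightarrow> int" where "NL L \<equiv> \<lfloor>L * NN\<rfloor>"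
abbreviation TL :: "real \<Rightarrow> int" where "TL L \<equiv> \<lfloor>L * TT\<rfloor>"
abbreviation SL :: "real \<Rightarrow> int" where "SL L \<equiv> \<lfloor>L * SS\<rfloor>"

abbreviation sliceL where "sliceL L \<equiv> slice \<lfloor>L * NN\<rfloor> \<lfloor>L * TT\<rfloor> \<lfloor>L * SS\<rfloor>"
abbreviation holesL where "holesL L \<equiv> holes \<lfloor>L * NN\<rfloor> \<lfloor>L * TT\<rfloor> \<lfloor>L * SS\<rfloor>"
abbreviation kernelL where "kernelL L \<equiv> corr_kernel \<lfloor>L * NN\<rfloor> \<lfloor>L * TT\<rfloor> \<lfloor>L * SS\<rfloor> q \<kappa>"
abbreviation probL where "probL L \<equiv> qRacah_prob \<lfloor>L * NN\<rfloor> \<lfloor>L * TT\<rfloor> \<lfloor>L * SS\<rfloor> q \<kappa>"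

abbreviation deepL :: "real \<Rightarrow> real \<Rightarrow> int \<Rightarrow> int \<Rightarrow> bool" where
  "deepL \<delta> L t x \<equiv> deep (\<delta> * L) (L * NN) (L * TT) (L * SS) (of_int t) (of_int x)"
abbreviation farL :: "real \<Rightarrow> real \<Rightarrow> int \<Rightarrow> int \<Rightarrow> bool" where
  "farL \<delta> L t x \<equiv> far (\<delta> * L) (L * NN) (L * TT) (L * SS) (of_int t) (of_int x)"

abbreviation deep_decay :: "real \<Rightarrow> real \<Rightarrow> real \<Rightarrow> bool" where
  "deep_decay \<delta> \<eta> L \<equiv> \<forall>t z. deepL \<delta> L t z \<longrightarrow>
     probL L (\<lambda>p. z \<in> holesL L p t) \<le> exp (- \<eta> * L) \<and>
     (\<forall>x. deepL \<delta> L t x \<longrightarrow> ((if x = z then 1 else 0) - kernelL L t x z)\<^sup>2 \<le> exp (- \<eta> * L))"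

abbreviation far_decay :: "real \<Rightarrow> real \<Rightarrow> bool" where
  "far_decay \<delta> L \<equiv> \<forall>t y. 0 \<le> t \<longrightarrow> t \<le> TL L \<longrightarrow> farL \<delta> L t y \<longrightarrow>
     (y \<in> sliceL L t \<longrightarrow> probL L (\<lambda>p. y \<in> positions (NL L) p t) \<le> exp (- L)) \<and>
     (\<forall>x. (kernelL L t x y)\<^sup>2 \<le> exp (- L))"

lemma floors:
  "of_int (NL L) \<le> L * NN" "L * NN < of_int (NL L) + 1"
  "of_int (TL L) \<le> L * TT" "L * TT < of_int (TL L) + 1"
  "of_int (SL L) \<le> L * SS" "L * SS < of_int (SL L) + 1"
  by linarith+

lemma eventually_ge_linear:
  assumes "0 < c"
  shows "\<forall>\<^sub>F L :: real in at_top. k \<le> L * c"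
  using eventually_ge_at_top[of "k / c"]
  by eventually_elim (use assms in \<open>simp add: divide_le_eq\<close>)

lemma eventually_qracah: "\<forall>\<^sub>F L in at_top. 0 < L \<and> qracah q ((Im \<kappa>)\<^sup>2) (NL L) (TL L) (SL L) \<and> NL L \<le> TL L"
  using eventually_gt_at_top[of 0] eventually_ge_linear[OF params(3), of 1]
proof eventually_elim
  case (elim L)
  have "L * SS \<le> L * TT" "L * NN \<le> L * TT" "0 \<le> L * SS"
    using elim params by (auto intro!: mult_left_mono)
  then have "SL L \<le> TL L" "NL L \<le> TL L" "1 \<le> NL L" "0 \<le> SL L"
    using elim by (simp_all add: floor_mono)
  then show ?case using elim by (auto intro!: qracah.intro qracah_axioms.intro q_parameters_axioms)
qed

lemma deep_estimate:
  assumes \<delta>: "0 < \<delta>"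
  shows "\<exists>\<eta>>0. \<forall>\<^sub>F L in at_top. deep_decay \<delta> \<eta> L"
proof -
  obtain M where M: "\<And>d. 0 \<le> d \<Longrightarrow> exp (step_const * of_int d) * q powi (d * (d - 1)) \<le> M"
    using qpow_quadratic_bounded by blast
  have M0: "0 \<le> M" using order.trans[OF _ M[of 0]] by simp
  define C where "C = M * exp (deep_const + 2 * Lam)"
  have C0: "0 \<le> C" using M0 by (simp add: C_def)
  define \<eta> where "\<eta> = - ln q * \<delta> / 4"
  have \<eta>: "0 < \<eta>" using ln_q \<delta> by (simp add: \<eta>_def mult_neg_pos)
  define K where "K = (SS + NN)\<^sup>2 * C * exp (- 4 * ln q)"
  have "\<forall>\<^sub>F L in at_top. deep_decay \<delta> \<eta> L"
    using eventually_qracah eventually_ge_linear[OF \<delta>, of 20] poly_exp_bound(1)[OF \<eta>, of K]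
  proof eventually_elim
    case (elim L)
    define N T S where "N = NL L" and "T = TL L" and "S = SL L"
    have L: "0 < L" "20 \<le> \<delta> * L" and NT: "N \<le> T" and base: "qracah q ((Im \<kappa>)\<^sup>2) N T S"
      using elim by (simp_all add: N_def T_def S_def mult.commute)
    interpret qracah q "(Im \<kappa>)\<^sup>2" N T S by (rule base)
    note fl = floors[of L, folded N_def T_def S_def]
    show ?case
    proof (intro allI impI)
      fix t z :: int assume "deepL \<delta> L t z"
      note dz = this[unfolded deep_def]
      define l where "l = (S + t - N) div 2"
      have l2: "S + t - N - 1 \<le> 2 * l" "2 * l \<le> S + t - N" unfolding l_def by linarith+
      have tr: "N - S + 10 \<le> t" "S - N + 10 \<le> t" "t + 10 \<le> N + S" "t + 10 \<le> 2 * T - N - S"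
        using dz L(2) fl by linarith+
      have "0 \<le> t" "t \<le> T" using tr by linarith+
      moreover have "lo t \<le> l" "l + N - 1 \<le> hi t"
        using tr l2 by (auto simp: lo_def hi_def)
      ultimately interpret qracah_slice q "(Im \<kappa>)\<^sup>2" N T S t l
        by unfold_locales
      have c: "r \<le> T" "r \<le> S + t" "S - N \<le> l" "t - N \<le> l" using tr l2 by linarith+
      have inJ: "x \<in> J \<and> \<delta> * L / 2 - 3 \<le> of_int (min (x - l) (r - x))"
        if "deepL \<delta> L t x" for x :: int
      proof -
        note dx = that[unfolded deep_def]
        have l2': "real_of_int S + of_int t - of_int N - 1 \<le> 2 * of_int l"
          "2 * real_of_int l \<le> of_int S + of_int t - of_int N"
          using l2 by linarith+
        have a: "\<delta> * L / 2 - 3 \<le> of_int (x - l)" "\<delta> * L / 2 - 3 \<le> of_int (r - x)"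
          unfolding of_int_diff of_int_add using dx l2' fl by (simp; argo)+
        then have "0 \<le> x - l" "0 \<le> r - x" using L(2) by linarith+
        then show ?thesis using a by (auto simp: J_def min_def)
      qed
      have zJ: "z \<in> J" and dist: "\<delta> * L / 2 - 3 \<le> of_int (min (z - l) (r - z))"
        using inJ dz deep_def by auto
      have Rz: "R z y \<le> C * exp ((\<delta> * L / 2 - 4) * ln q)" if y: "y \<in> slice N T S t - J" for y
      proof -
        have "R z y \<le> M * (exp (deep_const + 2 * Lam) * q powi (min (z - l) (r - z) - 1))"
          by (rule R_deep[OF NT l2 c _ zJ y]) (rule M)
        also have "\<dots> = C * q powi (min (z - l) (r - z) - 1)" by (simp add: C_def)
        also have "\<dots> \<le> C * exp ((\<delta> * L / 2 - 4) * ln q)"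
          unfolding qpow_exp using dist ln_q C0 by (intro mult_left_mono) auto
        finally show ?thesis .
      qed
      have finI: "finite (slice N T S t)" by (simp add: slice_def)
      define k where "k = real (card (slice N T S t - J))"
      have k: "0 \<le> k" "k \<le> (SS + NN) * L"
      proof -
        have "card (slice N T S t - J) \<le> card {0..S + N - 1}"
          by (intro card_mono) (auto simp: slice_def)
        also have "\<dots> = nat (S + N)" by simp
        finally have "k \<le> of_int (S + N)" using ranges by (simp add: k_def)
        then show "k \<le> (SS + NN) * L" using fl by (simp add: algebra_simps)
      qed (simp add: k_def)
      have sum: "(\<Sum>y\<in>slice N T S t - J. R z y) \<le> k * (C * exp ((\<delta> * L / 2 - 4) * ln q))"
        unfolding k_def using sum_bounded_above[of "slice N T S t - J" "R z"] Rz by blast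
      have e: "exp ((\<delta> * L / 2 - 4) * ln q) = exp (- 4 * ln q) * exp (- 2 * \<eta> * L)"
        unfolding exp_add[symmetric] \<eta>_def by (simp add: algebra_simps)
      have final: "k' * (\<Sum>y\<in>slice N T S t - J. R z y) \<le> exp (- \<eta> * L)"
        if k': "0 \<le> k'" "k' \<le> (SS + NN) * L" for k'
      proof -
        have "k' * (\<Sum>y\<in>slice N T S t - J. R z y) \<le> k' * (k * (C * exp ((\<delta> * L / 2 - 4) * ln q)))"
          by (intro mult_left_mono sum k')
        also have "\<dots> = (k' * k) * (C * exp ((\<delta> * L / 2 - 4) * ln q))" by simp
        also have "\<dots> \<le> (((SS + NN) * L) * ((SS + NN) * L)) * (C * exp ((\<delta> * L / 2 - 4) * ln q))"
          using k k' C0 by (intro mult_right_mono mult_mono) auto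
        also have "\<dots> = K * L ^ 2 * exp (- 2 * \<eta> * L)"
          unfolding e K_def by (simp add: power2_eq_square mult_ac)
        also have "\<dots> \<le> exp (- \<eta> * L)" using elim by simp
        finally show ?thesis .
      qed
      have "qRacah_prob N T S q \<kappa> (\<lambda>p. z \<in> holes N T S p t) \<le> k * (\<Sum>y\<in>slice N T S t - J. R z y)"
        unfolding k_def by (rule prob_hole_le[OF \<kappa> refl zJ])
      also have "\<dots> \<le> exp (- \<eta> * L)" by (rule final[OF k])
      finally have 1: "qRacah_prob N T S q \<kappa> (\<lambda>p. z \<in> holes N T S p t) \<le> exp (- \<eta> * L)" .
      have "1 \<le> (SS + NN) * L"
        using ranges(9) ranges(7) fl by (simp add: algebra_simps)
      then have s: "(\<Sum>y\<in>slice N T S t - J. R z y) \<le> exp (- \<eta> * L)"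
        using final[of 1] by simp
      have 2: "((if x = z then 1 else 0) - corr_kernel N T S q \<kappa> t x z)\<^sup>2 \<le> exp (- \<eta> * L)"
        if "deepL \<delta> L t x" for x
      proof -
        have "x \<in> slice N T S t" using inJ[OF that] J_subset by auto
        from order.trans[OF kernel_at_node[OF zJ this] s] show ?thesis
          by (simp add: corr_kernel_alt[OF \<kappa>(1) refl])
      qed
      show "probL L (\<lambda>p. z \<in> holesL L p t) \<le> exp (- \<eta> * L) \<and>
        (\<forall>x :: int. deepL \<delta> L t x \<longrightarrow>
        ((if x = z then 1 else 0) - kernelL L t x z)\<^sup>2 \<le> exp (- \<eta> * L))"
        unfolding N_def[symmetric] T_def[symmetric] S_def[symmetric] using 1 2 by blast
    qed
  qed
  then show ?thesis using \<eta> by blast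
qed

lemma far_estimate:
  assumes \<delta>: "0 < \<delta>"
  shows "\<forall>\<^sub>F L in at_top. far_decay \<delta> L"
proof -
  define lam where "lam = - ln q"
  have lam: "0 < lam" using ln_q by (simp add: lam_def)
  define c1 where "c1 = step_const * (1 + 2 * NN / \<delta>)"
  define c2 where "c2 = (c1 + lam + 4 / \<delta>) / lam"
  have "\<forall>\<^sub>F L in at_top. NN\<^sup>2 * L ^ 2 * exp (- 1 * L) \<le> 1" by (rule poly_exp_bound(2)) simp
  then show ?thesis
    using eventually_qracah eventually_ge_linear[OF \<delta>, of 20] eventually_ge_linear[OF \<delta>, of "2 * c2"]
  proof eventually_elim
    case (elim L)
    define N T S where "N = NL L" and "T = TL L" and "S = SL L"
    have L: "0 < L" "20 \<le> \<delta> * L" "2 * c2 \<le> \<delta> * L" and NT: "N \<le> T"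
      and base: "qracah q ((Im \<kappa>)\<^sup>2) N T S"
      using elim by (simp_all add: N_def T_def S_def mult.commute)
    interpret qracah q "(Im \<kappa>)\<^sup>2" N T S by (rule base)
    note fl = floors[of L, folded N_def T_def S_def]
    have small: "of_int N * (of_int N * (exp (step_const * of_int (d + N)) * q powi (d * (d - 1)))) \<le> exp (- L)"
      if d: "\<delta> * L / 2 \<le> of_int d" for d
    proof -
      have d0: "c2 \<le> of_int d" "0 < real_of_int d" using d L by linarith+
      have "of_int N \<le> 2 * NN / \<delta> * of_int d"
      proof -
        have "L \<le> 2 / \<delta> * of_int d" using d \<delta> by (simp add: field_simps)
        then have "L * NN \<le> 2 / \<delta> * of_int d * NN" using params by (intro mult_right_mono) auto
        then show ?thesis using fl(1) by (simp add: mult_ac)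
      qed
      then have "step_const * of_int (d + N) \<le> step_const * ((1 + 2 * NN / \<delta>) * of_int d)"
        by (intro mult_left_mono step_const_nonneg) (simp add: algebra_simps)
      then have 1: "step_const * of_int (d + N) \<le> c1 * of_int d" by (simp add: c1_def mult_ac)
      have "c1 + lam + 4 / \<delta> \<le> lam * of_int d"
        using d0 lam by (simp add: c2_def pos_divide_le_eq mult.commute)
      then have "(c1 + lam + 4 / \<delta>) * of_int d \<le> lam * of_int d * of_int d"
        using d0 by (intro mult_right_mono) auto
      moreover have "2 * L \<le> 4 / \<delta> * of_int d" using d \<delta> by (simp add: field_simps)
      moreover have "of_int (d * (d - 1)) * ln q = lam * of_int d - lam * of_int d * of_int d"
        by (simp add: lam_def algebra_simps)
      ultimately have "step_const * of_int (d + N) + of_int (d * (d - 1)) * ln q \<le> - 2 * L"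
        using 1 by (simp add: algebra_simps)
      then have "exp (step_const * of_int (d + N)) * q powi (d * (d - 1)) \<le> exp (- 2 * L)"
        unfolding qpow_exp exp_add[symmetric] by simp
      moreover have "0 \<le> real_of_int N" "of_int N \<le> NN * L" using fl N by (auto simp: mult.commute)
      ultimately have "of_int N * (of_int N * (exp (step_const * of_int (d + N)) * q powi (d * (d - 1)))) \<le>
          (NN * L) * ((NN * L) * exp (- 2 * L))"
        by (intro mult_mono) auto
      also have "\<dots> = (NN\<^sup>2 * L ^ 2 * exp (- 1 * L)) * exp (- L)"
        by (simp add: power2_eq_square exp_add[symmetric])
      also have "\<dots> \<le> 1 * exp (- L)" using elim by (intro mult_right_mono) auto
      finally show ?thesis by simp
    qed
    show ?case
    proof (intro allI impI)
      fix t y :: int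
      assume "0 \<le> t" "t \<le> TL L" and far: "farL \<delta> L t y"
      then have t: "0 \<le> t" "t \<le> T" by (simp_all add: T_def)
      define l where "l = clamp N T S t"
      note cl = clamp_bounds[OF t S, of N, folded l_def]
      have approx: "\<bar>of_int l - band_left (L * NN) (L * TT) (L * SS) (of_int t)\<bar> \<le> 2"
        unfolding l_def N_def T_def S_def by (rule clamp_approx)
      have "lo t \<le> l" "l + N - 1 \<le> hi t" using cl(1,2) by (auto simp: lo_def hi_def)
      then interpret qracah_slice q "(Im \<kappa>)\<^sup>2" N T S t l using t by unfold_locales
      have main: "of_int N * (\<Sum>z\<in>J. R z y) \<le> exp (- L) \<and> y \<notin> J" if y: "y \<in> slice N T S t"
      proof -
        have sum: "of_int N * (\<Sum>z\<in>J. R z y) \<le> of_int N * (of_int N * B)" if "\<And>z. z \<in> J \<Longrightarrow> R z y \<le> B" for B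
          using sum_bounded_above[of J "\<lambda>z. R z y" B] that N by (intro mult_left_mono) (auto simp: card_J)
        consider "band_left (L * NN) (L * TT) (L * SS) (of_int t) + L * NN + \<delta> * L \<le> of_int y"
          | "of_int y + \<delta> * L \<le> band_left (L * NN) (L * TT) (L * SS) (of_int t)"
          using far by (auto simp: far_def)
        then show ?thesis
        proof cases
          case 1
          then have d: "\<delta> * L / 2 \<le> of_int (y - r)" using approx fl L(2) by (simp add: abs_le_iff; argo)
          then have ry: "r < y" using L(2) by linarith
          moreover have "y \<le> hi t" using y by (simp add: slice_alt)
          moreover have "S + t - N - 1 \<le> 2 * l"
            using ry \<open>y \<le> hi t\<close> by (intro cl(3)) (auto simp: hi_def)
          ultimately have "R z y \<le> exp (step_const * of_int (y - r + N)) * q powi ((y - r) * (y - r - 1))"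
            if "z \<in> J" for z using R_far_above[OF NT _ that] by simp
          from order.trans[OF sum[OF this] small[OF d]] ry show ?thesis by (auto simp: J_def)
        next
          case 2
          then have d: "\<delta> * L / 2 \<le> of_int (l - y)" using approx fl L(2) by (simp add: abs_le_iff; argo)
          then have ly: "y < l" using L(2) by linarith
          moreover have "lo t \<le> y" using y by (simp add: slice_alt)
          moreover have "2 * l \<le> S + t - N"
            using ly \<open>lo t \<le> y\<close> by (intro cl(4)) (auto simp: lo_def)
          ultimately have "R z y \<le> exp (step_const * of_int (l - y + N)) * q powi ((l - y) * (l - y - 1))"
            if "z \<in> J" for z using R_far_below[OF NT _ that] by simp
          from order.trans[OF sum[OF this] small[OF d]] ly show ?thesis by (auto simp: J_def)
        qed
      qed
      have 1: "qRacah_prob N T S q \<kappa> (\<lambda>p. y \<in> positions N p t) \<le> exp (- L)" if y: "y \<in> slice N T S t"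
        using order.trans[OF prob_particle_le[OF \<kappa> refl]] main[OF y] y by blast
      have 2: "(corr_kernel N T S q \<kappa> t x y)\<^sup>2 \<le> exp (- L)" for x
      proof (cases "y \<in> slice N T S t")
        case True
        have s0: "0 \<le> (\<Sum>z\<in>J. R z y)" using True J_subset by (intro sum_nonneg exchange_nonneg) auto
        have "(kernel x y)\<^sup>2 \<le> 1 * (\<Sum>z\<in>J. R z y)"
          using kernel_outside_nodes main[OF True] True by simp
        also have "\<dots> \<le> of_int N * (\<Sum>z\<in>J. R z y)"
          using N s0 by (intro mult_right_mono) auto
        also have "\<dots> \<le> exp (- L)" using main[OF True] by blast
        finally show ?thesis by (simp add: corr_kernel_alt[OF \<kappa>(1) refl])
      next
        case False
        then show ?thesis by (simp add: corr_kernel_alt[OF \<kappa>(1) refl] kernel_column_outside)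
      qed
      show "(y \<in> sliceL L t \<longrightarrow>
        probL L (\<lambda>p. y \<in> positions (NL L) p t) \<le> exp (- L)) \<and>
        (\<forall>x :: int. (kernelL L t x y)\<^sup>2 \<le> exp (- L))"
        unfolding N_def[symmetric] T_def[symmetric] S_def[symmetric] using 1 2 by blast
    qed
  qed
qed

end

lemma band_left_lipschitz: "\<bar>band_left N T S t - band_left N T S t'\<bar> \<le> \<bar>t - t'\<bar>"
proof -
  have lip: "\<bar>max x y - max x' y'\<bar> \<le> e" "\<bar>min x y - min x' y'\<bar> \<le> e"
    if "\<bar>x - x'\<bar> \<le> e" "\<bar>y - y'\<bar> \<le> e" for x y x' y' e :: real
    using that by (auto simp: max_def min_def)
  have e: "(S + t - N) / 2 - (S + t' - N) / 2 = (t - t') / 2" by (simp add: diff_divide_distrib add_divide_distrib)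
  have "\<bar>(S + t - N) / 2 - (S + t' - N) / 2\<bar> \<le> \<bar>t - t'\<bar>" unfolding e by simp
  then show ?thesis unfolding band_left_def by (intro lip) auto
qed

lemma positive_margin:
  fixes f :: "'a :: topological_space \<Rightarrow> real"
  assumes "compact C" "continuous_on C f" "\<And>p. p \<in> C \<Longrightarrow> 0 < f p"
  obtains \<delta> where "0 < \<delta>" "\<And>p. p \<in> C \<Longrightarrow> \<delta> \<le> f p"
proof (cases "C = {}")
  case True
  then show ?thesis using that[of 1] by auto
next
  case False
  then obtain p where "p \<in> C" "\<And>x. x \<in> C \<Longrightarrow> f p \<le> f x"
    using continuous_attains_inf[OF assms(1) False assms(2)] by blast
  then show ?thesis using that[of "f p"] assms(3) by blast
qed

lemma tendsto_of_square_bound: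
  fixes f :: "real \<Rightarrow> real"
  assumes "0 < \<eta>" "\<forall>\<^sub>F L in at_top. (c - f L)\<^sup>2 \<le> exp (- \<eta> * L)"
  shows "(f \<longlongrightarrow> c) at_top"
proof -
  have "((\<lambda>L. f L - c) \<longlongrightarrow> 0) at_top"
  proof (rule Lim_null_comparison)
    show "\<forall>\<^sub>F L in at_top. norm (f L - c) \<le> exp (- (\<eta> / 2) * L)"
      using assms(2)
    proof eventually_elim
      case (elim L)
      have "(exp (- (\<eta> / 2) * L))\<^sup>2 = exp (- \<eta> * L)"
        by (simp add: power2_eq_square exp_add[symmetric])
      then have "(f L - c)\<^sup>2 \<le> (exp (- (\<eta> / 2) * L))\<^sup>2"
        using elim by (simp only: power2_commute[of "f L" c])
      then show ?case by (simp add: abs_le_square_iff[symmetric])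
    qed
    show "((\<lambda>L. exp (- (\<eta> / 2) * L)) \<longlongrightarrow> 0) at_top"
      using assms(1) by real_asymp
  qed
  then show ?thesis by (simp add: LIM_zero_iff)
qed

lemma deep_scale:
  assumes "0 < L" "deep \<delta> N T S (t / L) (x / L)"
  shows "deep (\<delta> * L) (L * N) (L * T) (L * S) t x"
proof -
  have *: "a \<le> b \<Longrightarrow> L * a \<le> L * b" for a b using assms(1) by simp
  show ?thesis
    using assms(2)[unfolded deep_def, THEN conjunct1, THEN *] assms(1)
      assms(2)[unfolded deep_def, THEN conjunct2, THEN conjunct1, THEN *]
      assms(2)[unfolded deep_def, THEN conjunct2, THEN conjunct2, THEN conjunct1, THEN *]
      assms(2)[unfolded deep_def, THEN conjunct2, THEN conjunct2, THEN conjunct2, THEN conjunct1, THEN *]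
      assms(2)[unfolded deep_def, THEN conjunct2, THEN conjunct2, THEN conjunct2, THEN conjunct2, THEN conjunct1, THEN *]
      assms(2)[unfolded deep_def, THEN conjunct2, THEN conjunct2, THEN conjunct2, THEN conjunct2, THEN conjunct2, THEN *]
    unfolding deep_def by (simp add: algebra_simps)
qed

lemma far_scale:
  assumes "0 < L" "far \<delta> N T S (t / L) (x / L)"
  shows "far (\<delta> * L) (L * N) (L * T) (L * S) t x"
proof -
  have *: "a \<le> b \<Longrightarrow> L * a \<le> L * b" for a b using assms(1) by simp
  have "L * (t / L) = t" using assms(1) by simp
  then have e: "band_left (L * N) (L * T) (L * S) t = L * band_left N T S (t / L)"
    using band_left_scale[OF assms(1), of N T S "t / L"] by simp
  show ?thesis
    using assms(2) unfolding far_def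
  proof (elim disjE)
    assume "band_left N T S (t / L) + N + \<delta> \<le> x / L"
    from *[OF this] show "band_left (L * N) (L * T) (L * S) t + L * N + \<delta> * L \<le> x \<or>
        x + \<delta> * L \<le> band_left (L * N) (L * T) (L * S) t"
      using assms(1) by (simp add: e algebra_simps)
  next
    assume "x / L + \<delta> \<le> band_left N T S (t / L)"
    from *[OF this] show "band_left (L * N) (L * T) (L * S) t + L * N + \<delta> * L \<le> x \<or>
        x + \<delta> * L \<le> band_left (L * N) (L * T) (L * S) t"
      using assms(1) by (simp add: e algebra_simps)
  qed
qed

definition waterfall_depth :: "real \<Rightarrow> real \<Rightarrow> real \<Rightarrow> real \<times> real \<Rightarrow> real" where
  "waterfall_depth N T S = (\<lambda>(t, x). min (min (t - (N - S)) (t - (S - N)))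
     (min (min (N + S - t) (2 * T - N - S - t)) (min (N - (2 * x - S - t)) (N - (S + t - 2 * x)))))"

definition band_distance :: "real \<Rightarrow> real \<Rightarrow> real \<Rightarrow> real \<times> real \<Rightarrow> real" where
  "band_distance N T S = (\<lambda>(t, x). max (band_left N T S t - x) (x - (band_left N T S t + N)))"

lemma waterfall_depth_pos: "p \<in> waterfall N T S \<Longrightarrow> 0 < waterfall_depth N T S p"
  by (auto simp: waterfall_def waterfall_depth_def)

lemma deep_iff: "deep \<delta> N T S t x \<longleftrightarrow> \<delta> \<le> waterfall_depth N T S (t, x)"
  by (auto simp: deep_def waterfall_depth_def)

lemma band_distance_pos:
  assumes "p \<in> hexagon N T S" "p \<notin> path_band N T S"
  shows "0 < band_distance N T S p"
proof (cases p)
  case (Pair t x)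
  have "max (max 0 (t - T + S)) (min (min S t) ((S + t - N) / 2)) = band_left N T S t"
    by (simp add: band_left_def algebra_simps)
  then have "\<not> (band_left N T S t \<le> x \<and> x \<le> band_left N T S t + N)"
    using assms by (simp add: path_band_def Pair Let_def)
  then show ?thesis unfolding band_distance_def Pair by (simp add: less_max_iff_disj) linarith
qed

lemma far_iff: "far \<delta> N T S t x \<longleftrightarrow> \<delta> \<le> band_distance N T S (t, x)"
  by (auto simp: far_def band_distance_def le_max_iff_disj)

context qracah_limit
begin

lemma floor_close: "\<bar>of_int (\<lfloor>L * x\<rfloor> + d) - L * x\<bar> \<le> 1 + \<bar>of_int d :: real\<bar>"
  by linarith

lemma eventually_deep:
  assumes "(t, x) \<in> waterfall NN TT SS"
  shows "\<exists>\<delta>>0. \<forall>d. \<forall>\<^sub>F L in at_top. deepL \<delta> L \<lfloor>L * t\<rfloor> (\<lfloor>L * x\<rfloor> + d)"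
proof -
  define \<delta> where "\<delta> = waterfall_depth NN TT SS (t, x) / 2"
  have \<delta>: "0 < \<delta>" using waterfall_depth_pos[OF assms] by (simp add: \<delta>_def)
  have dp: "deep (2 * \<delta>) NN TT SS t x" by (simp add: deep_iff \<delta>_def)
  have "\<forall>\<^sub>F L in at_top. deepL \<delta> L \<lfloor>L * t\<rfloor> (\<lfloor>L * x\<rfloor> + d)" for d
    using eventually_gt_at_top[of 0] eventually_ge_linear[OF \<delta>, of "5 + 2 * \<bar>of_int d\<bar>"]
  proof eventually_elim
    case (elim L)
    have "deep (2 * \<delta>) NN TT SS (L * t / L) (L * x / L)" using dp elim by simp
    from deep_scale[OF elim(1) this] have s: "deep (2 * \<delta> * L) (L * NN) (L * TT) (L * SS) (L * t) (L * x)" .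
    have a: "\<bar>of_int \<lfloor>L * t\<rfloor> - L * t\<bar> \<le> 1" using floor_close[of L t 0] by simp
    note b = floor_close[of L x d]
    show ?case
      using s a b elim(2) unfolding deep_def abs_le_iff by (auto simp del: of_int_add simp: mult.commute) argo+
  qed
  then show ?thesis using \<delta> by blast
qed

lemma eventually_far:
  assumes "(t, x) \<in> hexagon NN TT SS" "(t, x) \<notin> path_band NN TT SS"
  shows "\<exists>\<delta>>0. \<forall>d. \<forall>\<^sub>F L in at_top. farL \<delta> L \<lfloor>L * t\<rfloor> (\<lfloor>L * x\<rfloor> + d)"
proof -
  define \<delta> where "\<delta> = band_distance NN TT SS (t, x) / 2"
  have \<delta>: "0 < \<delta>" using band_distance_pos[OF assms] by (simp add: \<delta>_def)
  have dp: "far (2 * \<delta>) NN TT SS t x" by (simp add: far_iff \<delta>_def)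
  have "\<forall>\<^sub>F L in at_top. farL \<delta> L \<lfloor>L * t\<rfloor> (\<lfloor>L * x\<rfloor> + d)" for d
    using eventually_gt_at_top[of 0] eventually_ge_linear[OF \<delta>, of "2 + \<bar>of_int d\<bar>"]
  proof eventually_elim
    case (elim L)
    have "far (2 * \<delta>) NN TT SS (L * t / L) (L * x / L)" using dp elim by simp
    from far_scale[OF elim(1) this] have s: "far (2 * \<delta> * L) (L * NN) (L * TT) (L * SS) (L * t) (L * x)" .
    have a: "\<bar>of_int \<lfloor>L * t\<rfloor> - L * t\<bar> \<le> 1" using floor_close[of L t 0] by simp
    have c: "\<bar>band_left (L * NN) (L * TT) (L * SS) (of_int \<lfloor>L * t\<rfloor>) - band_left (L * NN) (L * TT) (L * SS) (L * t)\<bar> \<le> 1"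
      using order.trans[OF band_left_lipschitz a] .
    note b = floor_close[of L x d]
    have e: "2 + \<bar>of_int d\<bar> \<le> \<delta> * L" using elim(2) by (simp add: mult.commute)
    show ?case using s unfolding far_def
      by (elim disjE) (use b c e in argo)+
  qed
  then show ?thesis using \<delta> by blast
qed

lemma kernel_limit:
  assumes tx: "(t, x) \<in> hexagon NN TT SS" "(t, x) \<notin> path_band NN TT SS - waterfall NN TT SS"
  shows "((\<lambda>L. kernelL L \<lfloor>L * t\<rfloor> (\<lfloor>L * x\<rfloor> + dx) (\<lfloor>L * x\<rfloor> + dy))
    \<longlongrightarrow> (if (t, x) \<in> waterfall NN TT SS then (if dx = dy then 1 else 0) else 0)) at_top"
proof (cases "(t, x) \<in> waterfall NN TT SS")
  case True
  obtain \<delta> where \<delta>: "0 < \<delta>" "\<And>d. \<forall>\<^sub>F L in at_top. deepL \<delta> L \<lfloor>L * t\<rfloor> (\<lfloor>L * x\<rfloor> + d)"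
    using eventually_deep[OF True] by blast
  obtain \<eta> where \<eta>: "0 < \<eta>" and ev: "\<forall>\<^sub>F L in at_top. deep_decay \<delta> \<eta> L"
    using deep_estimate[OF \<delta>(1)] by blast
  have "\<forall>\<^sub>F L in at_top. ((if dx = dy then 1 else 0) -
      kernelL L \<lfloor>L * t\<rfloor> (\<lfloor>L * x\<rfloor> + dx) (\<lfloor>L * x\<rfloor> + dy))\<^sup>2 \<le> exp (- \<eta> * L)"
    using ev \<delta>(2)[of dx] \<delta>(2)[of dy]
  proof eventually_elim
    case (elim L)
    have e: "\<lfloor>L * x\<rfloor> + dx = \<lfloor>L * x\<rfloor> + dy \<longleftrightarrow> dx = dy" by simp
    from elim(1)[rule_format, OF elim(3), THEN conjunct2, rule_format, OF elim(2)]
    show ?case unfolding e .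
  qed
  from tendsto_of_square_bound[OF \<eta> this] show ?thesis using True by simp
next
  case False
  then have "(t, x) \<notin> path_band NN TT SS" using tx by blast
  then obtain \<delta> where \<delta>: "0 < \<delta>" "\<And>d. \<forall>\<^sub>F L in at_top. farL \<delta> L \<lfloor>L * t\<rfloor> (\<lfloor>L * x\<rfloor> + d)"
    using eventually_far[OF tx(1)] by blast
  have t: "0 < t" "t < TT" using tx(1) by (auto simp: hexagon_def)
  have "\<forall>\<^sub>F L in at_top. (0 - kernelL L \<lfloor>L * t\<rfloor> (\<lfloor>L * x\<rfloor> + dx) (\<lfloor>L * x\<rfloor> + dy))\<^sup>2
      \<le> exp (- 1 * L)"
    using far_estimate[OF \<delta>(1)] \<delta>(2)[of dy] eventually_gt_at_top[of 0]
  proof eventually_elim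
    case (elim L)
    have "0 \<le> \<lfloor>L * t\<rfloor>" "\<lfloor>L * t\<rfloor> \<le> TL L" using t elim(3) by (auto intro!: floor_mono)
    from elim(1)[rule_format, OF this elim(2), THEN conjunct2] show ?case by simp
  qed
  from tendsto_of_square_bound[OF _ this] show ?thesis using False by simp
qed

lemma union_bound:
  assumes \<eta>: "0 < \<eta>"
    and ev: "\<forall>\<^sub>F L in at_top. \<forall>t x :: int. 0 \<le> t \<longrightarrow> t \<le> TL L \<longrightarrow> x \<in> sliceL L t \<longrightarrow>
      (of_int t / L, of_int x / L) \<in> C \<longrightarrow>
      probL L (\<lambda>p. x \<in> X L p t) \<le> exp (- \<eta> * L)"
    and X: "\<And>L p t. p \<in> path_ensembles (NL L) (TL L) (SL L) \<Longrightarrow> 0 \<le> t \<Longrightarrow> t \<le> TL L \<Longrightarrow>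
      X L p t \<subseteq> sliceL L t"
  shows "\<exists>A > 0. \<exists>c > 0. \<forall>\<^sub>F L in at_top. probL L
    (\<lambda>p. \<exists>t \<in> {0..TL L}. \<exists>x \<in> X L p t. (of_int t / L, of_int x / L) \<in> C) \<le> A * exp (- c * L)"
proof -
  define c where "c = \<eta> / 2"
  have c: "0 < c" using \<eta> by (simp add: c_def)
  define K where "K = 2 * TT * (SS + NN)"
  have TT0: "0 < TT" using params by linarith
  have "\<forall>\<^sub>F L in at_top. probL L
    (\<lambda>p. \<exists>t \<in> {0..TL L}. \<exists>x \<in> X L p t. (of_int t / L, of_int x / L) \<in> C) \<le> 1 * exp (- c * L)"
    using ev eventually_qracah poly_exp_bound(1)[OF c, of K] eventually_ge_linear[OF TT0, of 1]
  proof eventually_elim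
    case (elim L)
    define N T S where "N = NL L" and "T = TL L" and "S = SL L"
    have L: "0 < L" and base: "qracah q ((Im \<kappa>)\<^sup>2) N T S" and LT: "1 \<le> L * TT"
      using elim params by (simp_all add: N_def T_def S_def)
    interpret qracah q "(Im \<kappa>)\<^sup>2" N T S by (rule base)
    note fl = floors[of L, folded N_def T_def S_def]
    define A where "A = {i \<in> {0..T} \<times> {0..S + N - 1}. snd i \<in> slice N T S (fst i) \<and>
      (of_int (fst i) / L, of_int (snd i) / L) \<in> C}"
    have finA: "finite A" unfolding A_def by (rule finite_subset[of _ "{0..T} \<times> {0..S + N - 1}"]) auto
    have "qRacah_prob N T S q \<kappa> (\<lambda>p. \<exists>t \<in> {0..T}. \<exists>x \<in> X L p t. (of_int t / L, of_int x / L) \<in> C) \<le>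
        (\<Sum>i\<in>A. qRacah_prob N T S q \<kappa> (\<lambda>p. snd i \<in> X L p (fst i)))"
    proof (rule qRacah_prob_union[OF \<kappa> refl finA])
      fix p assume p: "p \<in> path_ensembles N T S"
        and "\<exists>t \<in> {0..T}. \<exists>x \<in> X L p t. (of_int t / L, of_int x / L) \<in> C"
      then obtain t x where tx: "t \<in> {0..T}" "x \<in> X L p t" "(of_int t / L, of_int x / L) \<in> C" by blast
      then have "x \<in> slice N T S t"
        using X[of p L t] p unfolding N_def T_def S_def by auto
      then have "(t, x) \<in> A" using tx by (auto simp: A_def slice_def)
      then show "\<exists>i\<in>A. snd i \<in> X L p (fst i)" using tx(2) by force
    qed
    also have "\<dots> \<le> (\<Sum>i\<in>A. exp (- \<eta> * L))"
      using elim(1) unfolding N_def[symmetric] T_def[symmetric] S_def[symmetric]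
      by (intro sum_mono) (auto simp: A_def)
    also have "\<dots> = card A * exp (- \<eta> * L)" by simp
    also have "\<dots> \<le> (K * L ^ 2) * exp (- \<eta> * L)"
    proof (rule mult_right_mono)
      have "card A \<le> card ({0..T} \<times> {0..S + N - 1})"
        unfolding A_def by (intro card_mono) auto
      also have "\<dots> = nat (T + 1) * nat (S + N)" by (simp add: card_cartesian_product)
      finally have "real (card A) \<le> of_int (T + 1) * of_int (S + N)"
        using S N by (simp add: of_nat_mono flip: of_nat_le_iff[where 'a = real])
      also have "\<dots> \<le> (2 * TT * L) * ((SS + NN) * L)"
        using fl LT S N by (intro mult_mono) (auto simp: algebra_simps)
      finally show "real (card A) \<le> K * L ^ 2" by (simp add: K_def power2_eq_square mult_ac)
    qed simp
    also have "\<dots> \<le> 1 * exp (- c * L)" using elim(3) by (simp add: c_def)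
    finally show ?case unfolding N_def T_def S_def .
  qed
  then show ?thesis using c by (intro exI[of _ 1] conjI exI[of _ c]) auto
qed

lemma hole_bound:
  assumes C: "compact C" "C \<subseteq> waterfall NN TT SS"
  shows "\<exists>A > 0. \<exists>c > 0. \<forall>\<^sub>F L in at_top. probL L
    (\<lambda>p. \<exists>t \<in> {0..TL L}. \<exists>x \<in> holesL L p t. (of_int t / L, of_int x / L) \<in> C)
      \<le> A * exp (- c * L)"
proof -
  have "continuous_on C (waterfall_depth NN TT SS)"
    unfolding waterfall_depth_def case_prod_unfold by (intro continuous_intros)
  from positive_margin[OF C(1) this] obtain \<delta> where \<delta>: "0 < \<delta>" "\<And>p. p \<in> C \<Longrightarrow> \<delta> \<le> waterfall_depth NN TT SS p"
    using waterfall_depth_pos C(2) by blast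
  obtain \<eta> where \<eta>: "0 < \<eta>" and ev: "\<forall>\<^sub>F L in at_top. deep_decay \<delta> \<eta> L"
    using deep_estimate[OF \<delta>(1)] by blast
  show ?thesis
  proof (rule union_bound[OF \<eta>])
    show "\<forall>\<^sub>F L in at_top. \<forall>t x :: int. 0 \<le> t \<longrightarrow> t \<le> TL L \<longrightarrow> x \<in> sliceL L t \<longrightarrow>
      (of_int t / L, of_int x / L) \<in> C \<longrightarrow>
      probL L (\<lambda>p. x \<in> holesL L p t) \<le> exp (- \<eta> * L)"
      using ev eventually_gt_at_top[of 0]
    proof eventually_elim
      case (elim L)
      show ?case
      proof (intro allI impI)
        fix t x :: int assume "(of_int t / L, of_int x / L) \<in> C"
        from \<delta>(2)[OF this] have "deepL \<delta> L t x"
          by (intro deep_scale elim(2)) (simp add: deep_iff)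
        with elim(1) show "probL L (\<lambda>p. x \<in> holesL L p t) \<le> exp (- \<eta> * L)"
          by blast
      qed
    qed
  qed (auto simp: holes_def)
qed

lemma particle_bound:
  assumes C: "compact C" "C \<subseteq> hexagon NN TT SS - (waterfall NN TT SS \<union> path_band NN TT SS)"
  shows "\<exists>A > 0. \<exists>c > 0. \<forall>\<^sub>F L in at_top. probL L
    (\<lambda>p. \<exists>t \<in> {0..TL L}. \<exists>x \<in> positions (NL L) p t. (of_int t / L, of_int x / L) \<in> C)
      \<le> A * exp (- c * L)"
proof -
  have "continuous_on C (band_distance NN TT SS)"
    unfolding band_distance_def band_left_def case_prod_unfold by (intro continuous_intros) auto
  from positive_margin[OF C(1) this] obtain \<delta> where \<delta>: "0 < \<delta>" "\<And>p. p \<in> C \<Longrightarrow> \<delta> \<le> band_distance NN TT SS p"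
    using band_distance_pos C(2) by blast
  show ?thesis
  proof (rule union_bound[where \<eta> = 1])
    show "\<forall>\<^sub>F L in at_top. \<forall>t x :: int. 0 \<le> t \<longrightarrow> t \<le> TL L \<longrightarrow> x \<in> sliceL L t \<longrightarrow>
      (of_int t / L, of_int x / L) \<in> C \<longrightarrow>
      probL L (\<lambda>p. x \<in> positions (NL L) p t) \<le> exp (- 1 * L)"
      using far_estimate[OF \<delta>(1)] eventually_gt_at_top[of 0]
    proof eventually_elim
      case (elim L)
      show ?case
      proof (intro allI impI)
        fix t x :: int assume tx: "0 \<le> t" "t \<le> TL L" "x \<in> sliceL L t"
          and "(of_int t / L, of_int x / L) \<in> C"
        from \<delta>(2)[OF this(4)] have "farL \<delta> L t x"
          by (intro far_scale elim(2)) (simp add: far_iff)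
        with elim(1) tx show "probL L (\<lambda>p. x \<in> positions (NL L) p t) \<le> exp (- 1 * L)"
          by simp
      qed
    qed
  qed (use positions_subset_slice in auto)
qed

end

theorem theorem1p4:
  fixes TT SS NN q :: real and \<kappa> :: complex
  assumes "SS > 0" and "TT > SS" and "0 < NN" and "NN < TT"
    and "0 < q" and "q < 1"
    and "Re \<kappa> = 0" and "Im \<kappa> > 0"
  shows
    "(\<forall>t x. (t, x) \<in> hexagon NN TT SS \<and> (t, x) \<notin> path_band NN TT SS - waterfall NN TT SS \<longrightarrow>
        (\<forall>\<Delta>x \<Delta>y :: int.
          ((\<lambda>L :: real.
              corr_kernel \<lfloor>L * NN\<rfloor> \<lfloor>L * TT\<rfloor> \<lfloor>L * SS\<rfloor> q \<kappa> \<lfloor>L * t\<rfloor> (\<lfloor>L * x\<rfloor> + \<Delta>x) (\<lfloor>L * x\<rfloor> + \<Delta>y))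
            \<longlongrightarrow> (if (t, x) \<in> waterfall NN TT SS then (if \<Delta>x = \<Delta>y then 1 else 0) else 0)) at_top))
     \<and>
     (\<forall>C. compact C \<and> C \<subseteq> waterfall NN TT SS \<longrightarrow>
        (\<exists>A > 0. \<exists>c > 0. \<forall>\<^sub>F L :: real in at_top.
           qRacah_prob \<lfloor>L * NN\<rfloor> \<lfloor>L * TT\<rfloor> \<lfloor>L * SS\<rfloor> q \<kappa>
             (\<lambda>p. \<exists>t \<in> {0..\<lfloor>L * TT\<rfloor>}. \<exists>x \<in> holes \<lfloor>L * NN\<rfloor> \<lfloor>L * TT\<rfloor> \<lfloor>L * SS\<rfloor> p t.
                    (of_int t / L, of_int x / L) \<in> C)
           \<le> A * exp (- c * L)))
     \<and>
     (\<forall>C. compact C \<and> C \<subseteq> hexagon NN TT SS - (waterfall NN TT SS \<union> path_band NN TT SS) \<longrightarrow>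
        (\<exists>A > 0. \<exists>c > 0. \<forall>\<^sub>F L :: real in at_top.
           qRacah_prob \<lfloor>L * NN\<rfloor> \<lfloor>L * TT\<rfloor> \<lfloor>L * SS\<rfloor> q \<kappa>
             (\<lambda>p. \<exists>t \<in> {0..\<lfloor>L * TT\<rfloor>}. \<exists>x \<in> positions \<lfloor>L * NN\<rfloor> p t.
                    (of_int t / L, of_int x / L) \<in> C)
           \<le> A * exp (- c * L)))"
proof -
  interpret qracah_limit TT SS NN q \<kappa>
    using assms by unfold_locales
  show ?thesis
    using kernel_limit hole_bound particle_bound by blast
qed

end
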